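(* Let $A$ and $H$ be two Hopf algebras. Then any coalgebra split extension $(E, \pi)$ of $A$ by $H$ is equivalent to a crossed product extension $(A \#_{f}^{\triangleright} H, \pi_H)$ of $A$ by $H$ (for some crossed system of Hopf algebras $(A,H,\triangleright,f)$).
   Context: All objects are over an arbitrary field $k$; Sweedler notation is used. A coalgebra split extension of $A$ by $H$ is a pair $(E,\pi)$ consisting of a Hopf algebra $E$ that fits into a sequence $A\stackrel{i}{\hookrightarrow}E\stackrel{\pi}{\to}H$, where $i$ is an injective Hopf algebra map and $\pi:E\to H$ is a morphism of Hopf algebras which has a section that is a coalgebra map, and $A\simeq E^{{\rm co}(H)}:=\{x\in E\mid x_{(1)}\otimes\pi(x_{(2)})=x\otimes 1\}$ (via $i$). Two coalgebra split extensions $(E,\pi)$, $(E',\pi')$ of $A$ by $H$ (with inclusions $i$, $i'$) are equivalent if there is an isomorphism of Hopf algebras $\psi:E\to E'$ with $\psi\circ i=i'$ and $\pi'\circ\psi=\pi$. A weak action of $H$ on $A$ is a $k$-linear map $\triangleright: H\otimes A\to A$ with $h\triangleright 1_A=\varepsilon_H(h)1_A$, $1_H\triangleright a=a$, and $h\triangleright(ab)=(h_{(1)}\triangleright a)(h_{(2)}\triangleright b)$. Given a weak action $\triangleright$ and a $k$-linear map $f:H\otimes H\to A$ (write $f(g,h)=f(g\otimes h)$), $A\#_f^{\triangleright}H$ denotes the vector space $A\otimes H$ (write $a\#h$ for $a\otimes h$) with multiplication $(a\#h)\cdot(c\#g):=a(h_{(1)}\triangleright c)f(h_{(2)},g_{(1)})\#h_{(3)}g_{(2)}$.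 $(A,H,\triangleright,f)$ is a crossed system of Hopf algebras, and $A\#_f^{\triangleright}H$ a crossed product of Hopf algebras, if $A\#_f^{\triangleright}H$ is a Hopf algebra with this multiplication, unit $1_A\#1_H$ and the tensor product coalgebra structure. It is regarded as a coalgebra split extension of $A$ by $H$ via the Hopf algebra maps $i_A:A\to A\#_f^{\triangleright}H$, $i_A(a)=a\#1_H$, and $\pi_H:A\#_f^{\triangleright}H\to H$, $\pi_H(a\#h)=\varepsilon_A(a)h$. *)

theory Defs
  imports "HOL-Algebra.Module" "HOL-Algebra.AbelCoset"
begin

section \<open>Vector spaces, linear maps, algebras\<close>

text \<open>
  The ground field is a record \<open>K\<close> with \<^term>\<open>field K\<close>. Vector spaces and algebras over it are
  \<open>module\<close> records; a plain vector space simply leaves the fields \<open>mult\<close> and \<open>one\<close> unused.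
  (The locale \<^locale>\<open>algebra\<close> of HOL-Algebra is for commutative algebras only.)
\<close>

definition k_space :: "('k, 'l) ring_scheme \<Rightarrow> ('k, 'a, 'm) module_scheme \<Rightarrow> bool" where
  "k_space K V \<longleftrightarrow> field K \<and> module K V"

definition lin_maps ::
  "('k, 'l) ring_scheme \<Rightarrow> ('k, 'a, 'm) module_scheme \<Rightarrow> ('k, 'b, 'n) module_scheme \<Rightarrow> ('a \<Rightarrow> 'b) set"
where
  "lin_maps K V W = {f \<in> carrier V \<rightarrow> carrier W.
     (\<forall>x\<in>carrier V. \<forall>y\<in>carrier V. f (x \<oplus>\<^bsub>V\<^esub> y) = f x \<oplus>\<^bsub>W\<^esub> f y) \<and>
     (\<forall>c\<in>carrier K. \<forall>x\<in>carrier V. f (c \<odot>\<^bsub>V\<^esub> x) = c \<odot>\<^bsub>W\<^esub> f x)}"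

definition k_algebra :: "('k, 'l) ring_scheme \<Rightarrow> ('k, 'a, 'm) module_scheme \<Rightarrow> bool" where
  "k_algebra K A \<longleftrightarrow> k_space K A \<and> ring A \<and>
     (\<forall>c\<in>carrier K. \<forall>x\<in>carrier A. \<forall>y\<in>carrier A.
        (c \<odot>\<^bsub>A\<^esub> x) \<otimes>\<^bsub>A\<^esub> y = c \<odot>\<^bsub>A\<^esub> (x \<otimes>\<^bsub>A\<^esub> y) \<and>
        x \<otimes>\<^bsub>A\<^esub> (c \<odot>\<^bsub>A\<^esub> y) = c \<odot>\<^bsub>A\<^esub> (x \<otimes>\<^bsub>A\<^esub> y))"

definition scalars :: "('k, 'l) ring_scheme \<Rightarrow> ('k, 'k) module" where
  "scalars K = \<lparr>carrier = carrier K, mult = mult K, one = one K, zero = zero K, add = add K,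
                smult = mult K\<rparr>"

section \<open>Tensor products\<close>

text \<open>
  \<open>V \<otimes> W\<close> is the free vector space on \<open>carrier V \<times> carrier W\<close> modulo the subspace generated by the
  bilinearity relations. Its elements are cosets of finitely supported functions.
\<close>

definition free_space :: "('k, 'l) ring_scheme \<Rightarrow> 's set \<Rightarrow> ('k, 's \<Rightarrow> 'k) module" where
  "free_space K S =
     \<lparr>carrier = {r. (\<forall>p\<in>S. r p \<in> carrier K) \<and> (\<forall>p. p \<notin> S \<longrightarrow> r p = \<zero>\<^bsub>K\<^esub>) \<and>
                    finite {p. r p \<noteq> \<zero>\<^bsub>K\<^esub>}},
      mult = undefined, one = undefined,
      zero = (\<lambda>p. \<zero>\<^bsub>K\<^esub>),
      add = (\<lambda>r s p. r p \<oplus>\<^bsub>K\<^esub> s p),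
      smult = (\<lambda>c r p. c \<otimes>\<^bsub>K\<^esub> r p)\<rparr>"

definition free_basis :: "('k, 'l) ring_scheme \<Rightarrow> 's \<Rightarrow> 's \<Rightarrow> 'k" where
  "free_basis K p = (\<lambda>q. if q = p then \<one>\<^bsub>K\<^esub> else \<zero>\<^bsub>K\<^esub>)"

definition tensor_relators ::
  "('k, 'l) ring_scheme \<Rightarrow> ('k, 'a, 'm) module_scheme \<Rightarrow> ('k, 'b, 'n) module_scheme
     \<Rightarrow> ('a \<times> 'b \<Rightarrow> 'k) set"
where
  "tensor_relators K V W =
     (let F = free_space K (carrier V \<times> carrier W); e = (\<lambda>v w. free_basis K (v, w)) in
       {e (v \<oplus>\<^bsub>V\<^esub> v') w \<ominus>\<^bsub>F\<^esub> (e v w \<oplus>\<^bsub>F\<^esub> e v' w) | v v' w.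
          v \<in> carrier V \<and> v' \<in> carrier V \<and> w \<in> carrier W} \<union>
       {e v (w \<oplus>\<^bsub>W\<^esub> w') \<ominus>\<^bsub>F\<^esub> (e v w \<oplus>\<^bsub>F\<^esub> e v w') | v w w'.
          v \<in> carrier V \<and> w \<in> carrier W \<and> w' \<in> carrier W} \<union>
       {e (c \<odot>\<^bsub>V\<^esub> v) w \<ominus>\<^bsub>F\<^esub> (c \<odot>\<^bsub>F\<^esub> e v w) | c v w.
          c \<in> carrier K \<and> v \<in> carrier V \<and> w \<in> carrier W} \<union>
       {e v (c \<odot>\<^bsub>W\<^esub> w) \<ominus>\<^bsub>F\<^esub> (c \<odot>\<^bsub>F\<^esub> e v w) | c v w.
          c \<in> carrier K \<and> v \<in> carrier V \<and> w \<in> carrier W})"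

definition tensor_null ::
  "('k, 'l) ring_scheme \<Rightarrow> ('k, 'a, 'm) module_scheme \<Rightarrow> ('k, 'b, 'n) module_scheme
     \<Rightarrow> ('a \<times> 'b \<Rightarrow> 'k) set"
where
  "tensor_null K V W =
     \<Inter> {N. submodule N K (free_space K (carrier V \<times> carrier W)) \<and> tensor_relators K V W \<subseteq> N}"

definition pure_tensor ::
  "('k, 'l) ring_scheme \<Rightarrow> ('k, 'a, 'm) module_scheme \<Rightarrow> ('k, 'b, 'n) module_scheme
     \<Rightarrow> 'a \<Rightarrow> 'b \<Rightarrow> ('a \<times> 'b \<Rightarrow> 'k) set"
where
  "pure_tensor K V W v w =
     tensor_null K V W +>\<^bsub>free_space K (carrier V \<times> carrier W)\<^esub> free_basis K (v, w)"

definition tensor_space ::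
  "('k, 'l) ring_scheme \<Rightarrow> ('k, 'a, 'm) module_scheme \<Rightarrow> ('k, 'b, 'n) module_scheme
     \<Rightarrow> ('k, ('a \<times> 'b \<Rightarrow> 'k) set) module"
where
  "tensor_space K V W =
     (let F = free_space K (carrier V \<times> carrier W); N = tensor_null K V W in
      \<lparr>carrier = a_rcosets\<^bsub>F\<^esub> N,
       mult = undefined, one = undefined,
       zero = N,
       add = (\<lambda>X Y. X <+>\<^bsub>F\<^esub> Y),
       smult = (\<lambda>c X. \<Union>x\<in>X. N +>\<^bsub>F\<^esub> (c \<odot>\<^bsub>F\<^esub> x))\<rparr>)"

text \<open>
  The linear map \<open>V \<otimes> W \<rightarrow> M\<close>, \<open>v \<otimes> w \<mapsto> b v w\<close>, induced by a map \<open>b\<close> that is bilinear on the carriers.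
  It is computed from an arbitrary representative of the coset \<open>x\<close>; bilinearity of \<open>b\<close> makes the
  result independent of it. It is applied below to bilinear \<open>b\<close> only.
\<close>

definition tensor_lift ::
  "('k, 'l) ring_scheme \<Rightarrow> ('k, 'c, 'm) module_scheme \<Rightarrow> ('a \<Rightarrow> 'b \<Rightarrow> 'c) \<Rightarrow> ('a \<times> 'b \<Rightarrow> 'k) set \<Rightarrow> 'c"
where
  "tensor_lift K M b x =
     (let r = (SOME r. r \<in> x) in
      finsum M (\<lambda>p. r p \<odot>\<^bsub>M\<^esub> b (fst p) (snd p)) {p. r p \<noteq> \<zero>\<^bsub>K\<^esub>})"

text \<open>The tensor product of algebras: \<open>(a \<otimes> b)(a' \<otimes> b') = aa' \<otimes> bb'\<close>.\<close>

definition tensor_algebra ::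
  "('k, 'l) ring_scheme \<Rightarrow> ('k, 'a, 'm) module_scheme \<Rightarrow> ('k, 'b, 'n) module_scheme
     \<Rightarrow> ('k, ('a \<times> 'b \<Rightarrow> 'k) set) module"
where
  "tensor_algebra K A B =
     (tensor_space K A B)
       \<lparr>mult := (\<lambda>x y.
          tensor_lift K (tensor_space K A B) (\<lambda>a b.
            tensor_lift K (tensor_space K A B) (\<lambda>a' b'.
              pure_tensor K A B (a \<otimes>\<^bsub>A\<^esub> a') (b \<otimes>\<^bsub>B\<^esub> b')) y) x),
        one := pure_tensor K A B \<one>\<^bsub>A\<^esub> \<one>\<^bsub>B\<^esub>\<rparr>"

section \<open>Coalgebras, bialgebras, Hopf algebras\<close>

record ('k, 'a) bialg = "('k, 'a) module" +
  comult :: "'a \<Rightarrow> ('a \<times> 'a \<Rightarrow> 'k) set" (\<open>\<Delta>\<index>\<close>)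
  counit :: "'a \<Rightarrow> 'k" (\<open>\<epsilon>\<index>\<close>)

text \<open>
  Sweedler notation: \<open>sweedler K C M (\<lambda>x\<^sub>1 x\<^sub>2. b x\<^sub>1 x\<^sub>2) x\<close> is \<open>b x\<^sub>(\<^sub>1\<^sub>) x\<^sub>(\<^sub>2\<^sub>)\<close> for a bilinear map \<open>b\<close>
  with values in \<open>M\<close>.
\<close>

definition sweedler ::
  "('k, 'l) ring_scheme \<Rightarrow> ('k, 'a, 'n) bialg_scheme \<Rightarrow> ('k, 'c, 'm) module_scheme
     \<Rightarrow> ('a \<Rightarrow> 'a \<Rightarrow> 'c) \<Rightarrow> 'a \<Rightarrow> 'c"
where
  "sweedler K C M b x = tensor_lift K M b (\<Delta>\<^bsub>C\<^esub> x)"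

definition sweedler3 ::
  "('k, 'l) ring_scheme \<Rightarrow> ('k, 'a, 'n) bialg_scheme \<Rightarrow> ('k, 'c, 'm) module_scheme
     \<Rightarrow> ('a \<Rightarrow> 'a \<Rightarrow> 'a \<Rightarrow> 'c) \<Rightarrow> 'a \<Rightarrow> 'c"
where
  "sweedler3 K C M b x = sweedler K C M (\<lambda>x\<^sub>1 y. sweedler K C M (\<lambda>x\<^sub>2 x\<^sub>3. b x\<^sub>1 x\<^sub>2 x\<^sub>3) y) x"

text \<open>Coassociativity is stated in \<open>C \<otimes> (C \<otimes> C)\<close>.\<close>

definition coalgebra :: "('k, 'l) ring_scheme \<Rightarrow> ('k, 'a, 'm) bialg_scheme \<Rightarrow> bool" where
  "coalgebra K C \<longleftrightarrow>
     k_space K C \<and>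
     \<Delta>\<^bsub>C\<^esub> \<in> lin_maps K C (tensor_space K C C) \<and>
     \<epsilon>\<^bsub>C\<^esub> \<in> lin_maps K C (scalars K) \<and>
     (let CC = tensor_space K C C; CCC = tensor_space K C CC in
      \<forall>x\<in>carrier C.
        sweedler K C CCC (\<lambda>x\<^sub>1 x\<^sub>2. pure_tensor K C CC x\<^sub>1 (\<Delta>\<^bsub>C\<^esub> x\<^sub>2)) x =
        sweedler K C CCC (\<lambda>y x\<^sub>3. sweedler K C CCC (\<lambda>x\<^sub>1 x\<^sub>2.
          pure_tensor K C CC x\<^sub>1 (pure_tensor K C C x\<^sub>2 x\<^sub>3)) y) x) \<and>
     (\<forall>x\<in>carrier C.
        sweedler K C C (\<lambda>x\<^sub>1 x\<^sub>2. \<epsilon>\<^bsub>C\<^esub> x\<^sub>1 \<odot>\<^bsub>C\<^esub> x\<^sub>2) x = x \<and>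
        sweedler K C C (\<lambda>x\<^sub>1 x\<^sub>2. \<epsilon>\<^bsub>C\<^esub> x\<^sub>2 \<odot>\<^bsub>C\<^esub> x\<^sub>1) x = x)"

definition coalgebra_maps ::
  "('k, 'l) ring_scheme \<Rightarrow> ('k, 'a, 'm) bialg_scheme \<Rightarrow> ('k, 'b, 'n) bialg_scheme \<Rightarrow> ('a \<Rightarrow> 'b) set"
where
  "coalgebra_maps K C D = {f \<in> lin_maps K C D. \<forall>x\<in>carrier C.
     \<Delta>\<^bsub>D\<^esub> (f x) = sweedler K C (tensor_space K D D) (\<lambda>x\<^sub>1 x\<^sub>2. pure_tensor K D D (f x\<^sub>1) (f x\<^sub>2)) x \<and>
     \<epsilon>\<^bsub>D\<^esub> (f x) = \<epsilon>\<^bsub>C\<^esub> x}"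

definition bialgebra :: "('k, 'l) ring_scheme \<Rightarrow> ('k, 'a, 'm) bialg_scheme \<Rightarrow> bool" where
  "bialgebra K B \<longleftrightarrow> k_algebra K B \<and> coalgebra K B \<and>
     \<Delta>\<^bsub>B\<^esub> \<in> ring_hom B (tensor_algebra K B B) \<and> \<epsilon>\<^bsub>B\<^esub> \<in> ring_hom B K"

definition antipode ::
  "('k, 'l) ring_scheme \<Rightarrow> ('k, 'a, 'm) bialg_scheme \<Rightarrow> ('a \<Rightarrow> 'a) \<Rightarrow> bool"
where
  "antipode K B S \<longleftrightarrow> S \<in> lin_maps K B B \<and> (\<forall>x\<in>carrier B.
     sweedler K B B (\<lambda>x\<^sub>1 x\<^sub>2. S x\<^sub>1 \<otimes>\<^bsub>B\<^esub> x\<^sub>2) x = \<epsilon>\<^bsub>B\<^esub> x \<odot>\<^bsub>B\<^esub> \<one>\<^bsub>B\<^esub> \<and>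
     sweedler K B B (\<lambda>x\<^sub>1 x\<^sub>2. x\<^sub>1 \<otimes>\<^bsub>B\<^esub> S x\<^sub>2) x = \<epsilon>\<^bsub>B\<^esub> x \<odot>\<^bsub>B\<^esub> \<one>\<^bsub>B\<^esub>)"

text \<open>
  Antipodes are unique, so being a Hopf algebra is a property of a bialgebra, and bialgebra maps
  between Hopf algebras automatically commute with the antipodes.
\<close>

definition hopf_algebra :: "('k, 'l) ring_scheme \<Rightarrow> ('k, 'a, 'm) bialg_scheme \<Rightarrow> bool" where
  "hopf_algebra K B \<longleftrightarrow> bialgebra K B \<and> (\<exists>S. antipode K B S)"

definition hopf_maps ::
  "('k, 'l) ring_scheme \<Rightarrow> ('k, 'a, 'm) bialg_scheme \<Rightarrow> ('k, 'b, 'n) bialg_scheme \<Rightarrow> ('a \<Rightarrow> 'b) set"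
where
  "hopf_maps K A B = ring_hom A B \<inter> coalgebra_maps K A B"

definition hopf_isos ::
  "('k, 'l) ring_scheme \<Rightarrow> ('k, 'a, 'm) bialg_scheme \<Rightarrow> ('k, 'b, 'n) bialg_scheme \<Rightarrow> ('a \<Rightarrow> 'b) set"
where
  "hopf_isos K A B = {f \<in> hopf_maps K A B. bij_betw f (carrier A) (carrier B)}"

section \<open>Coalgebra split extensions\<close>

definition coinvariants ::
  "('k, 'l) ring_scheme \<Rightarrow> ('k, 'e, 'm) bialg_scheme \<Rightarrow> ('k, 'h, 'n) bialg_scheme \<Rightarrow> ('e \<Rightarrow> 'h) \<Rightarrow> 'e set"
where
  "coinvariants K E H \<pi> = {x \<in> carrier E.
     sweedler K E (tensor_space K E H) (\<lambda>x\<^sub>1 x\<^sub>2. pure_tensor K E H x\<^sub>1 (\<pi> x\<^sub>2)) x =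
     pure_tensor K E H x \<one>\<^bsub>H\<^esub>}"

definition coalgebra_split_extension ::
  "('k, 'l) ring_scheme \<Rightarrow> ('k, 'a, 'm) bialg_scheme \<Rightarrow> ('k, 'h, 'n) bialg_scheme
     \<Rightarrow> ('k, 'e, 'o) bialg_scheme \<Rightarrow> ('a \<Rightarrow> 'e) \<Rightarrow> ('e \<Rightarrow> 'h) \<Rightarrow> bool"
where
  "coalgebra_split_extension K A H E i \<pi> \<longleftrightarrow>
     hopf_algebra K E \<and>
     i \<in> hopf_maps K A E \<and> inj_on i (carrier A) \<and>
     \<pi> \<in> hopf_maps K E H \<and>
     (\<exists>\<phi>\<in>coalgebra_maps K H E. \<forall>h\<in>carrier H. \<pi> (\<phi> h) = h) \<and>
     i ` carrier A = coinvariants K E H \<pi>"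

definition equivalent_extensions ::
  "('k, 'l) ring_scheme \<Rightarrow> ('k, 'a, 'm) bialg_scheme \<Rightarrow> ('k, 'h, 'n) bialg_scheme
     \<Rightarrow> ('k, 'e, 'o) bialg_scheme \<Rightarrow> ('a \<Rightarrow> 'e) \<Rightarrow> ('e \<Rightarrow> 'h)
     \<Rightarrow> ('k, 'f, 'p) bialg_scheme \<Rightarrow> ('a \<Rightarrow> 'f) \<Rightarrow> ('f \<Rightarrow> 'h) \<Rightarrow> bool"
where
  "equivalent_extensions K A H E i \<pi> E' i' \<pi>' \<longleftrightarrow>
     coalgebra_split_extension K A H E i \<pi> \<and>
     coalgebra_split_extension K A H E' i' \<pi>' \<and>
     (\<exists>\<psi>\<in>hopf_isos K E E'. (\<forall>a\<in>carrier A. \<psi> (i a) = i' a) \<and> (\<forall>x\<in>carrier E. \<pi>' (\<psi> x) = \<pi> x))"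

section \<open>Crossed products\<close>

definition weak_action ::
  "('k, 'l) ring_scheme \<Rightarrow> ('k, 'a, 'm) bialg_scheme \<Rightarrow> ('k, 'h, 'n) bialg_scheme
     \<Rightarrow> (('h \<times> 'a \<Rightarrow> 'k) set \<Rightarrow> 'a) \<Rightarrow> bool"
where
  "weak_action K A H act \<longleftrightarrow>
     act \<in> lin_maps K (tensor_space K H A) A \<and>
     (let app = (\<lambda>h a. act (pure_tensor K H A h a)) in
       (\<forall>h\<in>carrier H. app h \<one>\<^bsub>A\<^esub> = \<epsilon>\<^bsub>H\<^esub> h \<odot>\<^bsub>A\<^esub> \<one>\<^bsub>A\<^esub>) \<and>
       (\<forall>a\<in>carrier A. app \<one>\<^bsub>H\<^esub> a = a) \<and>
       (\<forall>h\<in>carrier H. \<forall>a\<in>carrier A. \<forall>b\<in>carrier A.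
          app h (a \<otimes>\<^bsub>A\<^esub> b) = sweedler K H A (\<lambda>h\<^sub>1 h\<^sub>2. app h\<^sub>1 a \<otimes>\<^bsub>A\<^esub> app h\<^sub>2 b) h))"

definition tensor_coalgebra ::
  "('k, 'l) ring_scheme \<Rightarrow> ('k, 'a, 'm) bialg_scheme \<Rightarrow> ('k, 'h, 'n) bialg_scheme
     \<Rightarrow> ('k, ('a \<times> 'h \<Rightarrow> 'k) set) bialg"
where
  "tensor_coalgebra K A H =
     (let T = tensor_space K A H; TT = tensor_space K T T in
      module.extend T
       \<lparr>comult = tensor_lift K TT (\<lambda>a h.
          sweedler K A TT (\<lambda>a\<^sub>1 a\<^sub>2. sweedler K H TT (\<lambda>h\<^sub>1 h\<^sub>2.
            pure_tensor K T T (pure_tensor K A H a\<^sub>1 h\<^sub>1) (pure_tensor K A H a\<^sub>2 h\<^sub>2)) h) a),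
        counit = tensor_lift K (scalars K) (\<lambda>a h. \<epsilon>\<^bsub>A\<^esub> a \<otimes>\<^bsub>K\<^esub> \<epsilon>\<^bsub>H\<^esub> h)\<rparr>)"

text \<open>
  The product is \<open>(a # h)(c # g) = a (h\<^sub>(\<^sub>1\<^sub>) \<triangleright> c) f(h\<^sub>(\<^sub>2\<^sub>), g\<^sub>(\<^sub>1\<^sub>)) # h\<^sub>(\<^sub>3\<^sub>) g\<^sub>(\<^sub>2\<^sub>)\<close>, extended bilinearly.
\<close>

definition crossed_product ::
  "('k, 'l) ring_scheme \<Rightarrow> ('k, 'a, 'm) bialg_scheme \<Rightarrow> ('k, 'h, 'n) bialg_scheme
     \<Rightarrow> (('h \<times> 'a \<Rightarrow> 'k) set \<Rightarrow> 'a) \<Rightarrow> (('h \<times> 'h \<Rightarrow> 'k) set \<Rightarrow> 'a)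
     \<Rightarrow> ('k, ('a \<times> 'h \<Rightarrow> 'k) set) bialg"
where
  "crossed_product K A H act f =
     (let T = tensor_space K A H in
      (tensor_coalgebra K A H)
       \<lparr>mult := (\<lambda>x y.
          tensor_lift K T (\<lambda>a h. tensor_lift K T (\<lambda>c g.
            sweedler3 K H T (\<lambda>h\<^sub>1 h\<^sub>2 h\<^sub>3. sweedler K H T (\<lambda>g\<^sub>1 g\<^sub>2.
              pure_tensor K A H
                (a \<otimes>\<^bsub>A\<^esub> act (pure_tensor K H A h\<^sub>1 c) \<otimes>\<^bsub>A\<^esub> f (pure_tensor K H H h\<^sub>2 g\<^sub>1))
                (h\<^sub>3 \<otimes>\<^bsub>H\<^esub> g\<^sub>2)) g) h) y) x),
        one := pure_tensor K A H \<one>\<^bsub>A\<^esub> \<one>\<^bsub>H\<^esub>\<rparr>)"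

definition crossed_system ::
  "('k, 'l) ring_scheme \<Rightarrow> ('k, 'a, 'm) bialg_scheme \<Rightarrow> ('k, 'h, 'n) bialg_scheme
     \<Rightarrow> (('h \<times> 'a \<Rightarrow> 'k) set \<Rightarrow> 'a) \<Rightarrow> (('h \<times> 'h \<Rightarrow> 'k) set \<Rightarrow> 'a) \<Rightarrow> bool"
where
  "crossed_system K A H act f \<longleftrightarrow>
     weak_action K A H act \<and> f \<in> lin_maps K (tensor_space K H H) A \<and>
     hopf_algebra K (crossed_product K A H act f)"

definition crossed_incl ::
  "('k, 'l) ring_scheme \<Rightarrow> ('k, 'a, 'm) bialg_scheme \<Rightarrow> ('k, 'h, 'n) bialg_scheme
     \<Rightarrow> 'a \<Rightarrow> ('a \<times> 'h \<Rightarrow> 'k) set"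
where
  "crossed_incl K A H a = pure_tensor K A H a \<one>\<^bsub>H\<^esub>"

definition crossed_proj ::
  "('k, 'l) ring_scheme \<Rightarrow> ('k, 'a, 'm) bialg_scheme \<Rightarrow> ('k, 'h, 'n) bialg_scheme
     \<Rightarrow> ('a \<times> 'h \<Rightarrow> 'k) set \<Rightarrow> 'h"
where
  "crossed_proj K A H = tensor_lift K H (\<lambda>a h. \<epsilon>\<^bsub>A\<^esub> a \<odot>\<^bsub>H\<^esub> h)"


end

theory Submission
  imports Defs
begin

text \<open>
Let \<open>\<phi>\<close> be a section of \<open>\<pi>\<close> that is a coalgebra map. Multiplying by the inverse of the grouplike element
\<open>\<phi> 1\<close> makes it unital (lemma \<open>unital_section\<close>). Being a coalgebra map, it is convolution
invertible with inverse \<open>S \<phi>\<close>, where \<open>S\<close> is the antipode of \<open>E\<close>. The map \<open>q x = x\<^sub>1 S(\<phi>(\<pi> x\<^sub>2))\<close> therefore satisfies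
\<open>x = q(x\<^sub>1) \<phi>(\<pi> x\<^sub>2)\<close>, and it takes values in the coinvariants, that is, in the image of \<open>A\<close>. So every
element of \<open>E\<close> splits into a part from \<open>A\<close> and a part from \<open>H\<close>, and \<open>\<psi>(a # h) = i(a) \<phi>(h)\<close> is a
linear bijection \<open>A \<otimes> H \<rightarrow> E\<close> with inverse \<open>\<theta> x = i\<^sup>-\<^sup>1(q x\<^sub>1) # \<pi> x\<^sub>2\<close>.

Applied to \<open>\<phi>(h) i(a)\<close> and to \<open>\<phi>(g) \<phi>(h)\<close>, the splitting gives the commutation rules
\<open>\<phi>(h) i(a) = i(h\<^sub>1 \<triangleright> a) \<phi>(h\<^sub>2)\<close> and \<open>\<phi>(g) \<phi>(h) = i(f(g\<^sub>1, h\<^sub>1)) \<phi>(g\<^sub>2 h\<^sub>2)\<close>, where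
\<open>h \<triangleright> a = i\<^sup>-\<^sup>1(q(\<phi>(h) i(a)))\<close> and \<open>f(g, h) = i\<^sup>-\<^sup>1(q(\<phi>(g) \<phi>(h)))\<close>. Together they say that \<open>\<psi>\<close> carries
the crossed multiplication to the multiplication of \<open>E\<close>. Since \<open>i\<close>, \<open>\<phi>\<close> and the multiplication of
\<open>E\<close> are coalgebra maps, \<open>\<psi>\<close> also respects the coalgebra structures. So the crossed
product is \<open>E\<close> carried over along \<open>\<theta>\<close>, and this makes it a Hopf algebra and an extension equivalent
to \<open>E\<close> (locale \<open>transport\<close>).

That \<open>q\<close> takes coinvariant values (lemma \<open>coact_q\<close>) comes from the multiplicativity of
\<open>\<rho> = (id \<otimes> \<pi>) \<Delta>\<close>: cancelling the invertible factor \<open>\<rho> \<phi> \<pi>\<close> in \<open>\<rho>(q x\<^sub>1) \<rho>(\<phi>(\<pi> x\<^sub>2)) = \<rho> x = (q x\<^sub>1 \<otimes> 1) \<rho>(\<phi>(\<pi> x\<^sub>2))\<close>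
gives \<open>\<rho>(q x) = q x \<otimes> 1\<close>.

The computations are done in Sweedler form: an equation between elements of a tensor product is
replaced by the equations between their images under all bilinear maps \<open>b\<close>, whose left-hand sides
read \<open>sweedler K C M b x\<close> or \<open>coact M b x\<close>.
\<close>

section \<open>Linear and bilinear maps\<close>

lemma k_spaceD:
  assumes "k_space K V"
  shows "field K" "cring K" "module K V" "abelian_group V" "abelian_monoid V"
  using assms unfolding k_space_def module_def field_def domain_def abelian_group_def by auto

lemma lin_mapsI:
  assumes "\<And>x. x \<in> carrier V \<Longrightarrow> f x \<in> carrier W"
    and "\<And>x y. x \<in> carrier V \<Longrightarrow> y \<in> carrier V \<Longrightarrow> f (x \<oplus>\<^bsub>V\<^esub> y) = f x \<oplus>\<^bsub>W\<^esub> f y"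
    and "\<And>c x. c \<in> carrier K \<Longrightarrow> x \<in> carrier V \<Longrightarrow> f (c \<odot>\<^bsub>V\<^esub> x) = c \<odot>\<^bsub>W\<^esub> f x"
  shows "f \<in> lin_maps K V W"
  using assms unfolding lin_maps_def by auto

lemma lin_mapsD:
  assumes "f \<in> lin_maps K V W"
  shows lin_closed: "x \<in> carrier V \<Longrightarrow> f x \<in> carrier W"
    and lin_add: "x \<in> carrier V \<Longrightarrow> y \<in> carrier V \<Longrightarrow> f (x \<oplus>\<^bsub>V\<^esub> y) = f x \<oplus>\<^bsub>W\<^esub> f y"
    and lin_smult: "c \<in> carrier K \<Longrightarrow> x \<in> carrier V \<Longrightarrow> f (c \<odot>\<^bsub>V\<^esub> x) = c \<odot>\<^bsub>W\<^esub> f x"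
  using assms unfolding lin_maps_def by auto

lemma lin_comp:
  assumes g: "g \<in> lin_maps K V W" and f: "f \<in> lin_maps K U V"
  shows "(\<lambda>x. g (f x)) \<in> lin_maps K U W"
  by (rule lin_mapsI) (auto simp: lin_mapsD[OF f] lin_mapsD[OF g])

lemma lin_zero:
  assumes "f \<in> lin_maps K V W" "k_space K V" "k_space K W"
  shows "f \<zero>\<^bsub>V\<^esub> = \<zero>\<^bsub>W\<^esub>"
proof -
  interpret V: abelian_group V by (rule k_spaceD[OF assms(2)])
  interpret W: abelian_group W by (rule k_spaceD[OF assms(3)])
  have "f \<zero>\<^bsub>V\<^esub> \<oplus>\<^bsub>W\<^esub> f \<zero>\<^bsub>V\<^esub> = f \<zero>\<^bsub>V\<^esub>"
    using lin_add[OF assms(1), of "\<zero>\<^bsub>V\<^esub>" "\<zero>\<^bsub>V\<^esub>"] by simp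
  moreover have "f \<zero>\<^bsub>V\<^esub> \<in> carrier W" using lin_closed[OF assms(1)] by simp
  ultimately show ?thesis by (simp add: W.add.r_cancel_one')
qed

lemma lin_minus:
  assumes f: "f \<in> lin_maps K V W" and sp: "k_space K V" "k_space K W" and x: "x \<in> carrier V"
  shows "f (\<ominus>\<^bsub>V\<^esub> x) = \<ominus>\<^bsub>W\<^esub> f x"
proof -
  interpret V: abelian_group V by (rule k_spaceD[OF sp(1)])
  interpret W: abelian_group W by (rule k_spaceD[OF sp(2)])
  have "f (\<ominus>\<^bsub>V\<^esub> x) \<oplus>\<^bsub>W\<^esub> f x = \<zero>\<^bsub>W\<^esub>"
    using lin_add[OF f, of "\<ominus>\<^bsub>V\<^esub> x" x] x lin_zero[OF f sp] by (simp add: V.l_neg)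
  then show ?thesis
    using W.minus_equality[of "f (\<ominus>\<^bsub>V\<^esub> x)" "f x"] lin_closed[OF f] x by auto
qed

text \<open>
By this lemma, equality of linear maps can be tested on generators. Taking \<open>g\<close> to be the zero map gives
kernels.
\<close>

lemma lin_eq_submodule:
  assumes f: "f \<in> lin_maps K V W" and g: "g \<in> lin_maps K V W"
    and sp: "k_space K V" "k_space K W"
  shows "submodule {x \<in> carrier V. f x = g x} K V"
proof -
  interpret V: module K V by (rule k_spaceD[OF sp(1)])
  show ?thesis
    by (rule V.submoduleI)
      (auto simp: lin_zero[OF f sp] lin_zero[OF g sp] lin_minus[OF f sp] lin_minus[OF g sp]
        lin_add[OF f] lin_add[OF g] lin_smult[OF f] lin_smult[OF g])
qed

definition bilin ::
  "('k, 'l) ring_scheme \<Rightarrow> ('k, 'a, 'm) module_scheme \<Rightarrow> ('k, 'b, 'n) module_scheme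
     \<Rightarrow> ('k, 'c, 'o) module_scheme \<Rightarrow> ('a \<Rightarrow> 'b \<Rightarrow> 'c) \<Rightarrow> bool"
where
  "bilin K V W M b \<longleftrightarrow> (\<forall>v\<in>carrier V. b v \<in> lin_maps K W M) \<and>
     (\<forall>w\<in>carrier W. (\<lambda>v. b v w) \<in> lin_maps K V M)"

lemma bilinI:
  assumes "\<And>v. v \<in> carrier V \<Longrightarrow> b v \<in> lin_maps K W M"
    and "\<And>w. w \<in> carrier W \<Longrightarrow> (\<lambda>v. b v w) \<in> lin_maps K V M"
  shows "bilin K V W M b"
  using assms unfolding bilin_def by auto

lemma bilinD:
  assumes "bilin K V W M b"
  shows "v \<in> carrier V \<Longrightarrow> b v \<in> lin_maps K W M"
    and "w \<in> carrier W \<Longrightarrow> (\<lambda>v. b v w) \<in> lin_maps K V M"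
  using assms unfolding bilin_def by auto

lemma bilin_closed:
  "bilin K V W M b \<Longrightarrow> v \<in> carrier V \<Longrightarrow> w \<in> carrier W \<Longrightarrow> b v w \<in> carrier M"
  using bilinD(1) lin_closed by metis

section \<open>Free spaces and quotients\<close>

lemma free_space_simps:
  "zero (free_space K S) = (\<lambda>p. \<zero>\<^bsub>K\<^esub>)"
  "r \<oplus>\<^bsub>free_space K S\<^esub> s = (\<lambda>p. r p \<oplus>\<^bsub>K\<^esub> s p)"
  "c \<odot>\<^bsub>free_space K S\<^esub> r = (\<lambda>p. c \<otimes>\<^bsub>K\<^esub> r p)"
  by (auto simp: free_space_def)

lemma free_space_carrier:
  "r \<in> carrier (free_space K S) \<longleftrightarrow> (\<forall>p\<in>S. r p \<in> carrier K) \<and> (\<forall>p. p \<notin> S \<longrightarrow> r p = \<zero>\<^bsub>K\<^esub>) \<and>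
                    finite {p. r p \<noteq> \<zero>\<^bsub>K\<^esub>}"
  by (auto simp: free_space_def)

lemma free_space_closed:
  assumes "cring K" "r \<in> carrier (free_space K S)"
  shows "r p \<in> carrier K"
proof -
  interpret K: cring K by fact
  show ?thesis using assms(2) by (cases "p \<in> S") (auto simp: free_space_carrier)
qed

lemma free_space_module:
  assumes "cring K"
  shows "module K (free_space K S)" (is "module K ?F")
proof -
  interpret K: cring K by fact
  note cl = free_space_closed[OF assms, where S=S]
  have addc: "r \<oplus>\<^bsub>?F\<^esub> s \<in> carrier ?F" if "r \<in> carrier ?F" "s \<in> carrier ?F" for r s
  proof -
    have "{p. r p \<oplus>\<^bsub>K\<^esub> s p \<noteq> \<zero>\<^bsub>K\<^esub>} \<subseteq> {p. r p \<noteq> \<zero>\<^bsub>K\<^esub>} \<union> {p. s p \<noteq> \<zero>\<^bsub>K\<^esub>}" by auto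
    then show ?thesis using that unfolding free_space_carrier free_space_simps
      by (auto intro: finite_subset)
  qed
  have smc: "c \<odot>\<^bsub>?F\<^esub> r \<in> carrier ?F" if "c \<in> carrier K" "r \<in> carrier ?F" for c r
  proof -
    have "{p. c \<otimes>\<^bsub>K\<^esub> r p \<noteq> \<zero>\<^bsub>K\<^esub>} \<subseteq> {p. r p \<noteq> \<zero>\<^bsub>K\<^esub>}" using that by auto
    then show ?thesis using that unfolding free_space_carrier free_space_simps
      by (auto intro: finite_subset)
  qed
  have inv: "\<exists>y\<in>carrier ?F. y \<oplus>\<^bsub>?F\<^esub> r = \<zero>\<^bsub>?F\<^esub>" if r: "r \<in> carrier ?F" for r
  proof
    show "(\<lambda>p. \<ominus>\<^bsub>K\<^esub> r p) \<oplus>\<^bsub>?F\<^esub> r = \<zero>\<^bsub>?F\<^esub>"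
      using cl[OF r] by (auto simp: free_space_simps K.l_neg)
    have "{p. \<ominus>\<^bsub>K\<^esub> r p \<noteq> \<zero>\<^bsub>K\<^esub>} \<subseteq> {p. r p \<noteq> \<zero>\<^bsub>K\<^esub>}" by auto
    then show "(\<lambda>p. \<ominus>\<^bsub>K\<^esub> r p) \<in> carrier ?F" using r unfolding free_space_carrier
      by (auto intro: finite_subset)
  qed
  have ab: "abelian_group ?F"
  proof (rule abelian_groupI)
    show "\<zero>\<^bsub>?F\<^esub> \<in> carrier ?F" by (auto simp: free_space_simps free_space_carrier)
  qed (auto simp: addc inv, auto simp: free_space_simps K.a_ac cl)
  show ?thesis
    by (rule moduleI[OF assms ab smc])
      (auto simp: free_space_simps K.l_distr K.r_distr K.m_assoc cl)
qed

lemma free_basis_carrier: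
  assumes "cring K" "p \<in> S"
  shows "free_basis K p \<in> carrier (free_space K S)"
proof -
  interpret K: cring K by fact
  have "{q. (if q = p then \<one>\<^bsub>K\<^esub> else \<zero>\<^bsub>K\<^esub>) \<noteq> \<zero>\<^bsub>K\<^esub>} \<subseteq> {p}" by auto
  then have "finite {q. (if q = p then \<one>\<^bsub>K\<^esub> else \<zero>\<^bsub>K\<^esub>) \<noteq> \<zero>\<^bsub>K\<^esub>}" by (rule finite_subset) simp
  then show ?thesis using assms(2) unfolding free_basis_def free_space_carrier by auto
qed

lemma free_space_generated:
  assumes K: "cring K" and N: "submodule N K (free_space K S)"
    and basis: "\<And>p. p \<in> S \<Longrightarrow> free_basis K p \<in> N"
  shows "carrier (free_space K S) \<subseteq> N" (is "carrier ?F \<subseteq> N")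
proof
  interpret K: cring K by fact
  interpret F: module K ?F by (rule free_space_module[OF K])
  fix r assume "r \<in> carrier ?F"
  define J where "J = {p. r p \<noteq> \<zero>\<^bsub>K\<^esub>}"
  have "finite J" using \<open>r \<in> carrier ?F\<close> unfolding J_def free_space_carrier by auto
  then show "r \<in> N" using \<open>r \<in> carrier ?F\<close> J_def
  proof (induction J arbitrary: r rule: finite_induct)
    case empty
    then have "r = \<zero>\<^bsub>?F\<^esub>" by (auto simp: free_space_simps fun_eq_iff)
    then show ?case using F.submoduleE(2,4)[OF N] F.submoduleE(1)[OF N] 
      by (metis F.smult_l_null K.zero_closed all_not_in_conv subsetD)
  next
    case (insert p J r)
    define s where "s = (\<lambda>q. if q = p then \<zero>\<^bsub>K\<^esub> else r q)"
    have sJ: "{q. s q \<noteq> \<zero>\<^bsub>K\<^esub>} = J" using insert.hyps insert.prems(2) unfolding s_def by auto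
    then have sc: "s \<in> carrier ?F"
      using insert.prems(1) insert.hyps(1) unfolding free_space_carrier sJ by (auto simp: s_def)
    have pS: "p \<in> S" using insert.prems unfolding free_space_carrier by blast
    have "r = s \<oplus>\<^bsub>?F\<^esub> r p \<odot>\<^bsub>?F\<^esub> free_basis K p"
      using free_space_closed[OF K insert.prems(1)]
      by (auto simp: free_space_simps s_def free_basis_def)
    moreover have "s \<in> N" using insert.IH[OF sc] sJ by simp
    ultimately show ?case
      using F.submoduleE(4,5)[OF N] basis[OF pS] free_space_closed[OF K insert.prems(1)] by metis
  qed
qed

text \<open>
The value of \<^const>\<open>tensor_lift\<close> computed from a given representative \<open>r\<close> of a coset.
\<close>

definition free_lift ::
  "('k, 'l) ring_scheme \<Rightarrow> ('k, 'c, 'm) module_scheme \<Rightarrow> ('s \<Rightarrow> 'c) \<Rightarrow> ('s \<Rightarrow> 'k) \<Rightarrow> 'c" where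
  "free_lift K M b r = finsum M (\<lambda>p. r p \<odot>\<^bsub>M\<^esub> b p) {p. r p \<noteq> \<zero>\<^bsub>K\<^esub>}"

lemma free_lift_eq:
  assumes M: "module K M" and b: "\<And>p. p \<in> S \<Longrightarrow> b p \<in> carrier M"
    and r: "r \<in> carrier (free_space K S)"
    and J: "finite J" "J \<subseteq> S" "{p. r p \<noteq> \<zero>\<^bsub>K\<^esub>} \<subseteq> J"
  shows "free_lift K M b r = finsum M (\<lambda>p. r p \<odot>\<^bsub>M\<^esub> b p) J"
proof -
  interpret M: module K M by fact
  show ?thesis unfolding free_lift_def
    by (rule M.add.finprod_mono_neutral_cong_left)
      (use J b free_space_closed[OF M.R.is_cring r] in \<open>auto simp: Pi_def subset_iff\<close>)
qed

lemma free_lift_lin: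
  assumes M: "module K M" and b: "\<And>p. p \<in> S \<Longrightarrow> b p \<in> carrier M"
  shows "free_lift K M b \<in> lin_maps K (free_space K S) M"
proof -
  interpret M: module K M by fact
  let ?F = "free_space K S"
  interpret F: module K ?F by (rule free_space_module[OF M.R.is_cring])
  note cl = free_space_closed[OF M.R.is_cring, where S=S]
  let ?s = "\<lambda>r. {p. r p \<noteq> \<zero>\<^bsub>K\<^esub>}"
  have fin: "finite (?s r)" "?s r \<subseteq> S" if "r \<in> carrier ?F" for r
    using that unfolding free_space_carrier by auto
  show ?thesis
  proof (rule lin_mapsI)
    fix r assume "r \<in> carrier ?F"
    then show "free_lift K M b r \<in> carrier M"
      unfolding free_lift_def using fin[of r] b cl[of r]
      by (intro M.finsum_closed) (auto simp: Pi_def subset_iff)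
  next
    fix r s assume rs: "r \<in> carrier ?F" "s \<in> carrier ?F"
    let ?J = "?s r \<union> ?s s"
    have J: "finite ?J" "?J \<subseteq> S" using fin rs by auto
    have t: "r \<oplus>\<^bsub>?F\<^esub> s \<in> carrier ?F" using rs by simp
    have *: "free_lift K M b u = finsum M (\<lambda>p. u p \<odot>\<^bsub>M\<^esub> b p) ?J"
      if "u \<in> carrier ?F" "?s u \<subseteq> ?J" for u
      using free_lift_eq[OF M b that(1) J that(2)] by simp
    have bJ: "b p \<in> carrier M" if "p \<in> ?J" for p using b J(2) that by blast
    have bJ': "r p \<noteq> \<zero>\<^bsub>K\<^esub> \<Longrightarrow> b p \<in> carrier M" "s p \<noteq> \<zero>\<^bsub>K\<^esub> \<Longrightarrow> b p \<in> carrier M" for p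
      using bJ by auto
    have supp: "?s (r \<oplus>\<^bsub>?F\<^esub> s) \<subseteq> ?J" using rs by (auto simp: free_space_simps cl)
    have "free_lift K M b (r \<oplus>\<^bsub>?F\<^esub> s) = finsum M (\<lambda>p. (r p \<oplus>\<^bsub>K\<^esub> s p) \<odot>\<^bsub>M\<^esub> b p) ?J"
      using *[OF t supp] by (simp add: free_space_simps)
    also have "\<dots> = finsum M (\<lambda>p. r p \<odot>\<^bsub>M\<^esub> b p \<oplus>\<^bsub>M\<^esub> s p \<odot>\<^bsub>M\<^esub> b p) ?J"
      using rs by (intro M.finsum_cong') (auto simp: M.smult_l_distr bJ' cl)
    also have "\<dots> = finsum M (\<lambda>p. r p \<odot>\<^bsub>M\<^esub> b p) ?J \<oplus>\<^bsub>M\<^esub> finsum M (\<lambda>p. s p \<odot>\<^bsub>M\<^esub> b p) ?J"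
      using rs by (intro M.finsum_addf) (auto simp: bJ' cl)
    finally show "free_lift K M b (r \<oplus>\<^bsub>?F\<^esub> s) = free_lift K M b r \<oplus>\<^bsub>M\<^esub> free_lift K M b s"
      using *[OF rs(1)] *[OF rs(2)] by auto
  next
    fix c r assume c: "c \<in> carrier K" and r: "r \<in> carrier ?F"
    have t: "c \<odot>\<^bsub>?F\<^esub> r \<in> carrier ?F" using c r by simp
    have bJ: "\<And>p. p \<in> ?s r \<Longrightarrow> b p \<in> carrier M" using b fin[OF r] by auto
    have "free_lift K M b (c \<odot>\<^bsub>?F\<^esub> r) = finsum M (\<lambda>p. (c \<odot>\<^bsub>?F\<^esub> r) p \<odot>\<^bsub>M\<^esub> b p) (?s r)"
      using c fin[OF r] by (intro free_lift_eq[OF M b t]) (auto simp: free_space_simps)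
    also have "\<dots> = finsum M (\<lambda>p. c \<odot>\<^bsub>M\<^esub> (r p \<odot>\<^bsub>M\<^esub> b p)) (?s r)"
      using bJ cl[OF r] c by (intro M.finsum_cong') (auto simp: M.smult_assoc1 free_space_simps)
    also have "\<dots> = c \<odot>\<^bsub>M\<^esub> free_lift K M b r" unfolding free_lift_def
      using bJ cl[OF r] c fin[OF r] by (intro M.finsum_smult_ldistr[symmetric]) auto
    finally show "free_lift K M b (c \<odot>\<^bsub>?F\<^esub> r) = c \<odot>\<^bsub>M\<^esub> free_lift K M b r" .
  qed
qed

lemma free_lift_basis:
  assumes M: "module K M" and "b p \<in> carrier M"
  shows "free_lift K M b (free_basis K p) = b p"
proof -
  interpret M: module K M by fact
  have "free_lift K M b (free_basis K p) = finsum M (\<lambda>q. free_basis K p q \<odot>\<^bsub>M\<^esub> b q) {p}"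
    by (rule free_lift_eq[where S="{p}", OF M])
      (use assms(2) in \<open>auto simp: free_basis_carrier[OF M.R.is_cring]\<close>, auto simp: free_basis_def split: if_splits)
  then show ?thesis using assms(2) by (simp add: free_basis_def)
qed

text \<open>
The record \<open>Q\<close> has the shape of \<^const>\<open>tensor_space\<close>. Working with an arbitrary submodule keeps the
handling of cosets apart from bilinearity.
\<close>

locale quotient_space = F: module K F + N: submodule N K F
  for K :: "('k, 'l) ring_scheme" and F :: "('k, 'v, 'm) module_scheme" and N :: "'v set" +
  fixes Q :: "('k, 'v set) module"
  assumes Q: "Q = \<lparr>carrier = a_rcosets\<^bsub>F\<^esub> N, mult = undefined, one = undefined, zero = N,
       add = (\<lambda>X Y. X <+>\<^bsub>F\<^esub> Y), smult = (\<lambda>c X. \<Union>x\<in>X. N +>\<^bsub>F\<^esub> (c \<odot>\<^bsub>F\<^esub> x))\<rparr>"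
begin

lemma abelian_subgroup: "abelian_subgroup N F"
  by (rule abelian_subgroupI3)
    (auto intro!: additive_subgroup.intro N.subgroup_axioms F.abelian_group_axioms)

sublocale S: abelian_subgroup N F by (rule abelian_subgroup)

lemma carrier_Q: "carrier Q = (\<lambda>r. N +>\<^bsub>F\<^esub> r) ` carrier F"
  unfolding Q by (auto simp: A_RCOSETS_def' )

lemma coset_eq:
  assumes "r \<in> carrier F" "s \<in> carrier F"
  shows "N +>\<^bsub>F\<^esub> r = N +>\<^bsub>F\<^esub> s \<longleftrightarrow> r \<ominus>\<^bsub>F\<^esub> s \<in> N"
  using assms S.a_rcos_module[of s r] S.a_repr_independence'[of r s] S.a_rcos_self[of r]
  by (metis F.minus_eq)

lemma smult_Q:
  assumes c: "c \<in> carrier K" and r: "r \<in> carrier F"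
  shows "c \<odot>\<^bsub>Q\<^esub> (N +>\<^bsub>F\<^esub> r) = N +>\<^bsub>F\<^esub> (c \<odot>\<^bsub>F\<^esub> r)"
proof -
  have "N +>\<^bsub>F\<^esub> (c \<odot>\<^bsub>F\<^esub> x) = N +>\<^bsub>F\<^esub> (c \<odot>\<^bsub>F\<^esub> r)" if x: "x \<in> N +>\<^bsub>F\<^esub> r" for x
  proof -
    have xc: "x \<in> carrier F" using S.a_elemrcos_carrier[OF r x] .
    have "x \<ominus>\<^bsub>F\<^esub> r \<in> N" using S.a_rcos_module_imp[OF r x] by (simp add: F.minus_eq)
    then have "c \<odot>\<^bsub>F\<^esub> (x \<ominus>\<^bsub>F\<^esub> r) \<in> N" using c by simp
    then have "c \<odot>\<^bsub>F\<^esub> x \<ominus>\<^bsub>F\<^esub> c \<odot>\<^bsub>F\<^esub> r \<in> N"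
      using c r xc by (simp add: F.minus_eq F.smult_r_distr F.smult_r_minus)
    then show ?thesis using coset_eq c r xc by simp
  qed
  then have "(\<Union>x\<in>N +>\<^bsub>F\<^esub> r. N +>\<^bsub>F\<^esub> (c \<odot>\<^bsub>F\<^esub> x)) = N +>\<^bsub>F\<^esub> (c \<odot>\<^bsub>F\<^esub> r)"
    using S.a_rcos_self[OF r] by blast
  then show ?thesis by (simp add: Q)
qed

lemma add_Q:
  "r \<in> carrier F \<Longrightarrow> s \<in> carrier F \<Longrightarrow> (N +>\<^bsub>F\<^esub> r) \<oplus>\<^bsub>Q\<^esub> (N +>\<^bsub>F\<^esub> s) = N +>\<^bsub>F\<^esub> (r \<oplus>\<^bsub>F\<^esub> s)"
  unfolding Q using S.a_rcos_sum by simp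

lemma zero_Q: "\<zero>\<^bsub>Q\<^esub> = N +>\<^bsub>F\<^esub> \<zero>\<^bsub>F\<^esub>"
  unfolding Q using S.a_rcos_const[of "\<zero>\<^bsub>F\<^esub>"] by simp

lemma module_Q: "module K Q"
proof -
  have ab: "abelian_group Q"
  proof (rule abelian_groupI)
    fix x assume "x \<in> carrier Q"
    then obtain r where r: "r \<in> carrier F" "x = N +>\<^bsub>F\<^esub> r" unfolding carrier_Q by auto
    show "\<exists>y\<in>carrier Q. y \<oplus>\<^bsub>Q\<^esub> x = \<zero>\<^bsub>Q\<^esub>"
      by (rule bexI[of _ "N +>\<^bsub>F\<^esub> (\<ominus>\<^bsub>F\<^esub> r)"])
        (use r in \<open>auto simp: add_Q zero_Q F.l_neg carrier_Q\<close>)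
  qed (unfold carrier_Q, auto simp: add_Q zero_Q F.a_ac)
  show ?thesis
    by (rule moduleI[OF F.R.is_cring ab], unfold carrier_Q)
      (auto simp: add_Q smult_Q F.smult_l_distr F.smult_r_distr F.smult_assoc1)
qed

lemma proj_lin: "(\<lambda>r. N +>\<^bsub>F\<^esub> r) \<in> lin_maps K F Q"
  by (rule lin_mapsI) (auto simp: carrier_Q add_Q smult_Q)

end

section \<open>Tensor products\<close>

lemma submodule_Inter:
  assumes M: "module K M" and ne: "\<N> \<noteq> {}" and sub: "\<And>N. N \<in> \<N> \<Longrightarrow> submodule N K M"
  shows "submodule (\<Inter>\<N>) K M"
proof -
  interpret M: module K M by fact
  obtain N0 where "N0 \<in> \<N>" using ne by auto
  have z: "\<zero>\<^bsub>M\<^esub> \<in> N" if "N \<in> \<N>" for N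
    using sub[OF that] unfolding submodule_def using subgroup.one_closed by fastforce
  show ?thesis
  proof (rule M.submoduleI)
    show "\<Inter>\<N> \<subseteq> carrier M" using M.submoduleE(1)[OF sub[OF \<open>N0 \<in> \<N>\<close>]] \<open>N0 \<in> \<N>\<close> by blast
  qed (use M.submoduleE(3-5)[OF sub] z in \<open>simp_all add: Inter_iff\<close>)
qed

lemma tensor_relators_carrier:
  assumes "k_space K V" "k_space K W"
  shows "tensor_relators K V W \<subseteq> carrier (free_space K (carrier V \<times> carrier W))"
proof -
  interpret V: module K V by (rule k_spaceD[OF assms(1)])
  interpret W: module K W by (rule k_spaceD[OF assms(2)])
  interpret F: module K "free_space K (carrier V \<times> carrier W)"
    by (rule free_space_module[OF V.R.is_cring])
  show ?thesis unfolding tensor_relators_def Let_def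
    by (auto intro!: F.minus_closed F.smult_closed F.add.m_closed free_basis_carrier V.R.is_cring)
qed

lemma tensor_null_submodule:
  assumes "k_space K V" "k_space K W"
  shows "submodule (tensor_null K V W) K (free_space K (carrier V \<times> carrier W))"
proof -
  have K: "cring K" by (rule k_spaceD[OF assms(1)])
  note F = free_space_module[OF K, of "carrier V \<times> carrier W"]
  show ?thesis unfolding tensor_null_def
    using module.carrier_is_submodule[OF F] tensor_relators_carrier[OF assms]
    by (intro submodule_Inter[OF F]) auto
qed

lemma tensor_quotient:
  assumes "k_space K V" "k_space K W"
  shows "quotient_space K (free_space K (carrier V \<times> carrier W)) (tensor_null K V W) (tensor_space K V W)"
proof -
  have K: "cring K" by (rule k_spaceD[OF assms(1)])
  interpret F: module K "free_space K (carrier V \<times> carrier W)" by (rule free_space_module[OF K])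
  interpret N: submodule "tensor_null K V W" K "free_space K (carrier V \<times> carrier W)"
    by (rule tensor_null_submodule[OF assms])
  show ?thesis by unfold_locales (simp add: tensor_space_def Let_def)
qed

lemma tensor_space_k_space:
  assumes "k_space K V" "k_space K W"
  shows "k_space K (tensor_space K V W)"
  using assms quotient_space.module_Q[OF tensor_quotient[OF assms]] unfolding k_space_def by auto

lemma tensor_relators_null: "tensor_relators K V W \<subseteq> tensor_null K V W"
  unfolding tensor_null_def by auto

lemma tensor_relatorsI:
  fixes K V W
  defines "F \<equiv> free_space K (carrier V \<times> carrier W)"
  shows "\<lbrakk>v \<in> carrier V; v' \<in> carrier V; w \<in> carrier W\<rbrakk> \<Longrightarrow>
      free_basis K (v \<oplus>\<^bsub>V\<^esub> v', w) \<ominus>\<^bsub>F\<^esub> (free_basis K (v, w) \<oplus>\<^bsub>F\<^esub> free_basis K (v', w)) \<in> tensor_relators K V W"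
    and "\<lbrakk>v \<in> carrier V; w \<in> carrier W; w' \<in> carrier W\<rbrakk> \<Longrightarrow>
      free_basis K (v, w \<oplus>\<^bsub>W\<^esub> w') \<ominus>\<^bsub>F\<^esub> (free_basis K (v, w) \<oplus>\<^bsub>F\<^esub> free_basis K (v, w')) \<in> tensor_relators K V W"
    and "\<lbrakk>c \<in> carrier K; v \<in> carrier V; w \<in> carrier W\<rbrakk> \<Longrightarrow>
      free_basis K (c \<odot>\<^bsub>V\<^esub> v, w) \<ominus>\<^bsub>F\<^esub> (c \<odot>\<^bsub>F\<^esub> free_basis K (v, w)) \<in> tensor_relators K V W"
    and "\<lbrakk>c \<in> carrier K; v \<in> carrier V; w \<in> carrier W\<rbrakk> \<Longrightarrow>
      free_basis K (v, c \<odot>\<^bsub>W\<^esub> w) \<ominus>\<^bsub>F\<^esub> (c \<odot>\<^bsub>F\<^esub> free_basis K (v, w)) \<in> tensor_relators K V W"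
  unfolding F_def tensor_relators_def Let_def by blast+

lemma pure_tensor_bilin:
  assumes "k_space K V" "k_space K W"
  shows "bilin K V W (tensor_space K V W) (pure_tensor K V W)"
proof -
  interpret V: module K V by (rule k_spaceD[OF assms(1)])
  interpret W: module K W by (rule k_spaceD[OF assms(2)])
  interpret q: quotient_space K "free_space K (carrier V \<times> carrier W)" "tensor_null K V W"
    "tensor_space K V W" by (rule tensor_quotient[OF assms])
  note e = free_basis_carrier[OF V.R.is_cring]
  let ?F = "free_space K (carrier V \<times> carrier W)"
  let ?c = "\<lambda>r. tensor_null K V W +>\<^bsub>?F\<^esub> r"
  have pt: "pure_tensor K V W v w = ?c (free_basis K (v, w))"
    for v w by (simp add: pure_tensor_def)
  have eq: "?c r = ?c s"
    if "r \<ominus>\<^bsub>?F\<^esub> s \<in> tensor_relators K V W" "r \<in> carrier ?F" "s \<in> carrier ?F" for r s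
    using that tensor_relators_null q.coset_eq by blast
  show ?thesis
  proof (intro bilinI lin_mapsI)
    fix v w w' assume "v \<in> carrier V" "w \<in> carrier W" "w' \<in> carrier W"
    then have "?c (free_basis K (v, w \<oplus>\<^bsub>W\<^esub> w')) = ?c (free_basis K (v, w) \<oplus>\<^bsub>?F\<^esub> free_basis K (v, w'))"
      by (intro eq) (auto intro!: e q.F.add.m_closed tensor_relatorsI)
    then show "pure_tensor K V W v (w \<oplus>\<^bsub>W\<^esub> w') =
      pure_tensor K V W v w \<oplus>\<^bsub>tensor_space K V W\<^esub> pure_tensor K V W v w'"
      unfolding pt using \<open>v \<in> carrier V\<close> \<open>w \<in> carrier W\<close> \<open>w' \<in> carrier W\<close> by (simp add: q.add_Q e)
  next
    fix v w c assume "v \<in> carrier V" "w \<in> carrier W" "c \<in> carrier K"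
    then have "?c (free_basis K (v, c \<odot>\<^bsub>W\<^esub> w)) = ?c (c \<odot>\<^bsub>?F\<^esub> free_basis K (v, w))"
      by (intro eq) (auto intro!: e q.F.smult_closed tensor_relatorsI)
    then show "pure_tensor K V W v (c \<odot>\<^bsub>W\<^esub> w) = c \<odot>\<^bsub>tensor_space K V W\<^esub> pure_tensor K V W v w"
      unfolding pt using \<open>v \<in> carrier V\<close> \<open>w \<in> carrier W\<close> \<open>c \<in> carrier K\<close> by (simp add: q.smult_Q e)
  next
    fix v v' w assume "v \<in> carrier V" "v' \<in> carrier V" "w \<in> carrier W"
    then have "?c (free_basis K (v \<oplus>\<^bsub>V\<^esub> v', w)) = ?c (free_basis K (v, w) \<oplus>\<^bsub>?F\<^esub> free_basis K (v', w))"
      by (intro eq) (auto intro!: e q.F.add.m_closed tensor_relatorsI)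
    then show "pure_tensor K V W (v \<oplus>\<^bsub>V\<^esub> v') w =
      pure_tensor K V W v w \<oplus>\<^bsub>tensor_space K V W\<^esub> pure_tensor K V W v' w"
      unfolding pt using \<open>v \<in> carrier V\<close> \<open>v' \<in> carrier V\<close> \<open>w \<in> carrier W\<close> by (simp add: q.add_Q e)
  next
    fix v w c assume "v \<in> carrier V" "w \<in> carrier W" "c \<in> carrier K"
    then have "?c (free_basis K (c \<odot>\<^bsub>V\<^esub> v, w)) = ?c (c \<odot>\<^bsub>?F\<^esub> free_basis K (v, w))"
      by (intro eq) (auto intro!: e q.F.smult_closed tensor_relatorsI)
    then show "pure_tensor K V W (c \<odot>\<^bsub>V\<^esub> v) w = c \<odot>\<^bsub>tensor_space K V W\<^esub> pure_tensor K V W v w"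
      unfolding pt using \<open>v \<in> carrier V\<close> \<open>w \<in> carrier W\<close> \<open>c \<in> carrier K\<close> by (simp add: q.smult_Q e)
  qed (auto simp: pt q.carrier_Q e)
qed

text \<open>
Pure tensors span \<open>V \<otimes> W\<close>, since the basis vectors span the free space. Every identity between linear
maps on a tensor product is proved through this rule.
\<close>

lemma tensor_lin_eqI:
  assumes sp: "k_space K V" "k_space K W" "k_space K M"
    and f: "f \<in> lin_maps K (tensor_space K V W) M" and g: "g \<in> lin_maps K (tensor_space K V W) M"
    and eq: "\<And>v w. v \<in> carrier V \<Longrightarrow> w \<in> carrier W \<Longrightarrow>
      f (pure_tensor K V W v w) = g (pure_tensor K V W v w)"
    and x: "x \<in> carrier (tensor_space K V W)"
  shows "f x = g x"
proof -
  let ?F = "free_space K (carrier V \<times> carrier W)" and ?N = "tensor_null K V W"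
  interpret q: quotient_space K ?F ?N "tensor_space K V W" by (rule tensor_quotient[OF sp(1,2)])
  have F: "k_space K ?F" using q.F.module_axioms sp(1) unfolding k_space_def by auto
  have comp: "(\<lambda>r. h (?N +>\<^bsub>?F\<^esub> r)) \<in> lin_maps K ?F M" if "h \<in> lin_maps K (tensor_space K V W) M" for h
    by (rule lin_comp[OF that q.proj_lin])
  have "carrier ?F \<subseteq> {r \<in> carrier ?F. f (?N +>\<^bsub>?F\<^esub> r) = g (?N +>\<^bsub>?F\<^esub> r)}"
    by (rule free_space_generated[OF q.F.R.is_cring lin_eq_submodule[OF comp[OF f] comp[OF g] F sp(3)]])
      (use eq in \<open>auto simp: pure_tensor_def free_basis_carrier[OF q.F.R.is_cring]\<close>)
  then show ?thesis using x unfolding q.carrier_Q by auto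
qed

text \<open>
The universal property. The linear extension of \<open>b\<close> to the free space kills the bilinearity relations,
hence the submodule that they generate, so that it is constant on cosets and the choice of a
representative in \<^const>\<open>tensor_lift\<close> does not matter.
\<close>

lemma
  assumes sp: "k_space K V" "k_space K W" "k_space K M" and b: "bilin K V W M b"
  shows tensor_lift_lin: "tensor_lift K M b \<in> lin_maps K (tensor_space K V W) M"
    and tensor_lift_pure: "v \<in> carrier V \<Longrightarrow> w \<in> carrier W \<Longrightarrow>
      tensor_lift K M b (pure_tensor K V W v w) = b v w"
proof -
  let ?F = "free_space K (carrier V \<times> carrier W)" and ?N = "tensor_null K V W"
  interpret q: quotient_space K ?F ?N "tensor_space K V W" by (rule tensor_quotient[OF sp(1,2)])
  interpret V: module K V by (rule k_spaceD[OF sp(1)])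
  interpret W: module K W by (rule k_spaceD[OF sp(2)])
  interpret M: module K M by (rule k_spaceD[OF sp(3)])
  have F: "k_space K ?F" using q.F.module_axioms sp(1) unfolding k_space_def by auto
  let ?b = "\<lambda>p. b (fst p) (snd p)"
  let ?L = "free_lift K M ?b"
  have bc: "?b p \<in> carrier M" if "p \<in> carrier V \<times> carrier W" for p
    using bilin_closed[OF b] that by auto
  have L: "?L \<in> lin_maps K ?F M" by (rule free_lift_lin[OF M.module_axioms bc])
  have z: "(\<lambda>r. \<zero>\<^bsub>M\<^esub>) \<in> lin_maps K ?F M" by (rule lin_mapsI) auto
  note e = free_basis_carrier[OF q.F.R.is_cring]
  have Le: "?L (free_basis K (v, w)) = b v w" if "v \<in> carrier V" "w \<in> carrier W" for v w
    using free_lift_basis[OF M.module_axioms, of ?b "(v,w)"] that bc by auto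
  note bl = lin_mapsD[OF bilinD(1)[OF b]] lin_mapsD[OF bilinD(2)[OF b]]
  have Lm: "?L (r \<ominus>\<^bsub>?F\<^esub> s) = ?L r \<ominus>\<^bsub>M\<^esub> ?L s" if "r \<in> carrier ?F" "s \<in> carrier ?F" for r s
    using that lin_add[OF L] lin_minus[OF L F sp(3)] by (simp add: q.F.minus_eq M.minus_eq)
  have "tensor_relators K V W \<subseteq> {r \<in> carrier ?F. ?L r = \<zero>\<^bsub>M\<^esub>}"
    using tensor_relators_carrier[OF sp(1,2)]
    by (auto simp: tensor_relators_def Let_def Lm e lin_add[OF L] lin_smult[OF L] Le bl M.minus_eq M.r_neg)
  then have null: "?N \<subseteq> {r \<in> carrier ?F. ?L r = \<zero>\<^bsub>M\<^esub>}"
    unfolding tensor_null_def using lin_eq_submodule[OF L z F sp(3)] by auto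
  have lift: "tensor_lift K M b (?N +>\<^bsub>?F\<^esub> r) = ?L r" if r: "r \<in> carrier ?F" for r
  proof -
    define s where "s = (SOME s. s \<in> ?N +>\<^bsub>?F\<^esub> r)"
    have s: "s \<in> ?N +>\<^bsub>?F\<^esub> r" unfolding s_def by (rule someI[of "\<lambda>s. s \<in> _", OF q.S.a_rcos_self[OF r]])
    have sc: "s \<in> carrier ?F" using q.S.a_elemrcos_carrier[OF r s] .
    have "s \<ominus>\<^bsub>?F\<^esub> r \<in> ?N" using q.S.a_rcos_module_imp[OF r s] by (simp add: q.F.minus_eq)
    then have "?L s \<ominus>\<^bsub>M\<^esub> ?L r = \<zero>\<^bsub>M\<^esub>" using null Lm[OF sc r] by auto
    then have "?L s = ?L r" using lin_closed[OF L] sc r M.minus_equality[of "?L s" "\<ominus>\<^bsub>M\<^esub> ?L r"]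
      by (simp add: M.minus_eq M.r_neg)
    then show ?thesis unfolding tensor_lift_def s_def[symmetric] Let_def free_lift_def .
  qed
  show "tensor_lift K M b \<in> lin_maps K (tensor_space K V W) M"
    by (rule lin_mapsI, unfold q.carrier_Q)
      (auto simp: q.add_Q q.smult_Q lift lin_mapsD[OF L])
  show "tensor_lift K M b (pure_tensor K V W v w) = b v w" if "v \<in> carrier V" "w \<in> carrier W"
    unfolding pure_tensor_def using that by (simp add: lift e Le)
qed

section \<open>Multilinear maps out of tensor products\<close>

text \<open>
A Sweedler expression is linear in each of its variables because every variable occurs exactly once.
The following rules show this by descending, from the outside in, into the one argument that
contains the variable; that a rule for another argument does not apply is detected by unification,
as its constant argument may not depend on the bound variable.
\<close>

named_theorems mlin \<open>closure and multilinearity\<close>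

lemma lin_id [mlin]: "(\<lambda>x. x) \<in> lin_maps K V V"
  by (auto intro: lin_mapsI)

lemma bilin_left:
  assumes "bilin K V W M b" "t \<in> lin_maps K U V" "c \<in> carrier W"
  shows "(\<lambda>x. b (t x) c) \<in> lin_maps K U M"
  using lin_comp[OF bilinD(2)[OF assms(1,3)] assms(2)] .

lemma bilin_right:
  assumes "bilin K V W M b" "c \<in> carrier V" "t \<in> lin_maps K U W"
  shows "(\<lambda>x. b c (t x)) \<in> lin_maps K U M"
  using lin_comp[OF bilinD(1)[OF assms(1,2)] assms(3)] .

lemma lin_cong:
  assumes V: "k_space K V" and f: "f \<in> lin_maps K V W" and eq: "\<And>x. x \<in> carrier V \<Longrightarrow> f x = g x"
  shows "g \<in> lin_maps K V W"
proof -
  interpret V: module K V by (rule k_spaceD[OF V])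
  show ?thesis
    by (rule lin_mapsI) (auto simp: lin_mapsD[OF f] eq[symmetric])
qed

lemma bilin_cong:
  assumes sp: "k_space K V" "k_space K W" and b: "bilin K V W M b"
    and eq: "\<And>v w. v \<in> carrier V \<Longrightarrow> w \<in> carrier W \<Longrightarrow> b v w = b' v w"
  shows "bilin K V W M b'"
  using lin_cong[OF sp(2) bilinD(1)[OF b] eq] lin_cong[OF sp(1) bilinD(2)[OF b] eq]
  by (intro bilinI) auto

lemma lin_plus_map:
  assumes W: "k_space K W" and f: "f \<in> lin_maps K V W" and g: "g \<in> lin_maps K V W"
  shows "(\<lambda>x. f x \<oplus>\<^bsub>W\<^esub> g x) \<in> lin_maps K V W"
proof -
  interpret W: module K W by (rule k_spaceD[OF W])
  show ?thesis
    by (rule lin_mapsI) (auto simp: lin_mapsD[OF f] lin_mapsD[OF g] W.smult_r_distr W.a_ac)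
qed

lemma lin_smult_map:
  assumes W: "k_space K W" and f: "f \<in> lin_maps K V W" and c: "c \<in> carrier K"
  shows "(\<lambda>x. c \<odot>\<^bsub>W\<^esub> f x) \<in> lin_maps K V W"
proof -
  interpret W: module K W by (rule k_spaceD[OF W])
  show ?thesis
    by (rule lin_mapsI)
      (auto simp: lin_mapsD[OF f] W.smult_r_distr c W.smult_assoc1[symmetric] W.R.m_comm)
qed

lemma lift_lin_comp:
  assumes sp: "k_space K V" "k_space K W" "k_space K M" "k_space K M'"
    and b: "bilin K V W M b" and g: "g \<in> lin_maps K M M'" and x: "x \<in> carrier (tensor_space K V W)"
  shows "g (tensor_lift K M b x) = tensor_lift K M' (\<lambda>v w. g (b v w)) x"
proof -
  have b': "bilin K V W M' (\<lambda>v w. g (b v w))"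
    using lin_comp[OF g bilinD(1)[OF b]] lin_comp[OF g bilinD(2)[OF b]] by (intro bilinI) auto
  show ?thesis
    by (rule tensor_lin_eqI[OF sp(1,2,4) lin_comp[OF g tensor_lift_lin[OF sp(1-3) b]]
          tensor_lift_lin[OF sp(1,2,4) b'] _ x])
      (simp add: tensor_lift_pure[OF sp(1-3) b] tensor_lift_pure[OF sp(1,2,4) b'])
qed

lemma lift_cong:
  assumes sp: "k_space K V" "k_space K W" "k_space K M"
    and b: "bilin K V W M b"
    and eq: "\<And>v w. v \<in> carrier V \<Longrightarrow> w \<in> carrier W \<Longrightarrow> b v w = b' v w"
    and x: "x \<in> carrier (tensor_space K V W)"
  shows "tensor_lift K M b x = tensor_lift K M b' x"
proof -
  have b': "bilin K V W M b'" by (rule bilin_cong[OF sp(1,2) b eq])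
  show ?thesis
    by (rule tensor_lin_eqI[OF sp tensor_lift_lin[OF sp b] tensor_lift_lin[OF sp b'] _ x])
      (simp add: tensor_lift_pure[OF sp b] tensor_lift_pure[OF sp b'] eq)
qed

lemma lift_pure_tensor:
  assumes sp: "k_space K V" "k_space K W" and x: "x \<in> carrier (tensor_space K V W)"
  shows "tensor_lift K (tensor_space K V W) (pure_tensor K V W) x = x"
proof -
  note T = tensor_space_k_space[OF sp] and b = pure_tensor_bilin[OF sp]
  show ?thesis
    by (rule tensor_lin_eqI[OF sp T tensor_lift_lin[OF sp T b] lin_id _ x])
      (simp add: tensor_lift_pure[OF sp T b])
qed

definition trilin ::
  "('k, 'l) ring_scheme \<Rightarrow> ('k, 'u, 'q) module_scheme \<Rightarrow> ('k, 'a, 'm) module_scheme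
     \<Rightarrow> ('k, 'b, 'n) module_scheme \<Rightarrow> ('k, 'c, 'o) module_scheme \<Rightarrow> ('u \<Rightarrow> 'a \<Rightarrow> 'b \<Rightarrow> 'c) \<Rightarrow> bool"
where
  "trilin K U V W M t \<longleftrightarrow> (\<forall>u\<in>carrier U. bilin K V W M (t u)) \<and>
     (\<forall>v\<in>carrier V. \<forall>w\<in>carrier W. (\<lambda>u. t u v w) \<in> lin_maps K U M)"

lemma trilinI [mlin]:
  assumes "\<And>u v. u \<in> carrier U \<Longrightarrow> v \<in> carrier V \<Longrightarrow> t u v \<in> lin_maps K W M"
    and "\<And>u w. u \<in> carrier U \<Longrightarrow> w \<in> carrier W \<Longrightarrow> (\<lambda>v. t u v w) \<in> lin_maps K V M"
    and "\<And>v w. v \<in> carrier V \<Longrightarrow> w \<in> carrier W \<Longrightarrow> (\<lambda>u. t u v w) \<in> lin_maps K U M"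
  shows "trilin K U V W M t"
  using assms unfolding trilin_def bilin_def by auto

lemma trilinD:
  assumes "trilin K U V W M t"
  shows "u \<in> carrier U \<Longrightarrow> bilin K V W M (t u)"
    and "v \<in> carrier V \<Longrightarrow> w \<in> carrier W \<Longrightarrow> (\<lambda>u. t u v w) \<in> lin_maps K U M"
    and "w \<in> carrier W \<Longrightarrow> bilin K U V M (\<lambda>u v. t u v w)"
  using assms unfolding trilin_def bilin_def by auto

text \<open>
Nested Sweedler sums are linear in the variables of the outer sums by this lemma.
\<close>

lemma lift_param_lin:
  assumes sp: "k_space K U" "k_space K V" "k_space K W" "k_space K M"
    and t: "trilin K U V W M t" and x: "x \<in> carrier (tensor_space K V W)"
  shows "(\<lambda>u. tensor_lift K M (t u) x) \<in> lin_maps K U M"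
proof -
  interpret U: module K U by (rule k_spaceD[OF sp(1)])
  interpret M: module K M by (rule k_spaceD[OF sp(4)])
  note L = tensor_lift_lin[OF sp(2-4) trilinD(1)[OF t]]
    and P = tensor_lift_pure[OF sp(2-4) trilinD(1)[OF t]]
    and D = lin_mapsD[OF trilinD(2)[OF t]]
  show ?thesis
  proof (rule lin_mapsI)
    fix u assume "u \<in> carrier U"
    then show "tensor_lift K M (t u) x \<in> carrier M" using lin_closed[OF L x] by simp
  next
    fix u u' assume "u \<in> carrier U" "u' \<in> carrier U"
    then show "tensor_lift K M (t (u \<oplus>\<^bsub>U\<^esub> u')) x = tensor_lift K M (t u) x \<oplus>\<^bsub>M\<^esub> tensor_lift K M (t u') x"
      by (intro tensor_lin_eqI[OF sp(2-4) _ _ _ x, where g = "\<lambda>x. tensor_lift K M (t u) x \<oplus>\<^bsub>M\<^esub> tensor_lift K M (t u') x"]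
          L lin_plus_map[OF sp(4)]) (simp_all add: P D)
  next
    fix c u assume "c \<in> carrier K" "u \<in> carrier U"
    then show "tensor_lift K M (t (c \<odot>\<^bsub>U\<^esub> u)) x = c \<odot>\<^bsub>M\<^esub> tensor_lift K M (t u) x"
      by (intro tensor_lin_eqI[OF sp(2-4) _ _ _ x, where g = "\<lambda>x. c \<odot>\<^bsub>M\<^esub> tensor_lift K M (t u) x"]
          L lin_smult_map[OF sp(4)]) (simp_all add: P D)
  qed
qed

section \<open>Sweedler calculus\<close>

lemma coalgebraD:
  assumes "coalgebra K C"
  shows coalgebra_k_space: "k_space K C"
    and comult_lin: "\<Delta>\<^bsub>C\<^esub> \<in> lin_maps K C (tensor_space K C C)"
    and counit_lin: "\<epsilon>\<^bsub>C\<^esub> \<in> lin_maps K C (scalars K)"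
  using assms unfolding coalgebra_def by auto

lemma comult_closed [mlin]: "coalgebra K C \<Longrightarrow> x \<in> carrier C \<Longrightarrow> \<Delta>\<^bsub>C\<^esub> x \<in> carrier (tensor_space K C C)"
  using lin_closed[OF comult_lin] .

lemma counit_closed [mlin]: "coalgebra K C \<Longrightarrow> x \<in> carrier C \<Longrightarrow> \<epsilon>\<^bsub>C\<^esub> x \<in> carrier K"
  using lin_closed[OF counit_lin] by (simp add: scalars_def)

lemma scalars_k_space:
  assumes "field K" shows "k_space K (scalars K)"
proof -
  interpret K: field K by fact
  have "abelian_group (scalars K)"
    by (rule abelian_groupI) (auto simp: scalars_def K.a_ac intro: K.add.l_inv_ex)
  then show ?thesis unfolding k_space_def
    by (intro conjI assms moduleI K.is_cring) (auto simp: scalars_def K.l_distr K.r_distr K.m_assoc)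
qed

lemma bilin_rule [mlin]:
  assumes "\<And>v. v \<in> carrier V \<Longrightarrow> (\<lambda>w. b v w) \<in> lin_maps K W M"
    and "\<And>w. w \<in> carrier W \<Longrightarrow> (\<lambda>v. b v w) \<in> lin_maps K V M"
  shows "bilin K V W M b"
  using assms by (rule bilinI)

lemma pure_tensor_left [mlin]:
  "\<lbrakk>k_space K V; k_space K W; t \<in> lin_maps K U V; c \<in> carrier W\<rbrakk> \<Longrightarrow>
    (\<lambda>x. pure_tensor K V W (t x) c) \<in> lin_maps K U (tensor_space K V W)"
  using bilin_left[OF pure_tensor_bilin] .

lemma pure_tensor_right [mlin]:
  "\<lbrakk>k_space K V; k_space K W; c \<in> carrier V; t \<in> lin_maps K U W\<rbrakk> \<Longrightarrow>
    (\<lambda>x. pure_tensor K V W c (t x)) \<in> lin_maps K U (tensor_space K V W)"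
  using bilin_right[OF pure_tensor_bilin] .

lemma pure_tensor_closed [mlin]:
  "\<lbrakk>k_space K V; k_space K W; v \<in> carrier V; w \<in> carrier W\<rbrakk> \<Longrightarrow>
    pure_tensor K V W v w \<in> carrier (tensor_space K V W)"
  using bilin_closed[OF pure_tensor_bilin] .

lemma smult_left [mlin]:
  assumes V: "k_space K V" and t: "t \<in> lin_maps K U (scalars K)" and c: "c \<in> carrier V"
  shows "(\<lambda>x. t x \<odot>\<^bsub>V\<^esub> c) \<in> lin_maps K U V"
proof -
  interpret V: module K V by (rule k_spaceD[OF V])
  show ?thesis
    by (rule lin_mapsI) (use lin_mapsD[OF t] c in \<open>auto simp: scalars_def V.smult_l_distr V.smult_assoc1\<close>)
qed

lemma smult_right [mlin]:
  "\<lbrakk>k_space K V; c \<in> carrier K; t \<in> lin_maps K U V\<rbrakk> \<Longrightarrow> (\<lambda>x. c \<odot>\<^bsub>V\<^esub> t x) \<in> lin_maps K U V"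
  by (rule lin_smult_map)

lemma smult_mem [mlin]:
  "\<lbrakk>k_space K V; c \<in> carrier K; x \<in> carrier V\<rbrakk> \<Longrightarrow> c \<odot>\<^bsub>V\<^esub> x \<in> carrier V"
  using module.smult_closed k_spaceD(3) by metis

lemma counit_comp [mlin]:
  "\<lbrakk>coalgebra K C; t \<in> lin_maps K U C\<rbrakk> \<Longrightarrow> (\<lambda>x. \<epsilon>\<^bsub>C\<^esub> (t x)) \<in> lin_maps K U (scalars K)"
  using lin_comp[OF counit_lin] .

lemma comult_comp [mlin]:
  "\<lbrakk>coalgebra K C; t \<in> lin_maps K U C\<rbrakk> \<Longrightarrow> (\<lambda>x. \<Delta>\<^bsub>C\<^esub> (t x)) \<in> lin_maps K U (tensor_space K C C)"
  using lin_comp[OF comult_lin] .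

lemma k_algebraD:
  assumes "k_algebra K B"
  shows "k_space K B" "ring B"
    "\<lbrakk>c \<in> carrier K; x \<in> carrier B; y \<in> carrier B\<rbrakk> \<Longrightarrow> (c \<odot>\<^bsub>B\<^esub> x) \<otimes>\<^bsub>B\<^esub> y = c \<odot>\<^bsub>B\<^esub> (x \<otimes>\<^bsub>B\<^esub> y)"
    "\<lbrakk>c \<in> carrier K; x \<in> carrier B; y \<in> carrier B\<rbrakk> \<Longrightarrow> x \<otimes>\<^bsub>B\<^esub> (c \<odot>\<^bsub>B\<^esub> y) = c \<odot>\<^bsub>B\<^esub> (x \<otimes>\<^bsub>B\<^esub> y)"
  using assms unfolding k_algebra_def by auto

lemma mult_bilin:
  assumes "k_algebra K B"
  shows "bilin K B B B (\<lambda>x y. x \<otimes>\<^bsub>B\<^esub> y)"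
proof -
  interpret B: ring B by (rule k_algebraD[OF assms])
  show ?thesis
    by (intro bilinI lin_mapsI) (auto simp: B.l_distr B.r_distr k_algebraD(3,4)[OF assms])
qed

lemma mult_left [mlin]:
  "\<lbrakk>k_algebra K B; t \<in> lin_maps K U B; c \<in> carrier B\<rbrakk> \<Longrightarrow> (\<lambda>x. t x \<otimes>\<^bsub>B\<^esub> c) \<in> lin_maps K U B"
  using bilin_left[OF mult_bilin] .

lemma mult_right [mlin]:
  "\<lbrakk>k_algebra K B; c \<in> carrier B; t \<in> lin_maps K U B\<rbrakk> \<Longrightarrow> (\<lambda>x. c \<otimes>\<^bsub>B\<^esub> t x) \<in> lin_maps K U B"
  using bilin_right[OF mult_bilin] .

lemma mult_mem [mlin]:
  "\<lbrakk>k_algebra K B; x \<in> carrier B; y \<in> carrier B\<rbrakk> \<Longrightarrow> x \<otimes>\<^bsub>B\<^esub> y \<in> carrier B"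
  using k_algebraD(2) monoid.m_closed[of B] ring.is_monoid by metis

lemma one_mem [mlin]: "k_algebra K B \<Longrightarrow> \<one>\<^bsub>B\<^esub> \<in> carrier B"
  using k_algebraD(2) monoid.one_closed[of B] ring.is_monoid by metis

lemma sweedler_comp [mlin]:
  "\<lbrakk>coalgebra K C; k_space K M; bilin K C C M b; t \<in> lin_maps K U C\<rbrakk> \<Longrightarrow>
    (\<lambda>x. sweedler K C M b (t x)) \<in> lin_maps K U M"
  unfolding sweedler_def
  using lin_comp[OF tensor_lift_lin comult_comp] coalgebra_k_space by metis

lemma sweedler_param [mlin]:
  assumes "coalgebra K C" "k_space K U" "k_space K M" "trilin K U C C M t" "x \<in> carrier C"
  shows "(\<lambda>u. sweedler K C M (t u) x) \<in> lin_maps K U M"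
  unfolding sweedler_def
  using lift_param_lin[OF assms(2) coalgebra_k_space[OF assms(1)] coalgebra_k_space[OF assms(1)]
      assms(3,4) comult_closed[OF assms(1,5)]] .

lemma sweedler_mem [mlin]:
  "\<lbrakk>coalgebra K C; k_space K M; bilin K C C M b; x \<in> carrier C\<rbrakk> \<Longrightarrow> sweedler K C M b x \<in> carrier M"
  using lin_closed[OF sweedler_comp[OF _ _ _ lin_id]] .

lemma sweedler_cong:
  assumes C: "coalgebra K C" and M: "k_space K M" and x: "x \<in> carrier C" and b: "bilin K C C M b"
    and eq: "\<And>x y. x \<in> carrier C \<Longrightarrow> y \<in> carrier C \<Longrightarrow> b x y = b' x y"
  shows "sweedler K C M b x = sweedler K C M b' x"
  unfolding sweedler_def
  by (rule lift_cong[OF coalgebra_k_space[OF C] coalgebra_k_space[OF C] M b eq comult_closed[OF C x]])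

lemma sweedler_lin:
  assumes "coalgebra K C" "k_space K M" "k_space K M'" "g \<in> lin_maps K M M'" "bilin K C C M b" "x \<in> carrier C"
  shows "g (sweedler K C M b x) = sweedler K C M' (\<lambda>x y. g (b x y)) x"
  unfolding sweedler_def
  using lift_lin_comp[OF coalgebra_k_space[OF assms(1)] coalgebra_k_space[OF assms(1)]
      assms(2,3,5,4) comult_closed[OF assms(1,6)]] .

lemma sweedler_pure_tensor:
  assumes C: "coalgebra K C" and x: "x \<in> carrier C"
  shows "sweedler K C (tensor_space K C C) (pure_tensor K C C) x = \<Delta>\<^bsub>C\<^esub> x"
  unfolding sweedler_def by (intro lift_pure_tensor comult_closed coalgebra_k_space C x)

text \<open>
Coassociativity is an equation in \<open>C \<otimes> (C \<otimes> C)\<close>; the claim is its image under the linear map to \<open>M\<close>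
induced by \<open>t\<close>.
\<close>

lemma sweedler_coassoc:
  assumes C: "coalgebra K C" and M: "k_space K M" and t: "trilin K C C C M t" and x: "x \<in> carrier C"
  shows "sweedler K C M (\<lambda>x\<^sub>1 y. sweedler K C M (t x\<^sub>1) y) x =
    sweedler K C M (\<lambda>y x\<^sub>3. sweedler K C M (\<lambda>x\<^sub>1 x\<^sub>2. t x\<^sub>1 x\<^sub>2 x\<^sub>3) y) x"
proof -
  note C0 [mlin] = coalgebra_k_space[OF C]
  let ?CC = "tensor_space K C C"
  let ?CCC = "tensor_space K C ?CC"
  have CC [mlin]: "k_space K ?CC" by (intro tensor_space_k_space C0)
  have CCC [mlin]: "k_space K ?CCC" by (intro tensor_space_k_space C0 CC)
  let ?b = "\<lambda>x z. tensor_lift K M (t x) z"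
  let ?L = "tensor_lift K M ?b"
  note tl = tensor_lift_lin[OF C0 C0 M trilinD(1)[OF t]]
  have b: "bilin K C ?CC M ?b"
    using tl lift_param_lin[OF C0 C0 C0 M t] by (intro bilinI) auto
  have L: "?L \<in> lin_maps K ?CCC M" by (rule tensor_lift_lin[OF C0 CC M b])
  note P = tensor_lift_pure[OF C0 CC M b]
  have LP: "?L (pure_tensor K C ?CC u (pure_tensor K C C v w)) = t u v w"
    if "u \<in> carrier C" "v \<in> carrier C" "w \<in> carrier C" for u v w
    using that by (simp add: P pure_tensor_closed[OF C0 C0] tensor_lift_pure[OF C0 C0 M trilinD(1)[OF t]])
  have coassoc: "sweedler K C ?CCC (\<lambda>x\<^sub>1 x\<^sub>2. pure_tensor K C ?CC x\<^sub>1 (\<Delta>\<^bsub>C\<^esub> x\<^sub>2)) x =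
        sweedler K C ?CCC (\<lambda>y x\<^sub>3. sweedler K C ?CCC (\<lambda>x\<^sub>1 x\<^sub>2.
          pure_tensor K C ?CC x\<^sub>1 (pure_tensor K C C x\<^sub>2 x\<^sub>3)) y) x"
    using C x unfolding coalgebra_def Let_def by blast
  note [mlin] = C M
  have "sweedler K C M (\<lambda>x\<^sub>1 y. sweedler K C M (t x\<^sub>1) y) x
    = ?L (sweedler K C ?CCC (\<lambda>x\<^sub>1 x\<^sub>2. pure_tensor K C ?CC x\<^sub>1 (\<Delta>\<^bsub>C\<^esub> x\<^sub>2)) x)"
    apply (subst sweedler_lin[OF C CCC M L _ x], (rule mlin | assumption)+)
    apply (rule sweedler_cong[OF C M x])
    subgoal by (rule bilin_rule; (rule mlin t trilinD[OF t] | assumption)+)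
    by (simp add: P comult_closed[OF C] sweedler_def)
  also have "\<dots> = ?L (sweedler K C ?CCC (\<lambda>y x\<^sub>3. sweedler K C ?CCC (\<lambda>x\<^sub>1 x\<^sub>2.
          pure_tensor K C ?CC x\<^sub>1 (pure_tensor K C C x\<^sub>2 x\<^sub>3)) y) x)"
    by (simp only: coassoc)
  also have "\<dots> = sweedler K C M (\<lambda>y x\<^sub>3. sweedler K C M (\<lambda>x\<^sub>1 x\<^sub>2. t x\<^sub>1 x\<^sub>2 x\<^sub>3) y) x"
    apply (subst sweedler_lin[OF C CCC M L _ x], (rule mlin | assumption)+)
    apply (rule sweedler_cong[OF C M x])
    subgoal by (rule bilin_rule; rule lin_comp[OF L]; (rule mlin | assumption)+)
    apply (subst sweedler_lin[OF C CCC M L], (rule mlin | assumption)+)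
    apply (rule sweedler_cong[OF C M], assumption)
    subgoal by (rule bilin_rule; rule lin_comp[OF L]; (rule mlin | assumption)+)
    by (simp add: LP)
  finally show ?thesis .
qed

lemma sweedler_counit_left:
  assumes C: "coalgebra K C" and M: "k_space K M" and g: "g \<in> lin_maps K C M" and x: "x \<in> carrier C"
  shows "sweedler K C M (\<lambda>x\<^sub>1 x\<^sub>2. \<epsilon>\<^bsub>C\<^esub> x\<^sub>1 \<odot>\<^bsub>M\<^esub> g x\<^sub>2) x = g x"
proof -
  note C0 [mlin] = coalgebra_k_space[OF C]
  note [mlin] = C
  have "g x = g (sweedler K C C (\<lambda>x\<^sub>1 x\<^sub>2. \<epsilon>\<^bsub>C\<^esub> x\<^sub>1 \<odot>\<^bsub>C\<^esub> x\<^sub>2) x)"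
    using C x unfolding coalgebra_def by simp
  also have "\<dots> = sweedler K C M (\<lambda>x\<^sub>1 x\<^sub>2. \<epsilon>\<^bsub>C\<^esub> x\<^sub>1 \<odot>\<^bsub>M\<^esub> g x\<^sub>2) x"
    apply (subst sweedler_lin[OF C C0 M g _ x], (rule mlin | assumption)+)
    apply (rule sweedler_cong[OF C M x])
    subgoal by (rule bilin_rule; rule lin_comp[OF g]; (rule mlin | assumption)+)
    by (simp add: lin_smult[OF g] counit_closed[OF C])
  finally show ?thesis ..
qed

lemma sweedler_counit_right:
  assumes C: "coalgebra K C" and M: "k_space K M" and g: "g \<in> lin_maps K C M" and x: "x \<in> carrier C"
  shows "sweedler K C M (\<lambda>x\<^sub>1 x\<^sub>2. \<epsilon>\<^bsub>C\<^esub> x\<^sub>2 \<odot>\<^bsub>M\<^esub> g x\<^sub>1) x = g x"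
proof -
  note C0 [mlin] = coalgebra_k_space[OF C]
  note [mlin] = C
  have "g x = g (sweedler K C C (\<lambda>x\<^sub>1 x\<^sub>2. \<epsilon>\<^bsub>C\<^esub> x\<^sub>2 \<odot>\<^bsub>C\<^esub> x\<^sub>1) x)"
    using C x unfolding coalgebra_def by simp
  also have "\<dots> = sweedler K C M (\<lambda>x\<^sub>1 x\<^sub>2. \<epsilon>\<^bsub>C\<^esub> x\<^sub>2 \<odot>\<^bsub>M\<^esub> g x\<^sub>1) x"
    apply (subst sweedler_lin[OF C C0 M g _ x], (rule mlin | assumption)+)
    apply (rule sweedler_cong[OF C M x])
    subgoal by (rule bilin_rule; rule lin_comp[OF g]; (rule mlin | assumption)+)
    by (simp add: lin_smult[OF g] counit_closed[OF C])
  finally show ?thesis ..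
qed

lemma coalgebra_mapsD:
  assumes "f \<in> coalgebra_maps K C D"
  shows "f \<in> lin_maps K C D"
    and "x \<in> carrier C \<Longrightarrow> \<Delta>\<^bsub>D\<^esub> (f x) =
      sweedler K C (tensor_space K D D) (\<lambda>x\<^sub>1 x\<^sub>2. pure_tensor K D D (f x\<^sub>1) (f x\<^sub>2)) x"
    and "x \<in> carrier C \<Longrightarrow> \<epsilon>\<^bsub>D\<^esub> (f x) = \<epsilon>\<^bsub>C\<^esub> x"
  using assms unfolding coalgebra_maps_def by auto

text \<open>
Assuming comultiplicativity pointwise makes the rule available when \<open>D\<close>, a vector space with an
operation \<open>\<Delta>\<close>, is yet to be shown to be a coalgebra.
\<close>

lemma sweedler_map:
  assumes C: "coalgebra K C" and D: "k_space K D" and M: "k_space K M"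
    and f: "f \<in> lin_maps K C D"
    and com: "\<Delta>\<^bsub>D\<^esub> (f x) = sweedler K C (tensor_space K D D) (\<lambda>x\<^sub>1 x\<^sub>2. pure_tensor K D D (f x\<^sub>1) (f x\<^sub>2)) x"
    and b: "bilin K D D M b" and x: "x \<in> carrier C"
  shows "sweedler K D M b (f x) = sweedler K C M (\<lambda>x\<^sub>1 x\<^sub>2. b (f x\<^sub>1) (f x\<^sub>2)) x"
proof -
  have DD: "k_space K (tensor_space K D D)" by (intro tensor_space_k_space D)
  note L = tensor_lift_lin[OF D D M b]
  have fb: "bilin K C C (tensor_space K D D) (\<lambda>x\<^sub>1 x\<^sub>2. pure_tensor K D D (f x\<^sub>1) (f x\<^sub>2))"
    by (rule bilin_rule; (rule mlin D f | rule lin_closed[OF f] | assumption)+)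
  have "sweedler K D M b (f x) =
    tensor_lift K M b (sweedler K C (tensor_space K D D) (\<lambda>x\<^sub>1 x\<^sub>2. pure_tensor K D D (f x\<^sub>1) (f x\<^sub>2)) x)"
    unfolding sweedler_def[of K D] com ..
  also have "\<dots> = sweedler K C M (\<lambda>x\<^sub>1 x\<^sub>2. b (f x\<^sub>1) (f x\<^sub>2)) x"
    apply (subst sweedler_lin[OF C DD M L fb x])
    apply (rule sweedler_cong[OF C M x])
    subgoal using lin_comp[OF L bilinD(1)[OF fb]] lin_comp[OF L bilinD(2)[OF fb]] by (intro bilinI) auto
    by (simp add: tensor_lift_pure[OF D D M b] lin_closed[OF f])
  finally show ?thesis .
qed

lemma bialgebraD:
  assumes "bialgebra K B"
  shows bialgebra_algebra: "k_algebra K B" and bialgebra_coalgebra: "coalgebra K B" and "k_space K B"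
    and "\<Delta>\<^bsub>B\<^esub> \<in> ring_hom B (tensor_algebra K B B)" "\<epsilon>\<^bsub>B\<^esub> \<in> ring_hom B K"
  using assms unfolding bialgebra_def coalgebra_def by auto

lemma sweedler_mult:
  assumes B: "bialgebra K B" and M: "k_space K M" and b: "bilin K B B M b"
    and xy: "x \<in> carrier B" "y \<in> carrier B"
  shows "sweedler K B M b (x \<otimes>\<^bsub>B\<^esub> y) =
    sweedler K B M (\<lambda>x\<^sub>1 x\<^sub>2. sweedler K B M (\<lambda>y\<^sub>1 y\<^sub>2. b (x\<^sub>1 \<otimes>\<^bsub>B\<^esub> y\<^sub>1) (x\<^sub>2 \<otimes>\<^bsub>B\<^esub> y\<^sub>2)) y) x"
proof -
  note B' [mlin] = bialgebraD(1-3)[OF B]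
  let ?BB = "tensor_space K B B"
  have BB [mlin]: "k_space K ?BB" by (intro tensor_space_k_space B')
  note L = tensor_lift_lin[OF B'(3) B'(3) M b]
  let ?t = "\<lambda>x\<^sub>1 x\<^sub>2 y\<^sub>1 y\<^sub>2. pure_tensor K B B (x\<^sub>1 \<otimes>\<^bsub>B\<^esub> y\<^sub>1) (x\<^sub>2 \<otimes>\<^bsub>B\<^esub> y\<^sub>2)"
  have "sweedler K B M b (x \<otimes>\<^bsub>B\<^esub> y) = tensor_lift K M b (\<Delta>\<^bsub>B\<^esub> (x \<otimes>\<^bsub>B\<^esub> y))"
    by (simp add: sweedler_def)
  also have "\<Delta>\<^bsub>B\<^esub> (x \<otimes>\<^bsub>B\<^esub> y) = sweedler K B ?BB (\<lambda>x\<^sub>1 x\<^sub>2. sweedler K B ?BB (?t x\<^sub>1 x\<^sub>2) y) x"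
    using ring_hom_mult[OF bialgebraD(4)[OF B] xy] by (simp add: tensor_algebra_def sweedler_def)
  also have "tensor_lift K M b \<dots> =
    sweedler K B M (\<lambda>x\<^sub>1 x\<^sub>2. sweedler K B M (\<lambda>y\<^sub>1 y\<^sub>2. b (x\<^sub>1 \<otimes>\<^bsub>B\<^esub> y\<^sub>1) (x\<^sub>2 \<otimes>\<^bsub>B\<^esub> y\<^sub>2)) y) x"
    apply (subst sweedler_lin[OF B'(2) BB M L _ xy(1)], (rule mlin xy | assumption)+)
    apply (rule sweedler_cong[OF B'(2) M xy(1)])
    subgoal by (rule bilin_rule; rule lin_comp[OF L]; (rule mlin xy | assumption)+)
    apply (subst sweedler_lin[OF B'(2) BB M L _ xy(2)], (rule mlin xy | assumption)+)
    apply (rule sweedler_cong[OF B'(2) M xy(2)])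
    subgoal by (rule bilin_rule; rule lin_comp[OF L]; (rule mlin xy | assumption)+)
    by (simp add: tensor_lift_pure[OF B'(3) B'(3) M b] mult_mem[OF B'(1)])
  finally show ?thesis .
qed

lemma sweedler_one:
  assumes B: "bialgebra K B" and M: "k_space K M" and b: "bilin K B B M b"
  shows "sweedler K B M b \<one>\<^bsub>B\<^esub> = b \<one>\<^bsub>B\<^esub> \<one>\<^bsub>B\<^esub>"
proof -
  note B' = bialgebraD(1-3)[OF B]
  have "\<Delta>\<^bsub>B\<^esub> \<one>\<^bsub>B\<^esub> = pure_tensor K B B \<one>\<^bsub>B\<^esub> \<one>\<^bsub>B\<^esub>"
    using ring_hom_one[OF bialgebraD(4)[OF B]] by (simp add: tensor_algebra_def)
  then show ?thesis unfolding sweedler_def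
    by (simp add: tensor_lift_pure[OF B'(3) B'(3) M b] one_mem[OF B'(1)])
qed

section \<open>Hopf algebra maps\<close>

lemma sweedler_coalgebra_map:
  assumes C: "coalgebra K C" and D: "coalgebra K D" and M: "k_space K M"
    and f: "f \<in> coalgebra_maps K C D" and b: "bilin K D D M b" and x: "x \<in> carrier C"
  shows "sweedler K D M b (f x) = sweedler K C M (\<lambda>x\<^sub>1 x\<^sub>2. b (f x\<^sub>1) (f x\<^sub>2)) x"
  by (rule sweedler_map[OF C coalgebra_k_space[OF D] M coalgebra_mapsD(1)[OF f]
        coalgebra_mapsD(2)[OF f x] b x])

lemma coalgebra_mapsI:
  assumes "f \<in> lin_maps K C D"
    and "\<And>x. x \<in> carrier C \<Longrightarrow> \<Delta>\<^bsub>D\<^esub> (f x) =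
      sweedler K C (tensor_space K D D) (\<lambda>x\<^sub>1 x\<^sub>2. pure_tensor K D D (f x\<^sub>1) (f x\<^sub>2)) x"
    and "\<And>x. x \<in> carrier C \<Longrightarrow> \<epsilon>\<^bsub>D\<^esub> (f x) = \<epsilon>\<^bsub>C\<^esub> x"
  shows "f \<in> coalgebra_maps K C D"
  using assms unfolding coalgebra_maps_def by auto

lemma tensor_map_bilin:
  assumes "k_space K V'" "k_space K W'" "f \<in> lin_maps K V V'" "g \<in> lin_maps K W W'"
  shows "bilin K V W (tensor_space K V' W') (\<lambda>v w. pure_tensor K V' W' (f v) (g w))"
  using assms by (intro bilinI pure_tensor_left pure_tensor_right) (auto intro: lin_closed)

lemma coalgebra_maps_cong:
  assumes C: "coalgebra K C" and D: "coalgebra K D" and f: "f \<in> coalgebra_maps K C D"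
    and eq: "\<And>x. x \<in> carrier C \<Longrightarrow> g x = f x"
  shows "g \<in> coalgebra_maps K C D"
proof (rule coalgebra_mapsI)
  note D0 = coalgebra_k_space[OF D] and f0 = coalgebra_mapsD(1)[OF f]
  show "g \<in> lin_maps K C D" by (rule lin_cong[OF coalgebra_k_space[OF C] f0 eq[symmetric]])
  fix x assume x: "x \<in> carrier C"
  show "\<epsilon>\<^bsub>D\<^esub> (g x) = \<epsilon>\<^bsub>C\<^esub> x" by (simp add: eq x coalgebra_mapsD(3)[OF f])
  have "\<Delta>\<^bsub>D\<^esub> (g x) = sweedler K C (tensor_space K D D) (\<lambda>x\<^sub>1 x\<^sub>2. pure_tensor K D D (f x\<^sub>1) (f x\<^sub>2)) x"
    by (simp add: eq x coalgebra_mapsD(2)[OF f])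
  also have "\<dots> = sweedler K C (tensor_space K D D) (\<lambda>x\<^sub>1 x\<^sub>2. pure_tensor K D D (g x\<^sub>1) (g x\<^sub>2)) x"
    by (rule sweedler_cong[OF C tensor_space_k_space[OF D0 D0] x tensor_map_bilin[OF D0 D0 f0 f0]])
      (simp add: eq)
  finally show "\<Delta>\<^bsub>D\<^esub> (g x) = \<dots>" .
qed

lemma coalgebra_maps_comp:
  assumes C: "coalgebra K C" and D: "coalgebra K D" and F: "coalgebra K F"
    and f: "f \<in> coalgebra_maps K C D" and g: "g \<in> coalgebra_maps K D F"
  shows "(\<lambda>x. g (f x)) \<in> coalgebra_maps K C F"
proof (rule coalgebra_mapsI)
  note F0 = coalgebra_k_space[OF F] and f0 = coalgebra_mapsD(1)[OF f] and g0 = coalgebra_mapsD(1)[OF g]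
  show "(\<lambda>x. g (f x)) \<in> lin_maps K C F" by (rule lin_comp[OF g0 f0])
  fix x assume x: "x \<in> carrier C"
  note fx = lin_closed[OF f0 x]
  show "\<epsilon>\<^bsub>F\<^esub> (g (f x)) = \<epsilon>\<^bsub>C\<^esub> x"
    by (simp add: coalgebra_mapsD(3)[OF g fx] coalgebra_mapsD(3)[OF f x])
  show "\<Delta>\<^bsub>F\<^esub> (g (f x)) =
    sweedler K C (tensor_space K F F) (\<lambda>x\<^sub>1 x\<^sub>2. pure_tensor K F F (g (f x\<^sub>1)) (g (f x\<^sub>2))) x"
    unfolding coalgebra_mapsD(2)[OF g fx]
    by (rule sweedler_coalgebra_map[OF C D tensor_space_k_space[OF F0 F0] f tensor_map_bilin[OF F0 F0 g0 g0] x])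
qed

lemma hopf_mapsD:
  assumes "f \<in> hopf_maps K A B"
  shows "f \<in> ring_hom A B" "f \<in> coalgebra_maps K A B" "f \<in> lin_maps K A B"
  using assms unfolding hopf_maps_def coalgebra_maps_def by auto

lemma hopf_maps_cong:
  assumes A: "bialgebra K A" and B: "bialgebra K B" and f: "f \<in> hopf_maps K A B"
    and eq: "\<And>x. x \<in> carrier A \<Longrightarrow> g x = f x"
  shows "g \<in> hopf_maps K A B"
proof -
  have "g \<in> ring_hom A B"
    using hopf_mapsD(1)[OF f] eq mult_mem[OF bialgebraD(1)[OF A]] one_mem[OF bialgebraD(1)[OF A]]
    unfolding ring_hom_def
    by (auto simp: Pi_iff abelian_monoid.a_closed k_spaceD(5)[OF bialgebraD(3)[OF A]])
  then show ?thesis unfolding hopf_maps_def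
    using coalgebra_maps_cong[OF bialgebraD(2)[OF A] bialgebraD(2)[OF B] hopf_mapsD(2)[OF f] eq] by blast
qed

lemma hopf_maps_comp:
  assumes A: "bialgebra K A" and B: "bialgebra K B" and C: "bialgebra K C"
    and f: "f \<in> hopf_maps K A B" and g: "g \<in> hopf_maps K B C"
  shows "(\<lambda>x. g (f x)) \<in> hopf_maps K A C"
proof -
  have "(\<lambda>x. g (f x)) \<in> ring_hom A C"
    using ring_hom_trans[OF hopf_mapsD(1)[OF f] hopf_mapsD(1)[OF g]] by (simp add: comp_def)
  then show ?thesis unfolding hopf_maps_def
    using coalgebra_maps_comp[OF bialgebraD(2)[OF A] bialgebraD(2)[OF B] bialgebraD(2)[OF C]
        hopf_mapsD(2)[OF f] hopf_mapsD(2)[OF g]] by blast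
qed

text \<open>
Apply \<open>\<theta> \<otimes> id\<close> to the equation \<open>x\<^sub>1 \<otimes> \<pi>(x\<^sub>2) = x \<otimes> 1\<close>.
\<close>

lemma coinvariants_map:
  assumes E: "coalgebra K E" and B: "coalgebra K B" and H: "k_space K H"
    and \<theta>: "\<theta> \<in> coalgebra_maps K E B" and \<pi>': "\<pi>' \<in> lin_maps K B H"
    and \<pi>: "\<And>x. x \<in> carrier E \<Longrightarrow> \<pi>' (\<theta> x) = \<pi> x"
    and one: "\<one>\<^bsub>H\<^esub> \<in> carrier H"
    and x: "x \<in> coinvariants K E H \<pi>"
  shows "\<theta> x \<in> coinvariants K B H \<pi>'"
proof -
  note [mlin] = E B H coalgebra_k_space[OF E] coalgebra_k_space[OF B]
  note \<theta>0 = coalgebra_mapsD(1)[OF \<theta>]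
  have [mlin]: "k_space K (tensor_space K B H)" "k_space K (tensor_space K E H)"
    by (rule tensor_space_k_space mlin)+
  have x': "x \<in> carrier E" using x unfolding coinvariants_def by auto
  have \<pi>0: "\<pi> \<in> lin_maps K E H"
    by (rule lin_cong[OF coalgebra_k_space[OF E] lin_comp[OF \<pi>' \<theta>0] \<pi>])
  let ?L = "tensor_lift K (tensor_space K B H) (\<lambda>a h. pure_tensor K B H (\<theta> a) h)"
  have b: "bilin K E H (tensor_space K B H) (\<lambda>a h. pure_tensor K B H (\<theta> a) h)"
    by (rule tensor_map_bilin[OF coalgebra_k_space[OF B] H \<theta>0 lin_id])
  have L: "?L \<in> lin_maps K (tensor_space K E H) (tensor_space K B H)"
    by (rule tensor_lift_lin[OF _ _ _ b]) (rule mlin)+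
  have LP: "?L (pure_tensor K E H a h) = pure_tensor K B H (\<theta> a) h"
    if "a \<in> carrier E" "h \<in> carrier H" for a h
    by (rule tensor_lift_pure[OF _ _ _ b that]) (rule mlin)+
  have "sweedler K B (tensor_space K B H) (\<lambda>x\<^sub>1 x\<^sub>2. pure_tensor K B H x\<^sub>1 (\<pi>' x\<^sub>2)) (\<theta> x)
    = sweedler K E (tensor_space K B H) (\<lambda>x\<^sub>1 x\<^sub>2. pure_tensor K B H (\<theta> x\<^sub>1) (\<pi>' (\<theta> x\<^sub>2))) x"
    by (rule sweedler_coalgebra_map[OF E B _ \<theta> tensor_map_bilin[OF _ _ lin_id \<pi>'] x']) (rule mlin)+
  also have "\<dots> = sweedler K E (tensor_space K B H) (\<lambda>x\<^sub>1 x\<^sub>2. ?L (pure_tensor K E H x\<^sub>1 (\<pi> x\<^sub>2))) x"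
    by (rule sweedler_cong[OF E _ x'], rule mlin, rule tensor_map_bilin[OF _ _ \<theta>0 lin_comp[OF \<pi>' \<theta>0]])
      (auto intro: mlin simp: LP \<pi> lin_closed[OF \<pi>0])
  also have "\<dots> = ?L (sweedler K E (tensor_space K E H) (\<lambda>x\<^sub>1 x\<^sub>2. pure_tensor K E H x\<^sub>1 (\<pi> x\<^sub>2)) x)"
    by (rule sweedler_lin[OF E _ _ L tensor_map_bilin[OF _ _ lin_id \<pi>0] x', symmetric]) (rule mlin)+
  also have "\<dots> = ?L (pure_tensor K E H x \<one>\<^bsub>H\<^esub>)" using x unfolding coinvariants_def by simp
  also have "\<dots> = pure_tensor K B H (\<theta> x) \<one>\<^bsub>H\<^esub>" by (simp add: LP x' one)
  finally show ?thesis unfolding coinvariants_def using lin_closed[OF \<theta>0 x'] by simp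
qed

section \<open>Transport of structure\<close>

text \<open>
A linear bijection that matches the operations of \<open>B\<close> with those of a Hopf algebra \<open>E\<close> makes \<open>B\<close> a
Hopf algebra, and an extension with middle term \<open>E\<close> becomes an equivalent one with middle term \<open>B\<close>. As
every element of \<open>B\<close> has the form \<open>\<theta> y\<close>, each axiom for \<open>B\<close> is rewritten, by multiplicativity of \<open>\<theta>\<close> and
by \<open>\<Delta>(\<theta> y) = \<theta> y\<^sub>1 \<otimes> \<theta> y\<^sub>2\<close>, into the image under \<open>\<theta>\<close> of the corresponding axiom for \<open>E\<close>.
\<close>

locale transport =
  fixes K :: "('k, 'l) ring_scheme" and E :: "('k, 'e, 'm) bialg_scheme"
    and B :: "('k, 'b, 'n) bialg_scheme" and \<theta> :: "'e \<Rightarrow> 'b" and \<psi> :: "'b \<Rightarrow> 'e"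
  assumes E: "hopf_algebra K E" and B0: "k_space K B"
    and \<theta>: "\<theta> \<in> lin_maps K E B" and \<psi>: "\<psi> \<in> lin_maps K B E"
    and \<psi>\<theta>: "x \<in> carrier E \<Longrightarrow> \<psi> (\<theta> x) = x"
    and \<theta>\<psi>: "y \<in> carrier B \<Longrightarrow> \<theta> (\<psi> y) = y"
    and mult: "\<lbrakk>x \<in> carrier E; x' \<in> carrier E\<rbrakk> \<Longrightarrow> \<theta> x \<otimes>\<^bsub>B\<^esub> \<theta> x' = \<theta> (x \<otimes>\<^bsub>E\<^esub> x')"
    and one: "\<one>\<^bsub>B\<^esub> = \<theta> \<one>\<^bsub>E\<^esub>"
    and comult: "x \<in> carrier E \<Longrightarrow> \<Delta>\<^bsub>B\<^esub> (\<theta> x) =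
      sweedler K E (tensor_space K B B) (\<lambda>x\<^sub>1 x\<^sub>2. pure_tensor K B B (\<theta> x\<^sub>1) (\<theta> x\<^sub>2)) x"
    and counit: "x \<in> carrier E \<Longrightarrow> \<epsilon>\<^bsub>B\<^esub> (\<theta> x) = \<epsilon>\<^bsub>E\<^esub> x"
begin

lemma bialgebra_E: "bialgebra K E" using E unfolding hopf_algebra_def by simp

lemmas E' = bialgebraD(1-3)[OF bialgebra_E]

lemma BB: "k_space K (tensor_space K B B)" by (rule tensor_space_k_space[OF B0 B0])

lemma BBB: "k_space K (tensor_space K B (tensor_space K B B))" by (rule tensor_space_k_space[OF B0 BB])

lemmas \<theta>_closed = lin_closed[OF \<theta>]

lemmas \<psi>_closed = lin_closed[OF \<psi>]

lemmas tr = mlin E' B0 BB BBB lin_comp[OF \<theta>] lin_closed[OF \<theta>] lin_comp[OF \<psi>] lin_closed[OF \<psi>]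

lemma mult_B: "\<lbrakk>x \<in> carrier B; y \<in> carrier B\<rbrakk> \<Longrightarrow> x \<otimes>\<^bsub>B\<^esub> y = \<theta> (\<psi> x \<otimes>\<^bsub>E\<^esub> \<psi> y)"
  using mult[of "\<psi> x" "\<psi> y"] by (simp add: \<theta>\<psi> \<psi>_closed)

lemma algebra_B: "k_algebra K B"
proof -
  interpret E: ring E by (rule k_algebraD(2)[OF E'(1)])
  interpret B: module K B by (rule k_spaceD(3)[OF B0])
  have "monoid B"
    by (rule monoidI) (simp_all add: one mult_B \<psi>\<theta> \<theta>\<psi> \<theta>_closed \<psi>_closed E.m_assoc)
  then have "ring B"
    by (intro ringI B.M.abelian_group_axioms)
      (simp_all add: mult_B \<psi>\<theta> \<theta>\<psi> \<theta>_closed \<psi>_closed lin_add[OF \<psi>] lin_add[OF \<theta>, symmetric] E.l_distr E.r_distr)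
  then show ?thesis unfolding k_algebra_def
    using B0 by (auto simp: mult_B \<theta>_closed \<psi>_closed lin_smult[OF \<psi>] lin_smult[OF \<theta>, symmetric]
        k_algebraD(3,4)[OF E'(1)])
qed

lemma comult_B_lin: "\<Delta>\<^bsub>B\<^esub> \<in> lin_maps K B (tensor_space K B B)"
proof (rule lin_cong[OF B0])
  show "(\<lambda>y. sweedler K E (tensor_space K B B) (\<lambda>x\<^sub>1 x\<^sub>2. pure_tensor K B B (\<theta> x\<^sub>1) (\<theta> x\<^sub>2)) (\<psi> y))
    \<in> lin_maps K B (tensor_space K B B)"
    by (rule tr | assumption)+
qed (simp add: comult[symmetric] \<psi>_closed \<theta>\<psi>)

lemma counit_B_lin: "\<epsilon>\<^bsub>B\<^esub> \<in> lin_maps K B (scalars K)"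
proof (rule lin_cong[OF B0])
  show "(\<lambda>y. \<epsilon>\<^bsub>E\<^esub> (\<psi> y)) \<in> lin_maps K B (scalars K)"
    by (rule tr | assumption)+
qed (simp add: counit[symmetric] \<psi>_closed \<theta>\<psi>)

lemma counit_B_closed: "x \<in> carrier B \<Longrightarrow> \<epsilon>\<^bsub>B\<^esub> x \<in> carrier K"
  using lin_closed[OF counit_B_lin] by (simp add: scalars_def)

lemmas tr' = tr algebra_B lin_comp[OF comult_B_lin] lin_closed[OF comult_B_lin] lin_comp[OF counit_B_lin]

lemma sweedler_B:
  assumes M: "k_space K M" and b: "bilin K B B M b" and x: "x \<in> carrier E"
  shows "sweedler K B M b (\<theta> x) = sweedler K E M (\<lambda>x\<^sub>1 x\<^sub>2. b (\<theta> x\<^sub>1) (\<theta> x\<^sub>2)) x"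
  by (rule sweedler_map[OF E'(2) B0 M \<theta> comult[OF x] b x])

text \<open>
The analogues for \<open>B\<close> of the linearity rules for Sweedler sums over a coalgebra, for use in the proof
that \<open>B\<close> is one.
\<close>

lemma sweedler_B_comp:
  assumes M: "k_space K M" and b: "bilin K B B M b" and t: "t \<in> lin_maps K U B"
  shows "(\<lambda>x. sweedler K B M b (t x)) \<in> lin_maps K U M"
  unfolding sweedler_def
  by (rule lin_comp[OF tensor_lift_lin[OF B0 B0 M b] lin_comp[OF comult_B_lin t]])

lemma sweedler_B_param:
  assumes U: "k_space K U" and M: "k_space K M" and t: "trilin K U B B M t" and x: "x \<in> carrier B"
  shows "(\<lambda>u. sweedler K B M (t u) x) \<in> lin_maps K U M"
  unfolding sweedler_def
  by (rule lift_param_lin[OF U B0 B0 M t lin_closed[OF comult_B_lin x]])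

lemma coassoc_B:
  assumes y: "y \<in> carrier E"
  shows "sweedler K B (tensor_space K B (tensor_space K B B))
      (\<lambda>x\<^sub>1 x\<^sub>2. pure_tensor K B (tensor_space K B B) x\<^sub>1 (\<Delta>\<^bsub>B\<^esub> x\<^sub>2)) (\<theta> y) =
    sweedler K B (tensor_space K B (tensor_space K B B)) (\<lambda>z x\<^sub>3.
      sweedler K B (tensor_space K B (tensor_space K B B)) (\<lambda>x\<^sub>1 x\<^sub>2.
        pure_tensor K B (tensor_space K B B) x\<^sub>1 (pure_tensor K B B x\<^sub>2 x\<^sub>3)) z) (\<theta> y)"
    (is "sweedler K B ?BBB (\<lambda>x\<^sub>1 x\<^sub>2. ?p x\<^sub>1 (\<Delta>\<^bsub>B\<^esub> x\<^sub>2)) _ = ?R")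
proof -
  let ?BB = "tensor_space K B B"
  let ?t = "\<lambda>u v w. ?p (\<theta> u) (pure_tensor K B B (\<theta> v) (\<theta> w))"
  have pl: "?p u \<in> lin_maps K ?BB ?BBB" if "u \<in> carrier B" for u
    using bilinD(1)[OF pure_tensor_bilin[OF B0 BB] that] .
  have "sweedler K B ?BBB (\<lambda>x\<^sub>1 x\<^sub>2. ?p x\<^sub>1 (\<Delta>\<^bsub>B\<^esub> x\<^sub>2)) (\<theta> y) =
    sweedler K E ?BBB (\<lambda>u z. ?p (\<theta> u) (\<Delta>\<^bsub>B\<^esub> (\<theta> z))) y"
    by (rule sweedler_B[OF BBB _ y]) (rule tr' | assumption)+
  also have "\<dots> = sweedler K E ?BBB (\<lambda>u z. sweedler K E ?BBB (?t u) z) y"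
    apply (rule sweedler_cong[OF E'(2) BBB y])
    subgoal by (rule tr' | assumption)+
    apply (subst comult, assumption)
    apply (rule sweedler_lin[OF E'(2) BB BBB pl])
      apply (rule tr' | assumption)+
    done
  also have "\<dots> = sweedler K E ?BBB (\<lambda>z w. sweedler K E ?BBB (\<lambda>u v. ?t u v w) z) y"
    by (rule sweedler_coassoc[OF E'(2) BBB _ y]) (rule tr' | assumption)+
  also have "\<dots> = sweedler K E ?BBB (\<lambda>z w. sweedler K B ?BBB (\<lambda>x\<^sub>1 x\<^sub>2. ?p x\<^sub>1 (pure_tensor K B B x\<^sub>2 (\<theta> w))) (\<theta> z)) y"
    apply (rule sweedler_cong[OF E'(2) BBB y])
    subgoal by (rule tr' | assumption)+
    apply (rule sweedler_B[OF BBB, symmetric])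
     apply (rule tr' | assumption)+
    done
  also have "\<dots> = ?R"
    by (rule sweedler_B[OF BBB _ y, symmetric]) (rule sweedler_B_comp sweedler_B_param tr' | assumption)+
  finally show ?thesis .
qed

lemma coalgebra_B: "coalgebra K B"
proof -
  have counitl: "sweedler K B B (\<lambda>x\<^sub>1 x\<^sub>2. \<epsilon>\<^bsub>B\<^esub> x\<^sub>1 \<odot>\<^bsub>B\<^esub> x\<^sub>2) (\<theta> y) = \<theta> y" if y: "y \<in> carrier E" for y
  proof -
    have "sweedler K B B (\<lambda>x\<^sub>1 x\<^sub>2. \<epsilon>\<^bsub>B\<^esub> x\<^sub>1 \<odot>\<^bsub>B\<^esub> x\<^sub>2) (\<theta> y) =
      sweedler K E B (\<lambda>x\<^sub>1 x\<^sub>2. \<epsilon>\<^bsub>B\<^esub> (\<theta> x\<^sub>1) \<odot>\<^bsub>B\<^esub> \<theta> x\<^sub>2) y"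
      by (rule sweedler_B[OF B0 _ y]) (rule counit_B_closed counit_B_lin tr' | assumption)+
    also have "\<dots> = sweedler K E B (\<lambda>x\<^sub>1 x\<^sub>2. \<epsilon>\<^bsub>E\<^esub> x\<^sub>1 \<odot>\<^bsub>B\<^esub> \<theta> x\<^sub>2) y"
      by (rule sweedler_cong[OF E'(2) B0 y, symmetric]) ((rule tr' \<theta> | assumption)+, simp add: counit)
    also have "\<dots> = \<theta> y" by (rule sweedler_counit_left[OF E'(2) B0 \<theta> y])
    finally show ?thesis .
  qed
  have counitr: "sweedler K B B (\<lambda>x\<^sub>1 x\<^sub>2. \<epsilon>\<^bsub>B\<^esub> x\<^sub>2 \<odot>\<^bsub>B\<^esub> x\<^sub>1) (\<theta> y) = \<theta> y" if y: "y \<in> carrier E" for y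
  proof -
    have "sweedler K B B (\<lambda>x\<^sub>1 x\<^sub>2. \<epsilon>\<^bsub>B\<^esub> x\<^sub>2 \<odot>\<^bsub>B\<^esub> x\<^sub>1) (\<theta> y) =
      sweedler K E B (\<lambda>x\<^sub>1 x\<^sub>2. \<epsilon>\<^bsub>B\<^esub> (\<theta> x\<^sub>2) \<odot>\<^bsub>B\<^esub> \<theta> x\<^sub>1) y"
      by (rule sweedler_B[OF B0 _ y]) (rule counit_B_closed counit_B_lin tr' | assumption)+
    also have "\<dots> = sweedler K E B (\<lambda>x\<^sub>1 x\<^sub>2. \<epsilon>\<^bsub>E\<^esub> x\<^sub>2 \<odot>\<^bsub>B\<^esub> \<theta> x\<^sub>1) y"
      by (rule sweedler_cong[OF E'(2) B0 y, symmetric]) ((rule tr' \<theta> | assumption)+, simp add: counit)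
    also have "\<dots> = \<theta> y" by (rule sweedler_counit_right[OF E'(2) B0 \<theta> y])
    finally show ?thesis .
  qed
  show ?thesis unfolding coalgebra_def Let_def
    using B0 comult_B_lin counit_B_lin coassoc_B[OF \<psi>_closed] counitl[OF \<psi>_closed] counitr[OF \<psi>_closed]
    by (simp add: \<theta>\<psi>)
qed

lemma bialgebra_B: "bialgebra K B"
proof -
  let ?BB = "tensor_space K B B"
  have mul: "\<Delta>\<^bsub>B\<^esub> (\<theta> x \<otimes>\<^bsub>B\<^esub> \<theta> y) = \<Delta>\<^bsub>B\<^esub> (\<theta> x) \<otimes>\<^bsub>tensor_algebra K B B\<^esub> \<Delta>\<^bsub>B\<^esub> (\<theta> y)"
    if x: "x \<in> carrier E" and y: "y \<in> carrier E" for x y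
  proof -
    let ?t = "\<lambda>a b a' b'. pure_tensor K B B (a \<otimes>\<^bsub>B\<^esub> a') (b \<otimes>\<^bsub>B\<^esub> b')"
    have xy: "x \<otimes>\<^bsub>E\<^esub> y \<in> carrier E" by (rule mult_mem[OF E'(1) x y])
    have "\<Delta>\<^bsub>B\<^esub> (\<theta> x) \<otimes>\<^bsub>tensor_algebra K B B\<^esub> \<Delta>\<^bsub>B\<^esub> (\<theta> y) =
      sweedler K B ?BB (\<lambda>a b. sweedler K B ?BB (?t a b) (\<theta> y)) (\<theta> x)"
      by (simp add: tensor_algebra_def sweedler_def)
    also have "\<dots> = sweedler K E ?BB (\<lambda>a b. sweedler K B ?BB (?t (\<theta> a) (\<theta> b)) (\<theta> y)) x"
      by (rule sweedler_B[OF BB _ x]) (rule sweedler_B_param tr' y | assumption)+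
    also have "\<dots> = sweedler K E ?BB (\<lambda>a b. sweedler K E ?BB
        (\<lambda>a' b'. pure_tensor K B B (\<theta> (a \<otimes>\<^bsub>E\<^esub> a')) (\<theta> (b \<otimes>\<^bsub>E\<^esub> b'))) y) x"
      apply (rule sweedler_cong[OF E'(2) BB x])
      subgoal by (rule sweedler_B_param tr' y | assumption)+
      apply (subst sweedler_B[OF BB _ y])
      subgoal by (rule tr' | assumption)+
      apply (rule sweedler_cong[OF E'(2) BB y])
      subgoal by (rule tr' | assumption)+
      by (simp add: mult)
    also have "\<dots> = \<Delta>\<^bsub>B\<^esub> (\<theta> (x \<otimes>\<^bsub>E\<^esub> y))"
      unfolding comult[OF xy]
      by (rule sweedler_mult[OF bialgebra_E BB _ x y, symmetric]) (rule tr' \<theta> | assumption)+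
    finally show ?thesis by (simp add: mult x y)
  qed
  have eps1: "\<epsilon>\<^bsub>E\<^esub> \<in> ring_hom E K" by (rule bialgebraD(5)[OF bialgebra_E])
  have E1: "\<one>\<^bsub>E\<^esub> \<in> carrier E" by (rule one_mem[OF E'(1)])
  have add: "\<epsilon>\<^bsub>B\<^esub> (x \<oplus>\<^bsub>B\<^esub> y) = \<epsilon>\<^bsub>B\<^esub> x \<oplus>\<^bsub>K\<^esub> \<epsilon>\<^bsub>B\<^esub> y" if "x \<in> carrier B" "y \<in> carrier B" for x y
    using lin_add[OF counit_B_lin that] by (simp add: scalars_def)
  have "\<epsilon>\<^bsub>B\<^esub> \<in> ring_hom B K"
  proof (rule ring_hom_memI)
    fix x y assume xy: "x \<in> carrier B" "y \<in> carrier B"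
    show "\<epsilon>\<^bsub>B\<^esub> x \<in> carrier K" using lin_closed[OF counit_B_lin] xy by (simp add: scalars_def)
    show "\<epsilon>\<^bsub>B\<^esub> (x \<otimes>\<^bsub>B\<^esub> y) = \<epsilon>\<^bsub>B\<^esub> x \<otimes>\<^bsub>K\<^esub> \<epsilon>\<^bsub>B\<^esub> y"
      using counit[of "\<psi> x"] counit[of "\<psi> y"] xy ring_hom_mult[OF eps1]
      by (simp add: mult_B counit \<psi>_closed \<theta>\<psi> mult_mem[OF E'(1)])
    show "\<epsilon>\<^bsub>B\<^esub> (x \<oplus>\<^bsub>B\<^esub> y) = \<epsilon>\<^bsub>B\<^esub> x \<oplus>\<^bsub>K\<^esub> \<epsilon>\<^bsub>B\<^esub> y" by (rule add[OF xy])
  next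
    show "\<epsilon>\<^bsub>B\<^esub> \<one>\<^bsub>B\<^esub> = \<one>\<^bsub>K\<^esub>" using ring_hom_one[OF eps1] by (simp add: one counit E1)
  qed
  moreover have "\<Delta>\<^bsub>B\<^esub> \<in> ring_hom B (tensor_algebra K B B)"
  proof (rule ring_hom_memI)
    fix x y assume xy: "x \<in> carrier B" "y \<in> carrier B"
    show "\<Delta>\<^bsub>B\<^esub> x \<in> carrier (tensor_algebra K B B)"
      using lin_closed[OF comult_B_lin xy(1)] by (simp add: tensor_algebra_def)
    show "\<Delta>\<^bsub>B\<^esub> (x \<otimes>\<^bsub>B\<^esub> y) = \<Delta>\<^bsub>B\<^esub> x \<otimes>\<^bsub>tensor_algebra K B B\<^esub> \<Delta>\<^bsub>B\<^esub> y"
      using mul[OF \<psi>_closed[OF xy(1)] \<psi>_closed[OF xy(2)]] by (simp add: \<theta>\<psi> xy)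
    show "\<Delta>\<^bsub>B\<^esub> (x \<oplus>\<^bsub>B\<^esub> y) = \<Delta>\<^bsub>B\<^esub> x \<oplus>\<^bsub>tensor_algebra K B B\<^esub> \<Delta>\<^bsub>B\<^esub> y"
      using lin_add[OF comult_B_lin xy] by (simp add: tensor_algebra_def)
  next
    have "\<Delta>\<^bsub>B\<^esub> (\<theta> \<one>\<^bsub>E\<^esub>) = pure_tensor K B B (\<theta> \<one>\<^bsub>E\<^esub>) (\<theta> \<one>\<^bsub>E\<^esub>)"
      unfolding comult[OF E1]
      by (rule sweedler_one[OF bialgebra_E BB]) (rule tr' \<theta> | assumption)+
    then show "\<Delta>\<^bsub>B\<^esub> \<one>\<^bsub>B\<^esub> = \<one>\<^bsub>tensor_algebra K B B\<^esub>"
      by (simp add: tensor_algebra_def one)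
  qed
  ultimately show ?thesis unfolding bialgebra_def using algebra_B coalgebra_B by simp
qed

lemma hopf_B: "hopf_algebra K B"
proof -
  obtain S where S: "antipode K E S" using E unfolding hopf_algebra_def by auto
  have Sl: "S \<in> lin_maps K E E" using S unfolding antipode_def by auto
  \<comment> \<open>The antipode of \<open>E\<close>, conjugated by \<open>\<theta>\<close>.\<close>
  let ?S = "\<lambda>x. \<theta> (S (\<psi> x))"
  have S'l: "?S \<in> lin_maps K B B" by (rule lin_comp[OF \<theta> lin_comp[OF Sl \<psi>]])
  note tS = tr' \<theta> \<psi> lin_comp[OF Sl] lin_closed[OF Sl] Sl lin_comp[OF S'l]
  have r: "\<theta> (\<epsilon>\<^bsub>E\<^esub> y \<odot>\<^bsub>E\<^esub> \<one>\<^bsub>E\<^esub>) = \<epsilon>\<^bsub>B\<^esub> (\<theta> y) \<odot>\<^bsub>B\<^esub> \<one>\<^bsub>B\<^esub>" if y: "y \<in> carrier E" for y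
    by (simp add: counit y one lin_smult[OF \<theta>] one_mem[OF E'(1)] counit_closed[OF E'(2)])
  have l: "sweedler K B B (\<lambda>x\<^sub>1 x\<^sub>2. ?S x\<^sub>1 \<otimes>\<^bsub>B\<^esub> x\<^sub>2) (\<theta> y) = \<epsilon>\<^bsub>B\<^esub> (\<theta> y) \<odot>\<^bsub>B\<^esub> \<one>\<^bsub>B\<^esub>"
    if y: "y \<in> carrier E" for y
  proof -
    have "sweedler K B B (\<lambda>x\<^sub>1 x\<^sub>2. ?S x\<^sub>1 \<otimes>\<^bsub>B\<^esub> x\<^sub>2) (\<theta> y)
      = sweedler K E B (\<lambda>x\<^sub>1 x\<^sub>2. ?S (\<theta> x\<^sub>1) \<otimes>\<^bsub>B\<^esub> \<theta> x\<^sub>2) y"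
      by (rule sweedler_B[OF B0 _ y]) (rule tS | assumption)+
    also have "\<dots> = sweedler K E B (\<lambda>x\<^sub>1 x\<^sub>2. \<theta> (S x\<^sub>1 \<otimes>\<^bsub>E\<^esub> x\<^sub>2)) y"
      by (rule sweedler_cong[OF E'(2) B0 y]) ((rule tS | assumption)+, simp add: mult \<psi>\<theta> lin_closed[OF Sl])
    also have "\<dots> = \<theta> (sweedler K E E (\<lambda>x\<^sub>1 x\<^sub>2. S x\<^sub>1 \<otimes>\<^bsub>E\<^esub> x\<^sub>2) y)"
      by (rule sweedler_lin[OF E'(2) E'(3) B0 \<theta> _ y, symmetric]) (rule tS | assumption)+
    also have "\<dots> = \<theta> (\<epsilon>\<^bsub>E\<^esub> y \<odot>\<^bsub>E\<^esub> \<one>\<^bsub>E\<^esub>)" using S y unfolding antipode_def by simp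
    finally show ?thesis using r[OF y] by simp
  qed
  have r': "sweedler K B B (\<lambda>x\<^sub>1 x\<^sub>2. x\<^sub>1 \<otimes>\<^bsub>B\<^esub> ?S x\<^sub>2) (\<theta> y) = \<epsilon>\<^bsub>B\<^esub> (\<theta> y) \<odot>\<^bsub>B\<^esub> \<one>\<^bsub>B\<^esub>"
    if y: "y \<in> carrier E" for y
  proof -
    have "sweedler K B B (\<lambda>x\<^sub>1 x\<^sub>2. x\<^sub>1 \<otimes>\<^bsub>B\<^esub> ?S x\<^sub>2) (\<theta> y)
      = sweedler K E B (\<lambda>x\<^sub>1 x\<^sub>2. \<theta> x\<^sub>1 \<otimes>\<^bsub>B\<^esub> ?S (\<theta> x\<^sub>2)) y"
      by (rule sweedler_B[OF B0 _ y]) (rule tS | assumption)+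
    also have "\<dots> = sweedler K E B (\<lambda>x\<^sub>1 x\<^sub>2. \<theta> (x\<^sub>1 \<otimes>\<^bsub>E\<^esub> S x\<^sub>2)) y"
      by (rule sweedler_cong[OF E'(2) B0 y]) ((rule tS | assumption)+, simp add: mult \<psi>\<theta> lin_closed[OF Sl])
    also have "\<dots> = \<theta> (sweedler K E E (\<lambda>x\<^sub>1 x\<^sub>2. x\<^sub>1 \<otimes>\<^bsub>E\<^esub> S x\<^sub>2) y)"
      by (rule sweedler_lin[OF E'(2) E'(3) B0 \<theta> _ y, symmetric]) (rule tS | assumption)+
    also have "\<dots> = \<theta> (\<epsilon>\<^bsub>E\<^esub> y \<odot>\<^bsub>E\<^esub> \<one>\<^bsub>E\<^esub>)" using S y unfolding antipode_def by simp
    finally show ?thesis using r[OF y] by simp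
  qed
  have "antipode K B ?S" unfolding antipode_def
    using S'l l[OF \<psi>_closed] r'[OF \<psi>_closed] by (simp add: \<theta>\<psi>)
  then show ?thesis unfolding hopf_algebra_def using bialgebra_B by blast
qed

lemma \<theta>_hopf_map: "\<theta> \<in> hopf_maps K E B"
proof -
  have "\<theta> \<in> coalgebra_maps K E B" by (rule coalgebra_mapsI[OF \<theta> comult counit])
  moreover have "\<theta> \<in> ring_hom E B"
    by (rule ring_hom_memI) (simp_all add: \<theta>_closed mult one lin_add[OF \<theta>])
  ultimately show ?thesis unfolding hopf_maps_def by simp
qed

lemma \<psi>_hopf_map: "\<psi> \<in> hopf_maps K B E"
proof -
  have EE: "k_space K (tensor_space K E E)" by (rule tensor_space_k_space[OF E'(3) E'(3)])
  have "\<psi> \<in> coalgebra_maps K B E"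
  proof (rule coalgebra_mapsI[OF \<psi>])
    fix x assume x: "x \<in> carrier B"
    show "\<epsilon>\<^bsub>E\<^esub> (\<psi> x) = \<epsilon>\<^bsub>B\<^esub> x" using counit[OF \<psi>_closed[OF x]] x by (simp add: \<theta>\<psi>)
    have "sweedler K B (tensor_space K E E) (\<lambda>x\<^sub>1 x\<^sub>2. pure_tensor K E E (\<psi> x\<^sub>1) (\<psi> x\<^sub>2)) (\<theta> (\<psi> x))
      = sweedler K E (tensor_space K E E) (\<lambda>x\<^sub>1 x\<^sub>2. pure_tensor K E E (\<psi> (\<theta> x\<^sub>1)) (\<psi> (\<theta> x\<^sub>2))) (\<psi> x)"
      by (rule sweedler_B[OF EE tensor_map_bilin[OF E'(3) E'(3) \<psi> \<psi>] \<psi>_closed[OF x]])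
    also have "\<dots> = sweedler K E (tensor_space K E E) (pure_tensor K E E) (\<psi> x)"
      by (rule sweedler_cong[OF E'(2) EE \<psi>_closed[OF x] pure_tensor_bilin[OF E'(3) E'(3)], symmetric])
        (simp add: \<psi>\<theta>)
    also have "\<dots> = \<Delta>\<^bsub>E\<^esub> (\<psi> x)" by (rule sweedler_pure_tensor[OF E'(2) \<psi>_closed[OF x]])
    finally show "\<Delta>\<^bsub>E\<^esub> (\<psi> x) =
      sweedler K B (tensor_space K E E) (\<lambda>x\<^sub>1 x\<^sub>2. pure_tensor K E E (\<psi> x\<^sub>1) (\<psi> x\<^sub>2)) x"
      by (simp add: \<theta>\<psi> x)
  qed
  moreover have "\<psi> \<in> ring_hom B E"
    by (rule ring_hom_memI)
      (simp_all add: \<psi>_closed mult_B \<psi>\<theta> one lin_add[OF \<psi>] mult_mem[OF E'(1)] one_mem[OF E'(1)])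
  ultimately show ?thesis unfolding hopf_maps_def by simp
qed

lemma equivalent_extension:
  assumes A: "hopf_algebra K A" and H: "hopf_algebra K H"
    and ext: "coalgebra_split_extension K A H E i \<pi>"
    and i': "\<And>a. a \<in> carrier A \<Longrightarrow> i' a = \<theta> (i a)"
    and \<pi>': "\<And>x. x \<in> carrier B \<Longrightarrow> \<pi>' x = \<pi> (\<psi> x)"
  shows "equivalent_extensions K A H E i \<pi> B i' \<pi>'"
proof -
  have A': "bialgebra K A" and H': "bialgebra K H" using A H unfolding hopf_algebra_def by auto
  note H'' = bialgebraD[OF H']
  obtain \<phi> where i: "i \<in> hopf_maps K A E" and inj: "inj_on i (carrier A)" and \<pi>: "\<pi> \<in> hopf_maps K E H"
    and \<phi>: "\<phi> \<in> coalgebra_maps K H E" "\<And>h. h \<in> carrier H \<Longrightarrow> \<pi> (\<phi> h) = h"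
    and co: "i ` carrier A = coinvariants K E H \<pi>"
    using ext unfolding coalgebra_split_extension_def by auto
  note i0 = lin_closed[OF hopf_mapsD(3)[OF i]]
  have i'_hopf: "i' \<in> hopf_maps K A B"
    by (rule hopf_maps_cong[OF A' bialgebra_B hopf_maps_comp[OF A' bialgebra_E bialgebra_B i \<theta>_hopf_map] i'])
  have \<pi>'_hopf: "\<pi>' \<in> hopf_maps K B H"
    by (rule hopf_maps_cong[OF bialgebra_B H' hopf_maps_comp[OF bialgebra_B bialgebra_E H' \<psi>_hopf_map \<pi>] \<pi>'])
  have \<pi>'\<theta>: "\<pi>' (\<theta> x) = \<pi> x" if "x \<in> carrier E" for x using that by (simp add: \<pi>' \<theta>_closed \<psi>\<theta>)
  have "inj_on i' (carrier A)"
  proof (rule inj_onI)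
    fix a a' assume a: "a \<in> carrier A" "a' \<in> carrier A" "i' a = i' a'"
    then have "\<psi> (\<theta> (i a)) = \<psi> (\<theta> (i a'))" by (simp add: i')
    then have "i a = i a'" using a by (simp add: \<psi>\<theta> i0)
    then show "a = a'" using inj a by (auto dest: inj_onD)
  qed
  moreover have "\<exists>\<phi>\<in>coalgebra_maps K H B. \<forall>h\<in>carrier H. \<pi>' (\<phi> h) = h"
    using coalgebra_maps_comp[OF H''(2) E'(2) coalgebra_B \<phi>(1) hopf_mapsD(2)[OF \<theta>_hopf_map]]
      \<phi>(2) \<pi>'\<theta> lin_closed[OF coalgebra_mapsD(1)[OF \<phi>(1)]]
    by (intro bexI[of _ "\<lambda>h. \<theta> (\<phi> h)"]) auto
  moreover have "i' ` carrier A = coinvariants K B H \<pi>'"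
  proof (intro subset_antisym subsetI)
    fix x assume "x \<in> i' ` carrier A"
    then obtain a where a: "a \<in> carrier A" "x = \<theta> (i a)" using i' by auto
    have ia: "i a \<in> coinvariants K E H \<pi>" using co a(1) by blast
    show "x \<in> coinvariants K B H \<pi>'" unfolding a(2)
      by (rule coinvariants_map[OF E'(2) coalgebra_B H''(3) hopf_mapsD(2)[OF \<theta>_hopf_map]
            hopf_mapsD(3)[OF \<pi>'_hopf] \<pi>'\<theta> one_mem[OF H''(1)] ia])
  next
    fix x assume x: "x \<in> coinvariants K B H \<pi>'"
    have xB: "x \<in> carrier B" using x unfolding coinvariants_def by auto
    have "\<psi> x \<in> coinvariants K E H \<pi>"
      by (rule coinvariants_map[OF coalgebra_B E'(2) H''(3) hopf_mapsD(2)[OF \<psi>_hopf_map]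
            hopf_mapsD(3)[OF \<pi>] \<pi>'[symmetric] one_mem[OF H''(1)] x])
    then obtain a where a: "a \<in> carrier A" "\<psi> x = i a" using co by (metis imageE)
    then have "x = i' a" using \<theta>\<psi>[OF xB] by (simp add: i')
    then show "x \<in> i' ` carrier A" using a(1) by simp
  qed
  ultimately have "coalgebra_split_extension K A H B i' \<pi>'"
    unfolding coalgebra_split_extension_def using hopf_B i'_hopf \<pi>'_hopf by simp
  moreover have "bij_betw \<theta> (carrier E) (carrier B)"
    by (rule bij_betw_byWitness[where f'=\<psi>]) (auto simp: \<psi>\<theta> \<theta>\<psi> \<theta>_closed \<psi>_closed)
  ultimately show ?thesis
    unfolding equivalent_extensions_def hopf_isos_def using ext \<theta>_hopf_map i' \<pi>'\<theta>
    by (intro conjI bexI[of _ \<theta>]) auto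
qed

end

section \<open>Normalised sections\<close>

lemma sweedler_grouplike:
  assumes C: "k_space K C" and M: "k_space K M" and b: "bilin K C C M b"
    and g: "g \<in> carrier C" "\<Delta>\<^bsub>C\<^esub> g = pure_tensor K C C g g"
  shows "sweedler K C M b g = b g g"
  unfolding sweedler_def g(2) by (rule tensor_lift_pure[OF C C M b g(1) g(1)])

lemma counit_ring_hom:
  assumes "bialgebra K B"
  shows "\<lbrakk>x \<in> carrier B; y \<in> carrier B\<rbrakk> \<Longrightarrow> \<epsilon>\<^bsub>B\<^esub> (x \<otimes>\<^bsub>B\<^esub> y) = \<epsilon>\<^bsub>B\<^esub> x \<otimes>\<^bsub>K\<^esub> \<epsilon>\<^bsub>B\<^esub> y"
    and "\<epsilon>\<^bsub>B\<^esub> \<one>\<^bsub>B\<^esub> = \<one>\<^bsub>K\<^esub>"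
  using ring_hom_mult[OF bialgebraD(5)[OF assms]] ring_hom_one[OF bialgebraD(5)[OF assms]] by auto

lemma antipodeD:
  assumes "antipode K B S"
  shows "S \<in> lin_maps K B B"
    and "x \<in> carrier B \<Longrightarrow> sweedler K B B (\<lambda>x\<^sub>1 x\<^sub>2. S x\<^sub>1 \<otimes>\<^bsub>B\<^esub> x\<^sub>2) x = \<epsilon>\<^bsub>B\<^esub> x \<odot>\<^bsub>B\<^esub> \<one>\<^bsub>B\<^esub>"
    and "x \<in> carrier B \<Longrightarrow> sweedler K B B (\<lambda>x\<^sub>1 x\<^sub>2. x\<^sub>1 \<otimes>\<^bsub>B\<^esub> S x\<^sub>2) x = \<epsilon>\<^bsub>B\<^esub> x \<odot>\<^bsub>B\<^esub> \<one>\<^bsub>B\<^esub>"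
  using assms unfolding antipode_def by auto

text \<open>
The element \<open>g = \<phi> 1\<close> is grouplike, and so is its inverse
\<open>s = S g\<close>; moreover \<open>\<pi> s = 1\<close>, because \<open>\<pi> g = 1\<close>. Therefore \<open>\<phi>(h) s\<close> is again a section and a coalgebra map,
and it is unital.
\<close>

lemma unital_section:
  assumes E: "hopf_algebra K E" and H: "bialgebra K H" and \<pi>: "\<pi> \<in> hopf_maps K E H"
    and \<phi>: "\<phi> \<in> coalgebra_maps K H E" and sec: "\<And>h. h \<in> carrier H \<Longrightarrow> \<pi> (\<phi> h) = h"
  shows "\<exists>\<phi>'\<in>coalgebra_maps K H E. (\<forall>h\<in>carrier H. \<pi> (\<phi>' h) = h) \<and> \<phi>' \<one>\<^bsub>H\<^esub> = \<one>\<^bsub>E\<^esub>"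
proof -
  obtain S where E0: "bialgebra K E" and S: "antipode K E S" using E unfolding hopf_algebra_def by auto
  note E' = bialgebraD(1-3)[OF E0] and H' = bialgebraD(1-3)[OF H]
  interpret E: ring E by (rule k_algebraD(2)[OF E'(1)])
  interpret Em: module K E by (rule k_spaceD(3)[OF E'(3)])
  have EE: "k_space K (tensor_space K E E)" by (rule tensor_space_k_space[OF E'(3) E'(3)])
  note Sl = antipodeD(1)[OF S] and \<phi>0 = coalgebra_mapsD(1)[OF \<phi>]
  define g where "g = \<phi> \<one>\<^bsub>H\<^esub>"
  define s where "s = S g"
  have oneH: "\<one>\<^bsub>H\<^esub> \<in> carrier H" by (rule one_mem[OF H'(1)])
  have g: "g \<in> carrier E" unfolding g_def by (rule lin_closed[OF \<phi>0 oneH])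
  have s: "s \<in> carrier E" unfolding s_def by (rule lin_closed[OF Sl g])
  note ms = mlin E' H' EE g s lin_comp[OF Sl] lin_closed[OF Sl] Sl lin_comp[OF \<phi>0] lin_closed[OF \<phi>0] \<phi>0
  have \<Delta>g: "\<Delta>\<^bsub>E\<^esub> g = pure_tensor K E E g g"
    unfolding g_def coalgebra_mapsD(2)[OF \<phi> oneH]
    by (rule sweedler_one[OF H EE]) (rule ms | assumption)+
  have \<epsilon>g: "\<epsilon>\<^bsub>E\<^esub> g = \<one>\<^bsub>K\<^esub>"
    unfolding g_def coalgebra_mapsD(3)[OF \<phi> oneH] by (rule counit_ring_hom(2)[OF H])
  have "sweedler K E E (\<lambda>x\<^sub>1 x\<^sub>2. S x\<^sub>1 \<otimes>\<^bsub>E\<^esub> x\<^sub>2) g = S g \<otimes>\<^bsub>E\<^esub> g"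
    by (rule sweedler_grouplike[OF E'(3) E'(3) _ g \<Delta>g]) (rule ms | assumption)+
  then have sg: "s \<otimes>\<^bsub>E\<^esub> g = \<one>\<^bsub>E\<^esub>" using antipodeD(2)[OF S g] by (simp add: \<epsilon>g s_def)
  have "sweedler K E E (\<lambda>x\<^sub>1 x\<^sub>2. x\<^sub>1 \<otimes>\<^bsub>E\<^esub> S x\<^sub>2) g = g \<otimes>\<^bsub>E\<^esub> S g"
    by (rule sweedler_grouplike[OF E'(3) E'(3) _ g \<Delta>g]) (rule ms | assumption)+
  then have gs: "g \<otimes>\<^bsub>E\<^esub> s = \<one>\<^bsub>E\<^esub>" using antipodeD(3)[OF S g] by (simp add: \<epsilon>g s_def)
  have \<pi>m: "\<pi> (x \<otimes>\<^bsub>E\<^esub> y) = \<pi> x \<otimes>\<^bsub>H\<^esub> \<pi> y" if "x \<in> carrier E" "y \<in> carrier E" for x y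
    using ring_hom_mult[OF hopf_mapsD(1)[OF \<pi>] that] .
  interpret H: ring H by (rule k_algebraD(2)[OF H'(1)])
  have \<pi>s: "\<pi> s = \<one>\<^bsub>H\<^esub>"
    using \<pi>m[OF s g] ring_hom_one[OF hopf_mapsD(1)[OF \<pi>]] lin_closed[OF hopf_mapsD(3)[OF \<pi>] s]
    by (simp add: sg[unfolded g_def] g_def sec[OF oneH])
  have \<epsilon>s: "\<epsilon>\<^bsub>E\<^esub> s = \<one>\<^bsub>K\<^esub>"
    using counit_ring_hom(1)[OF E0 s g] counit_closed[OF E'(2) s] by (simp add: \<epsilon>g sg counit_ring_hom(2)[OF E0])
  \<comment> \<open>That \<open>s\<close> is grouplike: evaluate \<open>\<Delta>(s g) = 1 \<otimes> 1\<close> after multiplying both tensor factors by \<open>s\<close> on the right.\<close>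
  have sw_s: "sweedler K E (tensor_space K E E) b s = b s s"
    if b: "bilin K E E (tensor_space K E E) b" for b
  proof -
    note bl = bilin_left[OF b] bilin_right[OF b] bilin_closed[OF b]
    let ?c = "\<lambda>u v. b (u \<otimes>\<^bsub>E\<^esub> s) (v \<otimes>\<^bsub>E\<^esub> s)"
    have c: "bilin K E E (tensor_space K E E) ?c" by (rule bl ms | assumption)+
    have "?c \<one>\<^bsub>E\<^esub> \<one>\<^bsub>E\<^esub> = sweedler K E (tensor_space K E E) ?c (s \<otimes>\<^bsub>E\<^esub> g)"
      unfolding sg by (rule sweedler_one[OF E0 EE c, symmetric])
    also have "\<dots> = sweedler K E (tensor_space K E E) (\<lambda>x\<^sub>1 x\<^sub>2.
        sweedler K E (tensor_space K E E) (\<lambda>y\<^sub>1 y\<^sub>2. ?c (x\<^sub>1 \<otimes>\<^bsub>E\<^esub> y\<^sub>1) (x\<^sub>2 \<otimes>\<^bsub>E\<^esub> y\<^sub>2)) g) s"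
      by (rule sweedler_mult[OF E0 EE c s g])
    also have "\<dots> = sweedler K E (tensor_space K E E) b s"
    proof (rule sweedler_cong[OF E'(2) EE s])
      show "bilin K E E (tensor_space K E E) (\<lambda>x\<^sub>1 x\<^sub>2.
        sweedler K E (tensor_space K E E) (\<lambda>y\<^sub>1 y\<^sub>2. ?c (x\<^sub>1 \<otimes>\<^bsub>E\<^esub> y\<^sub>1) (x\<^sub>2 \<otimes>\<^bsub>E\<^esub> y\<^sub>2)) g)"
        by (rule bl ms | assumption)+
      fix x y assume xy: "x \<in> carrier E" "y \<in> carrier E"
      have "sweedler K E (tensor_space K E E) (\<lambda>y\<^sub>1 y\<^sub>2. ?c (x \<otimes>\<^bsub>E\<^esub> y\<^sub>1) (y \<otimes>\<^bsub>E\<^esub> y\<^sub>2)) g =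
        ?c (x \<otimes>\<^bsub>E\<^esub> g) (y \<otimes>\<^bsub>E\<^esub> g)"
        by (rule sweedler_grouplike[OF E'(3) EE _ g \<Delta>g]) (rule bl ms xy | assumption)+
      also have "\<dots> = b x y" using xy g s by (simp add: E.m_assoc gs)
      finally show "sweedler K E (tensor_space K E E) (\<lambda>y\<^sub>1 y\<^sub>2. ?c (x \<otimes>\<^bsub>E\<^esub> y\<^sub>1) (y \<otimes>\<^bsub>E\<^esub> y\<^sub>2)) g = b x y" .
    qed
    finally show ?thesis using s by simp
  qed
  let ?\<phi> = "\<lambda>h. \<phi> h \<otimes>\<^bsub>E\<^esub> s"
  have "?\<phi> \<in> coalgebra_maps K H E"
  proof (rule coalgebra_mapsI)
    show "?\<phi> \<in> lin_maps K H E" by (rule ms | assumption)+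
    fix h assume h: "h \<in> carrier H"
    have \<phi>h: "\<phi> h \<in> carrier E" by (rule lin_closed[OF \<phi>0 h])
    show "\<epsilon>\<^bsub>E\<^esub> (?\<phi> h) = \<epsilon>\<^bsub>H\<^esub> h"
      using counit_closed[OF H'(2) h] by (simp add: counit_ring_hom(1)[OF E0 \<phi>h s] \<epsilon>s coalgebra_mapsD(3)[OF \<phi> h])
    have "\<Delta>\<^bsub>E\<^esub> (?\<phi> h) = sweedler K E (tensor_space K E E) (pure_tensor K E E) (?\<phi> h)"
      by (rule sweedler_pure_tensor[OF E'(2), symmetric]) (rule ms \<phi>h | assumption)+
    also have "\<dots> = sweedler K E (tensor_space K E E) (\<lambda>x\<^sub>1 x\<^sub>2.
      sweedler K E (tensor_space K E E) (\<lambda>y\<^sub>1 y\<^sub>2. pure_tensor K E E (x\<^sub>1 \<otimes>\<^bsub>E\<^esub> y\<^sub>1) (x\<^sub>2 \<otimes>\<^bsub>E\<^esub> y\<^sub>2)) s) (\<phi> h)"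
      by (rule sweedler_mult[OF E0 EE pure_tensor_bilin[OF E'(3) E'(3)] \<phi>h s])
    also have "\<dots> = sweedler K E (tensor_space K E E) (\<lambda>x\<^sub>1 x\<^sub>2.
      pure_tensor K E E (x\<^sub>1 \<otimes>\<^bsub>E\<^esub> s) (x\<^sub>2 \<otimes>\<^bsub>E\<^esub> s)) (\<phi> h)"
      apply (rule sweedler_cong[OF E'(2) EE \<phi>h])
      subgoal by (rule ms | assumption)+
      apply (rule sw_s)
      by (rule ms | assumption)+
    also have "\<dots> = sweedler K H (tensor_space K E E) (\<lambda>h\<^sub>1 h\<^sub>2. pure_tensor K E E (?\<phi> h\<^sub>1) (?\<phi> h\<^sub>2)) h"
      by (rule sweedler_coalgebra_map[OF H'(2) E'(2) EE \<phi> _ h]) (rule ms | assumption)+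
    finally show "\<Delta>\<^bsub>E\<^esub> (?\<phi> h) = \<dots>" .
  qed
  moreover have "\<pi> (?\<phi> h) = h" if "h \<in> carrier H" for h
    using that by (simp add: \<pi>m[OF lin_closed[OF \<phi>0 that] s] sec \<pi>s)
  moreover have "?\<phi> \<one>\<^bsub>H\<^esub> = \<one>\<^bsub>E\<^esub>" using gs by (simp add: g_def)
  ultimately show ?thesis by (intro bexI[of _ ?\<phi>]) auto
qed

section \<open>The coaction of the quotient\<close>

locale split_extension =
  fixes K :: "('k, 'l) ring_scheme" and A :: "('k, 'a, 'm) bialg_scheme"
    and H :: "('k, 'h, 'n) bialg_scheme" and E :: "('k, 'e, 'o) bialg_scheme"
    and i :: "'a \<Rightarrow> 'e" and \<pi> :: "'e \<Rightarrow> 'h" and \<phi> :: "'h \<Rightarrow> 'e" and S :: "'e \<Rightarrow> 'e"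
  assumes hopf_A: "hopf_algebra K A" and hopf_H: "hopf_algebra K H" and hopf_E: "hopf_algebra K E"
    and i: "i \<in> hopf_maps K A E" and i_inj: "inj_on i (carrier A)"
    and \<pi>: "\<pi> \<in> hopf_maps K E H"
    and \<phi>: "\<phi> \<in> coalgebra_maps K H E" and \<pi>\<phi>: "h \<in> carrier H \<Longrightarrow> \<pi> (\<phi> h) = h"
    and \<phi>_one: "\<phi> \<one>\<^bsub>H\<^esub> = \<one>\<^bsub>E\<^esub>"
    and coinvariants: "i ` carrier A = coinvariants K E H \<pi>"
    and S: "antipode K E S"
begin

lemma bialg: "bialgebra K A" "bialgebra K H" "bialgebra K E"
  using hopf_A hopf_H hopf_E unfolding hopf_algebra_def by auto

lemmas A' = bialgebraD(1-3)[OF bialg(1)]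
lemmas H' = bialgebraD(1-3)[OF bialg(2)]
lemmas E' = bialgebraD(1-3)[OF bialg(3)]
lemmas i0 = hopf_mapsD(3)[OF i]
lemmas \<pi>0 = hopf_mapsD(3)[OF \<pi>]
lemmas \<phi>0 = coalgebra_mapsD(1)[OF \<phi>]
lemmas S0 = antipodeD(1)[OF S]

lemma field_K: "field K" using E'(3) by (rule k_spaceD)

lemmas spaces = A'(3) H'(3) E'(3) tensor_space_k_space[OF A'(3) H'(3)] tensor_space_k_space[OF H'(3) A'(3)]
  tensor_space_k_space[OF H'(3) H'(3)] tensor_space_k_space[OF E'(3) H'(3)] scalars_k_space[OF field_K]
  tensor_space_k_space[OF tensor_space_k_space[OF A'(3) H'(3)] tensor_space_k_space[OF A'(3) H'(3)]]

lemmas maps_lin = i0 \<pi>0 \<phi>0 S0 lin_comp[OF i0] lin_comp[OF \<pi>0] lin_comp[OF \<phi>0] lin_comp[OF S0]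

lemmas maps_closed = lin_closed[OF i0] lin_closed[OF \<pi>0] lin_closed[OF \<phi>0] lin_closed[OF S0]

text \<open>
A set of rules for closure and linearity conditions. The sets \<open>cs\<close>, \<open>qs\<close>, \<open>js\<close>, \<open>acs\<close> and \<open>ts\<close> below
extend it, each the one before, by rules for further maps.
\<close>

lemmas ms = mlin A' H' E' spaces maps_lin maps_closed

sublocale E: ring E by (rule k_algebraD(2)[OF E'(1)])
sublocale H: ring H by (rule k_algebraD(2)[OF H'(1)])
sublocale A: ring A by (rule k_algebraD(2)[OF A'(1)])
sublocale Em: module K E by (rule k_spaceD(3)[OF E'(3)])

lemma \<pi>_mult: "\<lbrakk>x \<in> carrier E; y \<in> carrier E\<rbrakk> \<Longrightarrow> \<pi> (x \<otimes>\<^bsub>E\<^esub> y) = \<pi> x \<otimes>\<^bsub>H\<^esub> \<pi> y"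
  using ring_hom_mult[OF hopf_mapsD(1)[OF \<pi>]] .

lemma i_mult: "\<lbrakk>x \<in> carrier A; y \<in> carrier A\<rbrakk> \<Longrightarrow> i (x \<otimes>\<^bsub>A\<^esub> y) = i x \<otimes>\<^bsub>E\<^esub> i y"
  using ring_hom_mult[OF hopf_mapsD(1)[OF i]] .

lemma i_one: "i \<one>\<^bsub>A\<^esub> = \<one>\<^bsub>E\<^esub>"
  using ring_hom_one[OF hopf_mapsD(1)[OF i]] .

lemma i_eqD: "\<lbrakk>i a = i a'; a \<in> carrier A; a' \<in> carrier A\<rbrakk> \<Longrightarrow> a = a'"
  using i_inj by (auto dest: inj_onD)

lemma \<phi>\<pi>: "(\<lambda>x. \<phi> (\<pi> x)) \<in> coalgebra_maps K E E"
  by (rule coalgebra_maps_comp[OF E'(2) H'(2) E'(2) hopf_mapsD(2)[OF \<pi>] \<phi>])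

text \<open>
The value of \<open>b\<close> on \<open>\<rho> x = x\<^sub>1 \<otimes> \<pi>(x\<^sub>2)\<close>, where \<open>\<rho>\<close> is the coaction of \<open>H\<close> on \<open>E\<close>. Its rules mirror those of
\<^const>\<open>sweedler\<close>: \<open>\<rho>\<close> is multiplicative, it sends \<open>i a\<close> to \<open>i a \<otimes> 1\<close> and \<open>\<phi> h\<close> to \<open>\<phi>(h\<^sub>1) \<otimes> h\<^sub>2\<close>.
\<close>

definition coact :: "('k, 'c, 'p) module_scheme \<Rightarrow> ('e \<Rightarrow> 'h \<Rightarrow> 'c) \<Rightarrow> 'e \<Rightarrow> 'c" where
  "coact M b x = sweedler K E M (\<lambda>x\<^sub>1 x\<^sub>2. b x\<^sub>1 (\<pi> x\<^sub>2)) x"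

lemma bilin_\<pi>:
  assumes "bilin K E H M b" shows "bilin K E E M (\<lambda>x\<^sub>1 x\<^sub>2. b x\<^sub>1 (\<pi> x\<^sub>2))"
  by (rule ms bilin_left[OF assms] bilin_right[OF assms] | assumption)+

lemma coact_comp:
  "\<lbrakk>k_space K M; bilin K E H M b; t \<in> lin_maps K U E\<rbrakk> \<Longrightarrow> (\<lambda>x. coact M b (t x)) \<in> lin_maps K U M"
  unfolding coact_def by (rule sweedler_comp[OF E'(2) _ bilin_\<pi>])

lemma coact_mem: "\<lbrakk>k_space K M; bilin K E H M b; x \<in> carrier E\<rbrakk> \<Longrightarrow> coact M b x \<in> carrier M"
  unfolding coact_def by (rule sweedler_mem[OF E'(2) _ bilin_\<pi>])

lemma coact_param:
  assumes U: "k_space K U" and M: "k_space K M" and t: "trilin K U E H M t" and x: "x \<in> carrier E"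
  shows "(\<lambda>u. coact M (t u) x) \<in> lin_maps K U M"
  unfolding coact_def
proof (rule sweedler_param[OF E'(2) U M _ x], rule trilinI)
  fix u v assume uv: "u \<in> carrier U" "v \<in> carrier E"
  show "(\<lambda>y. t u v (\<pi> y)) \<in> lin_maps K E M"
    by (rule bilin_right[OF trilinD(1)[OF t]]) (rule uv \<pi>0)+
next
  fix u w assume uw: "u \<in> carrier U" "w \<in> carrier E"
  show "(\<lambda>v. t u v (\<pi> w)) \<in> lin_maps K E M"
    using bilinD(2)[OF trilinD(1)[OF t uw(1)] lin_closed[OF \<pi>0 uw(2)]] .
next
  fix v w assume vw: "v \<in> carrier E" "w \<in> carrier E"
  show "(\<lambda>u. t u v (\<pi> w)) \<in> lin_maps K U M"
    using trilinD(2)[OF t vw(1) lin_closed[OF \<pi>0 vw(2)]] .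
qed

lemma coact_cong:
  assumes M: "k_space K M" and x: "x \<in> carrier E" and b: "bilin K E H M b"
    and eq: "\<And>u h. u \<in> carrier E \<Longrightarrow> h \<in> carrier H \<Longrightarrow> b u h = b' u h"
  shows "coact M b x = coact M b' x"
  unfolding coact_def by (rule sweedler_cong[OF E'(2) M x bilin_\<pi>[OF b]]) (simp add: eq maps_closed)

lemma coact_lin:
  assumes M: "k_space K M" "k_space K M'" and g: "g \<in> lin_maps K M M'" and b: "bilin K E H M b"
    and x: "x \<in> carrier E"
  shows "g (coact M b x) = coact M' (\<lambda>u h. g (b u h)) x"
  unfolding coact_def by (rule sweedler_lin[OF E'(2) M g bilin_\<pi>[OF b] x])

lemmas cs = coact_comp coact_param coact_mem ms

lemma coact_mult:
  assumes M: "k_space K M" and b: "bilin K E H M b" and x: "x \<in> carrier E" and y: "y \<in> carrier E"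
  shows "coact M b (x \<otimes>\<^bsub>E\<^esub> y) = coact M (\<lambda>u g. coact M (\<lambda>v h. b (u \<otimes>\<^bsub>E\<^esub> v) (g \<otimes>\<^bsub>H\<^esub> h)) y) x"
proof -
  note bl = bilin_left[OF b] bilin_right[OF b] bilin_closed[OF b]
  have "coact M b (x \<otimes>\<^bsub>E\<^esub> y) = sweedler K E M (\<lambda>x\<^sub>1 x\<^sub>2. sweedler K E M (\<lambda>y\<^sub>1 y\<^sub>2.
    b (x\<^sub>1 \<otimes>\<^bsub>E\<^esub> y\<^sub>1) (\<pi> (x\<^sub>2 \<otimes>\<^bsub>E\<^esub> y\<^sub>2))) y) x"
    unfolding coact_def by (rule sweedler_mult[OF bialg(3) M bilin_\<pi>[OF b] x y])
  also have "\<dots> = coact M (\<lambda>u g. coact M (\<lambda>v h. b (u \<otimes>\<^bsub>E\<^esub> v) (g \<otimes>\<^bsub>H\<^esub> h)) y) x"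
    unfolding coact_def
    apply (rule sweedler_cong[OF E'(2) M x])
    subgoal by (rule bl ms M y | assumption)+
    apply (rule sweedler_cong[OF E'(2) M y])
    subgoal by (rule bl ms M y | assumption)+
    by (simp add: \<pi>_mult)
  finally show ?thesis .
qed

lemma coact_i:
  assumes M: "k_space K M" and b: "bilin K E H M b" and a: "a \<in> carrier A"
  shows "coact M b (i a) = b (i a) \<one>\<^bsub>H\<^esub>"
proof -
  let ?EH = "tensor_space K E H"
  note L = tensor_lift_lin[OF E'(3) H'(3) M b] and P = tensor_lift_pure[OF E'(3) H'(3) M b]
  have ia: "i a \<in> carrier E" by (rule maps_closed(1)[OF a])
  have "i a \<in> coinvariants K E H \<pi>" using coinvariants a by blast
  then have "coact ?EH (pure_tensor K E H) (i a) = pure_tensor K E H (i a) \<one>\<^bsub>H\<^esub>"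
    unfolding coinvariants_def coact_def by simp
  then have "tensor_lift K M b (coact ?EH (pure_tensor K E H) (i a)) = b (i a) \<one>\<^bsub>H\<^esub>"
    by (simp add: P ia)
  moreover have "tensor_lift K M b (coact ?EH (pure_tensor K E H) (i a)) =
    coact M (\<lambda>u h. tensor_lift K M b (pure_tensor K E H u h)) (i a)"
    by (rule coact_lin[OF _ M L pure_tensor_bilin[OF E'(3) H'(3)] ia]) (rule spaces)
  moreover have "\<dots> = coact M b (i a)"
    by (rule coact_cong[OF M ia b, symmetric]) (simp add: P)
  ultimately show ?thesis by simp
qed

lemma coact_\<phi>:
  assumes M: "k_space K M" and b: "bilin K E H M b" and h: "h \<in> carrier H"
  shows "coact M b (\<phi> h) = sweedler K H M (\<lambda>h\<^sub>1 h\<^sub>2. b (\<phi> h\<^sub>1) h\<^sub>2) h"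
proof -
  note bl = bilin_left[OF b] bilin_right[OF b] bilin_closed[OF b]
  have "coact M b (\<phi> h) = sweedler K H M (\<lambda>h\<^sub>1 h\<^sub>2. b (\<phi> h\<^sub>1) (\<pi> (\<phi> h\<^sub>2))) h"
    unfolding coact_def by (rule sweedler_coalgebra_map[OF H'(2) E'(2) M \<phi> bilin_\<pi>[OF b] h])
  also have "\<dots> = sweedler K H M (\<lambda>h\<^sub>1 h\<^sub>2. b (\<phi> h\<^sub>1) h\<^sub>2) h"
    by (rule sweedler_cong[OF H'(2) M h]) ((rule bl ms | assumption)+, simp add: \<pi>\<phi>)
  finally show ?thesis .
qed

lemma coact_one:
  assumes M: "k_space K M" and b: "bilin K E H M b"
  shows "coact M b \<one>\<^bsub>E\<^esub> = b \<one>\<^bsub>E\<^esub> \<one>\<^bsub>H\<^esub>"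
  using coact_i[OF M b A.one_closed] by (simp add: i_one)

lemma coact_i_\<phi>:
  assumes M: "k_space K M" and b: "bilin K E H M b" and a: "a \<in> carrier A" and h: "h \<in> carrier H"
  shows "coact M b (i a \<otimes>\<^bsub>E\<^esub> \<phi> h) = sweedler K H M (\<lambda>h\<^sub>1 h\<^sub>2. b (i a \<otimes>\<^bsub>E\<^esub> \<phi> h\<^sub>1) h\<^sub>2) h"
proof -
  note bl = bilin_left[OF b] bilin_right[OF b] bilin_closed[OF b]
  have ia: "i a \<in> carrier E" and \<phi>h: "\<phi> h \<in> carrier E" by (rule maps_closed a h)+
  have "coact M b (i a \<otimes>\<^bsub>E\<^esub> \<phi> h) =
    coact M (\<lambda>u g. coact M (\<lambda>v h. b (u \<otimes>\<^bsub>E\<^esub> v) (g \<otimes>\<^bsub>H\<^esub> h)) (\<phi> h)) (i a)"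
    by (rule coact_mult[OF M b ia \<phi>h])
  also have "\<dots> = coact M (\<lambda>v h. b (i a \<otimes>\<^bsub>E\<^esub> v) (\<one>\<^bsub>H\<^esub> \<otimes>\<^bsub>H\<^esub> h)) (\<phi> h)"
    by (rule coact_i[OF M _ a]) (rule bl cs M \<phi>h | assumption)+
  also have "\<dots> = coact M (\<lambda>v h. b (i a \<otimes>\<^bsub>E\<^esub> v) h) (\<phi> h)"
    by (rule coact_cong[OF M \<phi>h]) ((rule bl cs M ia | assumption)+, simp)
  also have "\<dots> = sweedler K H M (\<lambda>h\<^sub>1 h\<^sub>2. b (i a \<otimes>\<^bsub>E\<^esub> \<phi> h\<^sub>1) h\<^sub>2) h"
    by (rule coact_\<phi>[OF M _ h]) (rule bl cs M ia | assumption)+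
  finally show ?thesis .
qed

lemma coact_\<phi>_i:
  assumes M: "k_space K M" and b: "bilin K E H M b" and a: "a \<in> carrier A" and h: "h \<in> carrier H"
  shows "coact M b (\<phi> h \<otimes>\<^bsub>E\<^esub> i a) = sweedler K H M (\<lambda>h\<^sub>1 h\<^sub>2. b (\<phi> h\<^sub>1 \<otimes>\<^bsub>E\<^esub> i a) h\<^sub>2) h"
proof -
  note bl = bilin_left[OF b] bilin_right[OF b] bilin_closed[OF b]
  have ia: "i a \<in> carrier E" and \<phi>h: "\<phi> h \<in> carrier E" by (rule maps_closed a h)+
  have "coact M b (\<phi> h \<otimes>\<^bsub>E\<^esub> i a) =
    coact M (\<lambda>u g. coact M (\<lambda>v h. b (u \<otimes>\<^bsub>E\<^esub> v) (g \<otimes>\<^bsub>H\<^esub> h)) (i a)) (\<phi> h)"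
    by (rule coact_mult[OF M b \<phi>h ia])
  also have "\<dots> = coact M (\<lambda>u g. b (u \<otimes>\<^bsub>E\<^esub> i a) g) (\<phi> h)"
    apply (rule coact_cong[OF M \<phi>h])
    subgoal by (rule bl cs M ia | assumption)+
    apply (subst coact_i[OF M _ a])
    subgoal by (rule bl cs M ia | assumption)+
    by simp
  also have "\<dots> = sweedler K H M (\<lambda>h\<^sub>1 h\<^sub>2. b (\<phi> h\<^sub>1 \<otimes>\<^bsub>E\<^esub> i a) h\<^sub>2) h"
    by (rule coact_\<phi>[OF M _ h]) (rule bl cs M ia | assumption)+
  finally show ?thesis .
qed

section \<open>The projection onto the coinvariants\<close>

text \<open>
The convolution product of the identity with \<open>S \<phi> \<pi>\<close>, the convolution inverse of \<open>\<phi> \<pi>\<close>.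
\<close>

definition q :: "'e \<Rightarrow> 'e" where
  "q = coact E (\<lambda>u h. u \<otimes>\<^bsub>E\<^esub> S (\<phi> h))"

lemma q_bilin: "bilin K E H E (\<lambda>u h. u \<otimes>\<^bsub>E\<^esub> S (\<phi> h))"
  by (rule ms | assumption)+

lemma q_lin: "q \<in> lin_maps K E E"
  unfolding q_def by (rule coact_comp[OF E'(3) q_bilin lin_id])

lemmas qs = cs q_lin lin_comp[OF q_lin] lin_closed[OF q_lin]

text \<open>
As \<open>\<phi> \<pi>\<close> is a coalgebra map, composing it with the antipode inverts it under convolution.
\<close>

lemma antipode_\<phi>\<pi>:
  assumes x: "x \<in> carrier E"
  shows "sweedler K E E (\<lambda>u v. S (\<phi> (\<pi> u)) \<otimes>\<^bsub>E\<^esub> \<phi> (\<pi> v)) x = \<epsilon>\<^bsub>E\<^esub> x \<odot>\<^bsub>E\<^esub> \<one>\<^bsub>E\<^esub>"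
    and "sweedler K E E (\<lambda>u v. \<phi> (\<pi> u) \<otimes>\<^bsub>E\<^esub> S (\<phi> (\<pi> v))) x = \<epsilon>\<^bsub>E\<^esub> x \<odot>\<^bsub>E\<^esub> \<one>\<^bsub>E\<^esub>"
proof -
  have y: "\<phi> (\<pi> x) \<in> carrier E" by (rule maps_closed x)+
  have "sweedler K E E (\<lambda>u v. S u \<otimes>\<^bsub>E\<^esub> v) (\<phi> (\<pi> x)) =
    sweedler K E E (\<lambda>u v. S (\<phi> (\<pi> u)) \<otimes>\<^bsub>E\<^esub> \<phi> (\<pi> v)) x"
    by (rule sweedler_coalgebra_map[OF E'(2) E'(2) E'(3) \<phi>\<pi> _ x]) (rule ms | assumption)+
  then show "sweedler K E E (\<lambda>u v. S (\<phi> (\<pi> u)) \<otimes>\<^bsub>E\<^esub> \<phi> (\<pi> v)) x = \<epsilon>\<^bsub>E\<^esub> x \<odot>\<^bsub>E\<^esub> \<one>\<^bsub>E\<^esub>"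
    using antipodeD(2)[OF S y] coalgebra_mapsD(3)[OF \<phi>\<pi> x] by simp
  have "sweedler K E E (\<lambda>u v. u \<otimes>\<^bsub>E\<^esub> S v) (\<phi> (\<pi> x)) =
    sweedler K E E (\<lambda>u v. \<phi> (\<pi> u) \<otimes>\<^bsub>E\<^esub> S (\<phi> (\<pi> v))) x"
    by (rule sweedler_coalgebra_map[OF E'(2) E'(2) E'(3) \<phi>\<pi> _ x]) (rule ms | assumption)+
  then show "sweedler K E E (\<lambda>u v. \<phi> (\<pi> u) \<otimes>\<^bsub>E\<^esub> S (\<phi> (\<pi> v))) x = \<epsilon>\<^bsub>E\<^esub> x \<odot>\<^bsub>E\<^esub> \<one>\<^bsub>E\<^esub>"
    using antipodeD(3)[OF S y] coalgebra_mapsD(3)[OF \<phi>\<pi> x] by simp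
qed

text \<open>
\<open>q(x\<^sub>1) \<phi>(\<pi> x\<^sub>2) = x\<^sub>1 S(\<phi>(\<pi> x\<^sub>2)) \<phi>(\<pi> x\<^sub>3) = x\<^sub>1 \<epsilon>(x\<^sub>2) = x\<close>.
\<close>

lemma recompose:
  assumes x: "x \<in> carrier E"
  shows "coact E (\<lambda>u h. q u \<otimes>\<^bsub>E\<^esub> \<phi> h) x = x"
proof -
  let ?t = "\<lambda>w u v. w \<otimes>\<^bsub>E\<^esub> (S (\<phi> (\<pi> u)) \<otimes>\<^bsub>E\<^esub> \<phi> (\<pi> v))"
  have "coact E (\<lambda>u h. q u \<otimes>\<^bsub>E\<^esub> \<phi> h) x =
    sweedler K E E (\<lambda>y v. sweedler K E E (\<lambda>w u. ?t w u v) y) x"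
    unfolding coact_def
  proof (rule sweedler_cong[OF E'(2) E'(3) x])
    show "bilin K E E E (\<lambda>y v. q y \<otimes>\<^bsub>E\<^esub> \<phi> (\<pi> v))" by (rule qs | assumption)+
    fix y v assume y: "y \<in> carrier E" and v: "v \<in> carrier E"
    have "q y \<otimes>\<^bsub>E\<^esub> \<phi> (\<pi> v) = sweedler K E E (\<lambda>w u. (w \<otimes>\<^bsub>E\<^esub> S (\<phi> (\<pi> u))) \<otimes>\<^bsub>E\<^esub> \<phi> (\<pi> v)) y"
      unfolding q_def coact_def
      by (rule sweedler_lin[OF E'(2) E'(3) E'(3) _ bilin_\<pi>[OF q_bilin] y]) (rule ms v)+
    also have "\<dots> = sweedler K E E (\<lambda>w u. ?t w u v) y"
      by (rule sweedler_cong[OF E'(2) E'(3) y]) ((rule ms v | assumption)+, simp add: E.m_assoc maps_closed v)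
    finally show "q y \<otimes>\<^bsub>E\<^esub> \<phi> (\<pi> v) = sweedler K E E (\<lambda>w u. ?t w u v) y" .
  qed
  also have "\<dots> = sweedler K E E (\<lambda>w y. sweedler K E E (?t w) y) x"
    by (rule sweedler_coassoc[OF E'(2) E'(3) _ x, symmetric]) (rule ms | assumption)+
  also have "\<dots> = sweedler K E E (\<lambda>w y. \<epsilon>\<^bsub>E\<^esub> y \<odot>\<^bsub>E\<^esub> w) x"
  proof (rule sweedler_cong[OF E'(2) E'(3) x])
    show "bilin K E E E (\<lambda>w y. sweedler K E E (?t w) y)" by (rule ms | assumption)+
    fix w y assume w: "w \<in> carrier E" and y: "y \<in> carrier E"
    have "sweedler K E E (?t w) y = w \<otimes>\<^bsub>E\<^esub> sweedler K E E (\<lambda>u v. S (\<phi> (\<pi> u)) \<otimes>\<^bsub>E\<^esub> \<phi> (\<pi> v)) y"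
      by (rule sweedler_lin[OF E'(2) E'(3) E'(3) _ _ y, symmetric]) (rule ms w | assumption)+
    also have "\<dots> = \<epsilon>\<^bsub>E\<^esub> y \<odot>\<^bsub>E\<^esub> w"
      by (simp add: antipode_\<phi>\<pi> y w k_algebraD(4)[OF E'(1)] counit_closed[OF E'(2)])
    finally show "sweedler K E E (?t w) y = \<epsilon>\<^bsub>E\<^esub> y \<odot>\<^bsub>E\<^esub> w" .
  qed
  also have "\<dots> = x" by (rule sweedler_counit_right[OF E'(2) E'(3) lin_id x])
  finally show ?thesis .
qed

text \<open>
This is \<open>\<rho> x = (q x\<^sub>1 \<otimes> 1) \<rho>(\<phi>(\<pi> x\<^sub>2))\<close>: recompose the first factor of \<open>x\<^sub>1 \<otimes> \<pi>(x\<^sub>2)\<close> and use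
\<open>\<rho>(\<phi> h) = \<phi>(h\<^sub>1) \<otimes> h\<^sub>2\<close>.
\<close>

lemma coact_split:
  assumes M: "k_space K M" and c: "bilin K E H M c" and x: "x \<in> carrier E"
  shows "coact M c x = sweedler K E M (\<lambda>u y. coact M (\<lambda>s h. c (q u \<otimes>\<^bsub>E\<^esub> s) h) (\<phi> (\<pi> y))) x"
proof -
  note cl = bilin_left[OF c] bilin_right[OF c] bilin_closed[OF c]
  let ?t = "\<lambda>u v w. c (q u \<otimes>\<^bsub>E\<^esub> \<phi> (\<pi> v)) (\<pi> w)"
  have "coact M c x = sweedler K E M (\<lambda>y w. sweedler K E M (\<lambda>u v. ?t u v w) y) x"
    unfolding coact_def
  proof (rule sweedler_cong[OF E'(2) M x bilin_\<pi>[OF c]])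
    fix y w assume y: "y \<in> carrier E" and w: "w \<in> carrier E"
    have "c y (\<pi> w) = c (coact E (\<lambda>u h. q u \<otimes>\<^bsub>E\<^esub> \<phi> h) y) (\<pi> w)" by (simp add: recompose y)
    also have "\<dots> = sweedler K E M (\<lambda>u v. ?t u v w) y"
      unfolding coact_def
      by (rule sweedler_lin[OF E'(2) E'(3) M _ _ y]) (rule cl qs w | assumption)+
    finally show "c y (\<pi> w) = sweedler K E M (\<lambda>u v. ?t u v w) y" .
  qed
  also have "\<dots> = sweedler K E M (\<lambda>u y. sweedler K E M (?t u) y) x"
    by (rule sweedler_coassoc[OF E'(2) M _ x, symmetric]) (rule cl qs | assumption)+
  also have "\<dots> = sweedler K E M (\<lambda>u y. coact M (\<lambda>s h. c (q u \<otimes>\<^bsub>E\<^esub> s) h) (\<phi> (\<pi> y))) x"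
  proof (rule sweedler_cong[OF E'(2) M x])
    show "bilin K E E M (\<lambda>u y. sweedler K E M (?t u) y)" by (rule cl qs M | assumption)+
    fix u y assume u: "u \<in> carrier E" and y: "y \<in> carrier E"
    have d: "bilin K E H M (\<lambda>s h. c (q u \<otimes>\<^bsub>E\<^esub> s) h)" by (rule cl qs u | assumption)+
    have \<pi>y: "\<pi> y \<in> carrier H" by (rule maps_closed y)+
    have "coact M (\<lambda>s h. c (q u \<otimes>\<^bsub>E\<^esub> s) h) (\<phi> (\<pi> y)) =
      sweedler K H M (\<lambda>h\<^sub>1 h\<^sub>2. c (q u \<otimes>\<^bsub>E\<^esub> \<phi> h\<^sub>1) h\<^sub>2) (\<pi> y)"
      by (rule coact_\<phi>[OF M d \<pi>y])
    also have "\<dots> = sweedler K E M (?t u) y"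
      by (rule sweedler_coalgebra_map[OF E'(2) H'(2) M hopf_mapsD(2)[OF \<pi>] _ y]) (rule cl qs u | assumption)+
    finally show "sweedler K E M (?t u) y = coact M (\<lambda>s h. c (q u \<otimes>\<^bsub>E\<^esub> s) h) (\<phi> (\<pi> y))" by simp
  qed
  finally show ?thesis .
qed

text \<open>
As \<open>\<rho>\<close> is multiplicative,
\<open>\<rho>(q x) = \<rho>(x\<^sub>1) \<rho>(S(\<phi>(\<pi> x\<^sub>2))) = (q x\<^sub>1 \<otimes> 1) \<rho>(\<phi>(\<pi> x\<^sub>2) S(\<phi>(\<pi> x\<^sub>3))) = q x \<otimes> 1\<close>.
\<close>

lemma coact_q:
  assumes M: "k_space K M" and b: "bilin K E H M b" and x: "x \<in> carrier E"
  shows "coact M b (q x) = b (q x) \<one>\<^bsub>H\<^esub>"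
proof -
  note bl = bilin_left[OF b] bilin_right[OF b] bilin_closed[OF b]
  let ?Y = "\<lambda>y. \<phi> (\<pi> y)" and ?Z = "\<lambda>y. S (\<phi> (\<pi> y))" and ?d = "\<lambda>u e h. b (q u \<otimes>\<^bsub>E\<^esub> e) h"
  have d: "bilin K E H M (?d u)" if "u \<in> carrier E" for u by (rule bl qs that | assumption)+
  have Y: "?Y y \<in> carrier E" and Z: "?Z y \<in> carrier E" if "y \<in> carrier E" for y
    by (rule maps_closed that)+
  have "coact M b (q x) = sweedler K E M (\<lambda>v w. coact M b (v \<otimes>\<^bsub>E\<^esub> ?Z w)) x"
    unfolding q_def coact_def[of E]
    by (rule sweedler_lin[OF E'(2) E'(3) M coact_comp[OF M b lin_id] bilin_\<pi>[OF q_bilin] x])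
  also have "\<dots> = sweedler K E M (\<lambda>v w. sweedler K E M (\<lambda>u y. coact M (?d u) (?Y y \<otimes>\<^bsub>E\<^esub> ?Z w)) v) x"
  proof (rule sweedler_cong[OF E'(2) M x])
    show "bilin K E E M (\<lambda>v w. coact M b (v \<otimes>\<^bsub>E\<^esub> ?Z w))" by (rule b cs M | assumption)+
    fix v w assume v: "v \<in> carrier E" and w: "w \<in> carrier E"
    let ?c = "\<lambda>u g. coact M (\<lambda>s h. b (u \<otimes>\<^bsub>E\<^esub> s) (g \<otimes>\<^bsub>H\<^esub> h)) (?Z w)"
    have c: "bilin K E H M ?c" by (rule bl cs M w | assumption)+
    have "coact M b (v \<otimes>\<^bsub>E\<^esub> ?Z w) = coact M ?c v" by (rule coact_mult[OF M b v Z[OF w]])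
    also have "\<dots> = sweedler K E M (\<lambda>u y. coact M (\<lambda>s g. ?c (q u \<otimes>\<^bsub>E\<^esub> s) g) (?Y y)) v"
      by (rule coact_split[OF M c v])
    also have "\<dots> = sweedler K E M (\<lambda>u y. coact M (?d u) (?Y y \<otimes>\<^bsub>E\<^esub> ?Z w)) v"
    proof (rule sweedler_cong[OF E'(2) M v])
      show "bilin K E E M (\<lambda>u y. coact M (\<lambda>s g. ?c (q u \<otimes>\<^bsub>E\<^esub> s) g) (?Y y))"
        by (rule bl qs M w | assumption)+
      fix u y assume u: "u \<in> carrier E" and y: "y \<in> carrier E"
      have "coact M (?d u) (?Y y \<otimes>\<^bsub>E\<^esub> ?Z w) =
        coact M (\<lambda>s g. coact M (\<lambda>t h. ?d u (s \<otimes>\<^bsub>E\<^esub> t) (g \<otimes>\<^bsub>H\<^esub> h)) (?Z w)) (?Y y)"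
        by (rule coact_mult[OF M d[OF u] Y[OF y] Z[OF w]])
      also have "\<dots> = coact M (\<lambda>s g. ?c (q u \<otimes>\<^bsub>E\<^esub> s) g) (?Y y)"
        apply (rule coact_cong[OF M Y[OF y]])
        subgoal by (rule bl qs M u w | assumption)+
        apply (rule coact_cong[OF M Z[OF w]])
        subgoal by (rule bl qs M u w | assumption)+
        by (simp add: E.m_assoc u lin_closed[OF q_lin])
      finally show "coact M (\<lambda>s g. ?c (q u \<otimes>\<^bsub>E\<^esub> s) g) (?Y y) = coact M (?d u) (?Y y \<otimes>\<^bsub>E\<^esub> ?Z w)" by simp
    qed
    finally show "coact M b (v \<otimes>\<^bsub>E\<^esub> ?Z w) =
      sweedler K E M (\<lambda>u y. coact M (?d u) (?Y y \<otimes>\<^bsub>E\<^esub> ?Z w)) v" .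
  qed
  also have "\<dots> = sweedler K E M (\<lambda>u z. sweedler K E M (\<lambda>y w. coact M (?d u) (?Y y \<otimes>\<^bsub>E\<^esub> ?Z w)) z) x"
    by (rule sweedler_coassoc[OF E'(2) M _ x, symmetric]) (rule bl qs M d | assumption)+
  also have "\<dots> = sweedler K E M (\<lambda>u z. \<epsilon>\<^bsub>E\<^esub> z \<odot>\<^bsub>M\<^esub> b (q u) \<one>\<^bsub>H\<^esub>) x"
  proof (rule sweedler_cong[OF E'(2) M x])
    show "bilin K E E M (\<lambda>u z. sweedler K E M (\<lambda>y w. coact M (?d u) (?Y y \<otimes>\<^bsub>E\<^esub> ?Z w)) z)"
      by (rule bl qs M d | assumption)+
    fix u z assume u: "u \<in> carrier E" and z: "z \<in> carrier E"
    note L = coact_comp[OF M d[OF u] lin_id]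
    have "sweedler K E M (\<lambda>y w. coact M (?d u) (?Y y \<otimes>\<^bsub>E\<^esub> ?Z w)) z =
      coact M (?d u) (sweedler K E E (\<lambda>y w. ?Y y \<otimes>\<^bsub>E\<^esub> ?Z w) z)"
      by (rule sweedler_lin[OF E'(2) E'(3) M L _ z, symmetric]) (rule ms | assumption)+
    also have "\<dots> = \<epsilon>\<^bsub>E\<^esub> z \<odot>\<^bsub>M\<^esub> coact M (?d u) \<one>\<^bsub>E\<^esub>"
      by (simp add: antipode_\<phi>\<pi> z lin_smult[OF L] counit_closed[OF E'(2)])
    also have "\<dots> = \<epsilon>\<^bsub>E\<^esub> z \<odot>\<^bsub>M\<^esub> b (q u) \<one>\<^bsub>H\<^esub>"
      by (simp add: coact_one[OF M d[OF u]] u lin_closed[OF q_lin])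
    finally show "sweedler K E M (\<lambda>y w. coact M (?d u) (?Y y \<otimes>\<^bsub>E\<^esub> ?Z w)) z = \<epsilon>\<^bsub>E\<^esub> z \<odot>\<^bsub>M\<^esub> b (q u) \<one>\<^bsub>H\<^esub>" .
  qed
  also have "\<dots> = b (q x) \<one>\<^bsub>H\<^esub>"
    by (rule sweedler_counit_right[OF E'(2) M _ x]) (rule bl qs | assumption)+
  finally show ?thesis .
qed

lemma q_image:
  assumes x: "x \<in> carrier E" shows "q x \<in> i ` carrier A"
  using coact_q[OF _ pure_tensor_bilin[OF E'(3) H'(3)] x] spaces lin_closed[OF q_lin x]
  unfolding coinvariants coinvariants_def coact_def by simp

lemma q_i_\<phi>:
  assumes a: "a \<in> carrier A" and h: "h \<in> carrier H"
  shows "q (i a \<otimes>\<^bsub>E\<^esub> \<phi> h) = \<epsilon>\<^bsub>H\<^esub> h \<odot>\<^bsub>E\<^esub> i a"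
proof -
  have ia: "i a \<in> carrier E" and \<phi>h: "\<phi> h \<in> carrier E" by (rule maps_closed a h)+
  have "q (i a \<otimes>\<^bsub>E\<^esub> \<phi> h) = sweedler K H E (\<lambda>h\<^sub>1 h\<^sub>2. (i a \<otimes>\<^bsub>E\<^esub> \<phi> h\<^sub>1) \<otimes>\<^bsub>E\<^esub> S (\<phi> h\<^sub>2)) h"
    unfolding q_def by (rule coact_i_\<phi>[OF E'(3) q_bilin a h])
  also have "\<dots> = sweedler K H E (\<lambda>h\<^sub>1 h\<^sub>2. i a \<otimes>\<^bsub>E\<^esub> (\<phi> h\<^sub>1 \<otimes>\<^bsub>E\<^esub> S (\<phi> h\<^sub>2))) h"
    by (rule sweedler_cong[OF H'(2) E'(3) h]) ((rule ms ia | assumption)+, simp add: E.m_assoc ia maps_closed)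
  also have "\<dots> = sweedler K E E (\<lambda>x\<^sub>1 x\<^sub>2. i a \<otimes>\<^bsub>E\<^esub> (x\<^sub>1 \<otimes>\<^bsub>E\<^esub> S x\<^sub>2)) (\<phi> h)"
    by (rule sweedler_coalgebra_map[OF H'(2) E'(2) E'(3) \<phi> _ h, symmetric]) (rule ms ia | assumption)+
  also have "\<dots> = i a \<otimes>\<^bsub>E\<^esub> sweedler K E E (\<lambda>x\<^sub>1 x\<^sub>2. x\<^sub>1 \<otimes>\<^bsub>E\<^esub> S x\<^sub>2) (\<phi> h)"
    by (rule sweedler_lin[OF E'(2) E'(3) E'(3) _ _ \<phi>h, symmetric]) (rule ms ia | assumption)+
  also have "\<dots> = \<epsilon>\<^bsub>H\<^esub> h \<odot>\<^bsub>E\<^esub> i a"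
    by (simp add: antipodeD(3)[OF S \<phi>h] coalgebra_mapsD(3)[OF \<phi> h] ia
        k_algebraD(4)[OF E'(1)] counit_closed[OF H'(2) h])
  finally show ?thesis .
qed

lemma q_i_mult:
  assumes a: "a \<in> carrier A" and x: "x \<in> carrier E"
  shows "q (i a \<otimes>\<^bsub>E\<^esub> x) = i a \<otimes>\<^bsub>E\<^esub> q x"
proof -
  have ia: "i a \<in> carrier E" by (rule maps_closed a)+
  have "q (i a \<otimes>\<^bsub>E\<^esub> x) = coact E (\<lambda>u g. coact E (\<lambda>v h. (u \<otimes>\<^bsub>E\<^esub> v) \<otimes>\<^bsub>E\<^esub> S (\<phi> (g \<otimes>\<^bsub>H\<^esub> h))) x) (i a)"
    unfolding q_def by (rule coact_mult[OF E'(3) q_bilin ia x])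
  also have "\<dots> = coact E (\<lambda>v h. (i a \<otimes>\<^bsub>E\<^esub> v) \<otimes>\<^bsub>E\<^esub> S (\<phi> (\<one>\<^bsub>H\<^esub> \<otimes>\<^bsub>H\<^esub> h))) x"
    by (rule coact_i[OF E'(3) _ a]) (rule cs x | assumption)+
  also have "\<dots> = coact E (\<lambda>v h. i a \<otimes>\<^bsub>E\<^esub> (v \<otimes>\<^bsub>E\<^esub> S (\<phi> h))) x"
    by (rule coact_cong[OF E'(3) x]) ((rule cs ia | assumption)+, simp add: E.m_assoc ia maps_closed)
  also have "\<dots> = i a \<otimes>\<^bsub>E\<^esub> q x"
    unfolding q_def by (rule coact_lin[OF E'(3) E'(3) _ q_bilin x, symmetric]) (rule ms ia)+
  finally show ?thesis .
qed

text \<open>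
The map \<open>q\<close> read as a map into \<open>A\<close>.
\<close>

definition j :: "'e \<Rightarrow> 'a" where
  "j x = inv_into (carrier A) i (q x)"

lemma i_j: "x \<in> carrier E \<Longrightarrow> i (j x) = q x"
  unfolding j_def using q_image by (rule f_inv_into_f)

lemma j_closed: "x \<in> carrier E \<Longrightarrow> j x \<in> carrier A"
  unfolding j_def using q_image by (rule inv_into_into)

lemma j_lin: "j \<in> lin_maps K E A"
proof (rule lin_mapsI)
  interpret Am: module K A by (rule k_spaceD(3)[OF A'(3)])
  fix x y assume "x \<in> carrier E" "y \<in> carrier E"
  then show "j (x \<oplus>\<^bsub>E\<^esub> y) = j x \<oplus>\<^bsub>A\<^esub> j y"
    by (intro i_eqD) (auto simp: i_j j_closed lin_add[OF q_lin] lin_add[OF i0])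
next
  interpret Am: module K A by (rule k_spaceD(3)[OF A'(3)])
  fix c x assume "c \<in> carrier K" "x \<in> carrier E"
  then show "j (c \<odot>\<^bsub>E\<^esub> x) = c \<odot>\<^bsub>A\<^esub> j x"
    by (intro i_eqD) (auto simp: i_j j_closed lin_smult[OF q_lin] lin_smult[OF i0])
qed (rule j_closed)

lemma j_i_\<phi>:
  assumes a: "a \<in> carrier A" and h: "h \<in> carrier H"
  shows "j (i a \<otimes>\<^bsub>E\<^esub> \<phi> h) = \<epsilon>\<^bsub>H\<^esub> h \<odot>\<^bsub>A\<^esub> a"
proof (rule i_eqD)
  interpret Am: module K A by (rule k_spaceD(3)[OF A'(3)])
  have x: "i a \<otimes>\<^bsub>E\<^esub> \<phi> h \<in> carrier E" by (rule ms a h)+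
  show "i (j (i a \<otimes>\<^bsub>E\<^esub> \<phi> h)) = i (\<epsilon>\<^bsub>H\<^esub> h \<odot>\<^bsub>A\<^esub> a)"
    by (simp add: i_j x q_i_\<phi> a h lin_smult[OF i0] counit_closed[OF H'(2)])
  show "j (i a \<otimes>\<^bsub>E\<^esub> \<phi> h) \<in> carrier A" by (rule j_closed[OF x])
  show "\<epsilon>\<^bsub>H\<^esub> h \<odot>\<^bsub>A\<^esub> a \<in> carrier A" by (rule ms a h)+
qed

end

section \<open>The crossed system of a split extension\<close>

text \<open>
The crossed product and the underlying tensor product are different records. They agree in the
components that matter for linear algebra, and the two following lemmas allow passing from one to
the other.
\<close>

lemma k_space_ops_cong:
  assumes V: "k_space K V"
    and eq: "carrier W = carrier V" "add W = add V" "zero W = zero V" "smult W = smult V"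
  shows "k_space K W"
proof -
  interpret V: module K V by (rule k_spaceD(3)[OF V])
  have ab: "abelian_group W"
    by (rule abelian_groupI) (auto simp: eq V.a_ac intro: V.add.l_inv_ex)
  have "module K W"
    by (rule moduleI[OF V.R.is_cring ab])
      (auto simp: eq V.smult_l_distr V.smult_r_distr V.smult_assoc1)
  then show ?thesis using V unfolding k_space_def by simp
qed

lemma tensor_ops_cong:
  assumes eq: "carrier W = carrier V" "add W = add V" "zero W = zero V" "smult W = smult V"
  shows "tensor_space K W W = tensor_space K V V" "pure_tensor K W W = pure_tensor K V V"
proof -
  have r: "tensor_relators K W W = tensor_relators K V V"
    unfolding tensor_relators_def eq ..
  have n: "tensor_null K W W = tensor_null K V V"
    unfolding tensor_null_def r eq ..
  show "tensor_space K W W = tensor_space K V V" "pure_tensor K W W = pure_tensor K V V"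
    unfolding tensor_space_def pure_tensor_def n eq by (rule refl)+
qed

lemma tensor_coalgebra_simps [simp]:
  "comult (tensor_coalgebra K A H) = (let T = tensor_space K A H; TT = tensor_space K T T in
      tensor_lift K TT (\<lambda>a h.
          sweedler K A TT (\<lambda>a\<^sub>1 a\<^sub>2. sweedler K H TT (\<lambda>h\<^sub>1 h\<^sub>2.
            pure_tensor K T T (pure_tensor K A H a\<^sub>1 h\<^sub>1) (pure_tensor K A H a\<^sub>2 h\<^sub>2)) h) a))"
  "counit (tensor_coalgebra K A H) = tensor_lift K (scalars K) (\<lambda>a h. \<epsilon>\<^bsub>A\<^esub> a \<otimes>\<^bsub>K\<^esub> \<epsilon>\<^bsub>H\<^esub> h)"
  "carrier (tensor_coalgebra K A H) = carrier (tensor_space K A H)"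
  "add (tensor_coalgebra K A H) = add (tensor_space K A H)"
  "zero (tensor_coalgebra K A H) = zero (tensor_space K A H)"
  "smult (tensor_coalgebra K A H) = smult (tensor_space K A H)"
  by (simp_all add: tensor_coalgebra_def module.defs Let_def)

lemma crossed_product_simps [simp]:
  "comult (crossed_product K A H act f) = comult (tensor_coalgebra K A H)"
  "counit (crossed_product K A H act f) = counit (tensor_coalgebra K A H)"
  "carrier (crossed_product K A H act f) = carrier (tensor_space K A H)"
  "add (crossed_product K A H act f) = add (tensor_space K A H)"
  "zero (crossed_product K A H act f) = zero (tensor_space K A H)"
  "smult (crossed_product K A H act f) = smult (tensor_space K A H)"
  "one (crossed_product K A H act f) = pure_tensor K A H \<one>\<^bsub>A\<^esub> \<one>\<^bsub>H\<^esub>"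
  by (simp_all add: crossed_product_def Let_def)

context split_extension
begin

lemmas js = qs j_lin lin_comp[OF j_lin] lin_closed[OF j_lin]

definition act :: "('h \<times> 'a \<Rightarrow> 'k) set \<Rightarrow> 'a" where
  "act = tensor_lift K A (\<lambda>h a. j (\<phi> h \<otimes>\<^bsub>E\<^esub> i a))"

definition cocycle :: "('h \<times> 'h \<Rightarrow> 'k) set \<Rightarrow> 'a" where
  "cocycle = tensor_lift K A (\<lambda>g h. j (\<phi> g \<otimes>\<^bsub>E\<^esub> \<phi> h))"

lemma act_bilin: "bilin K H A A (\<lambda>h a. j (\<phi> h \<otimes>\<^bsub>E\<^esub> i a))"
  by (rule js | assumption)+

lemma cocycle_bilin: "bilin K H H A (\<lambda>g h. j (\<phi> g \<otimes>\<^bsub>E\<^esub> \<phi> h))"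
  by (rule js | assumption)+

lemma act_lin: "act \<in> lin_maps K (tensor_space K H A) A"
  unfolding act_def by (rule tensor_lift_lin[OF H'(3) A'(3) A'(3) act_bilin])

lemma cocycle_lin: "cocycle \<in> lin_maps K (tensor_space K H H) A"
  unfolding cocycle_def by (rule tensor_lift_lin[OF H'(3) H'(3) A'(3) cocycle_bilin])

lemma act_pure: "\<lbrakk>h \<in> carrier H; a \<in> carrier A\<rbrakk> \<Longrightarrow> act (pure_tensor K H A h a) = j (\<phi> h \<otimes>\<^bsub>E\<^esub> i a)"
  unfolding act_def by (rule tensor_lift_pure[OF H'(3) A'(3) A'(3) act_bilin])

lemma cocycle_pure:
  "\<lbrakk>g \<in> carrier H; h \<in> carrier H\<rbrakk> \<Longrightarrow> cocycle (pure_tensor K H H g h) = j (\<phi> g \<otimes>\<^bsub>E\<^esub> \<phi> h)"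
  unfolding cocycle_def by (rule tensor_lift_pure[OF H'(3) H'(3) A'(3) cocycle_bilin])

lemmas acs = js lin_comp[OF act_lin] lin_closed[OF act_lin] lin_comp[OF cocycle_lin] lin_closed[OF cocycle_lin]

lemma i_act:
  "\<lbrakk>h \<in> carrier H; a \<in> carrier A\<rbrakk> \<Longrightarrow> i (act (pure_tensor K H A h a)) = q (\<phi> h \<otimes>\<^bsub>E\<^esub> i a)"
  by (simp add: act_pure i_j mult_mem[OF E'(1)] maps_closed)

lemma i_cocycle:
  "\<lbrakk>g \<in> carrier H; h \<in> carrier H\<rbrakk> \<Longrightarrow> i (cocycle (pure_tensor K H H g h)) = q (\<phi> g \<otimes>\<^bsub>E\<^esub> \<phi> h)"
  by (simp add: cocycle_pure i_j mult_mem[OF E'(1)] maps_closed)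

text \<open>
Recompose \<open>\<phi>(h) i(a)\<close>, whose coaction is \<open>\<phi>(h\<^sub>1) i(a) \<otimes> h\<^sub>2\<close>.
\<close>

lemma \<phi>_i_commute:
  assumes h: "h \<in> carrier H" and a: "a \<in> carrier A"
  shows "\<phi> h \<otimes>\<^bsub>E\<^esub> i a = sweedler K H E (\<lambda>h\<^sub>1 h\<^sub>2. i (act (pure_tensor K H A h\<^sub>1 a)) \<otimes>\<^bsub>E\<^esub> \<phi> h\<^sub>2) h"
proof -
  have x: "\<phi> h \<otimes>\<^bsub>E\<^esub> i a \<in> carrier E" by (rule ms h a)+
  have "\<phi> h \<otimes>\<^bsub>E\<^esub> i a = coact E (\<lambda>u h. q u \<otimes>\<^bsub>E\<^esub> \<phi> h) (\<phi> h \<otimes>\<^bsub>E\<^esub> i a)"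
    by (rule recompose[OF x, symmetric])
  also have "\<dots> = sweedler K H E (\<lambda>h\<^sub>1 h\<^sub>2. q (\<phi> h\<^sub>1 \<otimes>\<^bsub>E\<^esub> i a) \<otimes>\<^bsub>E\<^esub> \<phi> h\<^sub>2) h"
    by (rule coact_\<phi>_i[OF E'(3) _ a h]) (rule qs | assumption)+
  also have "\<dots> = sweedler K H E (\<lambda>h\<^sub>1 h\<^sub>2. i (act (pure_tensor K H A h\<^sub>1 a)) \<otimes>\<^bsub>E\<^esub> \<phi> h\<^sub>2) h"
    by (rule sweedler_cong[OF H'(2) E'(3) h]) ((rule qs a | assumption)+, simp add: i_act a)
  finally show ?thesis .
qed

text \<open>
Recompose \<open>\<phi>(g) \<phi>(h)\<close>, whose coaction is \<open>\<phi>(g\<^sub>1) \<phi>(h\<^sub>1) \<otimes> g\<^sub>2 h\<^sub>2\<close>.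
\<close>

lemma \<phi>_\<phi>_mult:
  assumes g: "g \<in> carrier H" and h: "h \<in> carrier H"
  shows "\<phi> g \<otimes>\<^bsub>E\<^esub> \<phi> h = sweedler K H E (\<lambda>g\<^sub>1 g\<^sub>2. sweedler K H E (\<lambda>h\<^sub>1 h\<^sub>2.
    i (cocycle (pure_tensor K H H g\<^sub>1 h\<^sub>1)) \<otimes>\<^bsub>E\<^esub> \<phi> (g\<^sub>2 \<otimes>\<^bsub>H\<^esub> h\<^sub>2)) h) g"
proof -
  have \<phi>g: "\<phi> g \<in> carrier E" and \<phi>h: "\<phi> h \<in> carrier E" by (rule maps_closed g h)+
  let ?b = "\<lambda>u h. q u \<otimes>\<^bsub>E\<^esub> \<phi> h"
  have b: "bilin K E H E ?b" by (rule qs | assumption)+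
  have "\<phi> g \<otimes>\<^bsub>E\<^esub> \<phi> h = coact E ?b (\<phi> g \<otimes>\<^bsub>E\<^esub> \<phi> h)"
    by (rule recompose[symmetric]) (rule ms g h)+
  also have "\<dots> = coact E (\<lambda>u g. coact E (\<lambda>v h. ?b (u \<otimes>\<^bsub>E\<^esub> v) (g \<otimes>\<^bsub>H\<^esub> h)) (\<phi> h)) (\<phi> g)"
    by (rule coact_mult[OF E'(3) b \<phi>g \<phi>h])
  also have "\<dots> = sweedler K H E (\<lambda>g\<^sub>1 g\<^sub>2. coact E (\<lambda>v h. ?b (\<phi> g\<^sub>1 \<otimes>\<^bsub>E\<^esub> v) (g\<^sub>2 \<otimes>\<^bsub>H\<^esub> h)) (\<phi> h)) g"
    by (rule coact_\<phi>[OF E'(3) _ g]) (rule qs h | assumption)+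
  also have "\<dots> = sweedler K H E (\<lambda>g\<^sub>1 g\<^sub>2. sweedler K H E (\<lambda>h\<^sub>1 h\<^sub>2.
    i (cocycle (pure_tensor K H H g\<^sub>1 h\<^sub>1)) \<otimes>\<^bsub>E\<^esub> \<phi> (g\<^sub>2 \<otimes>\<^bsub>H\<^esub> h\<^sub>2)) h) g"
    apply (rule sweedler_cong[OF H'(2) E'(3) g])
    subgoal by (rule qs h | assumption)+
    apply (subst coact_\<phi>[OF E'(3) _ h])
    subgoal by (rule qs | assumption)+
    apply (rule sweedler_cong[OF H'(2) E'(3) h])
    subgoal by (rule qs | assumption)+
    by (simp add: i_cocycle)
  finally show ?thesis .
qed

text \<open>
Unitality is \<open>q(i(a) \<phi>(h)) = \<epsilon>(h) i(a)\<close> for \<open>a = 1\<close> and for \<open>h = 1\<close>. For products, \<open>q\<close> is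
\<open>A\<close>-linear on the left, so that
\<open>q(\<phi>(h) i(a) i(b)) = q(i(h\<^sub>1 \<triangleright> a) \<phi>(h\<^sub>2) i(b)) = i(h\<^sub>1 \<triangleright> a) q(\<phi>(h\<^sub>2) i(b))\<close>.
\<close>

lemma weak_action_act: "weak_action K A H act"
proof -
  let ?app = "\<lambda>h a. act (pure_tensor K H A h a)"
  interpret Am: module K A by (rule k_spaceD(3)[OF A'(3)])
  have one_A: "?app h \<one>\<^bsub>A\<^esub> = \<epsilon>\<^bsub>H\<^esub> h \<odot>\<^bsub>A\<^esub> \<one>\<^bsub>A\<^esub>" if h: "h \<in> carrier H" for h
    using j_i_\<phi>[OF A.one_closed h] by (simp add: act_pure h i_one maps_closed)
  have one_H: "?app \<one>\<^bsub>H\<^esub> a = a" if a: "a \<in> carrier A" for a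
    using j_i_\<phi>[OF a H.one_closed]
    by (simp add: act_pure a \<phi>_one maps_closed counit_ring_hom(2)[OF bialg(2)])
  have mult: "?app h (a \<otimes>\<^bsub>A\<^esub> b) = sweedler K H A (\<lambda>h\<^sub>1 h\<^sub>2. ?app h\<^sub>1 a \<otimes>\<^bsub>A\<^esub> ?app h\<^sub>2 b) h"
    if h: "h \<in> carrier H" and a: "a \<in> carrier A" and b: "b \<in> carrier A" for h a b
  proof (rule i_eqD)
    have ib: "i b \<in> carrier E" and ia: "i a \<in> carrier E" and \<phi>h: "\<phi> h \<in> carrier E"
      by (rule maps_closed a b h)+
    have "i (?app h (a \<otimes>\<^bsub>A\<^esub> b)) = q ((\<phi> h \<otimes>\<^bsub>E\<^esub> i a) \<otimes>\<^bsub>E\<^esub> i b)"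
      by (simp add: i_act h a b i_mult E.m_assoc ia ib \<phi>h)
    also have "\<dots> = sweedler K H E (\<lambda>h\<^sub>1 h\<^sub>2. q ((i (?app h\<^sub>1 a) \<otimes>\<^bsub>E\<^esub> \<phi> h\<^sub>2) \<otimes>\<^bsub>E\<^esub> i b)) h"
      unfolding \<phi>_i_commute[OF h a]
      by (rule sweedler_lin[OF H'(2) E'(3) E'(3) _ _ h]) (rule acs a ib | assumption)+
    also have "\<dots> = sweedler K H E (\<lambda>h\<^sub>1 h\<^sub>2. i (?app h\<^sub>1 a \<otimes>\<^bsub>A\<^esub> ?app h\<^sub>2 b)) h"
    proof (rule sweedler_cong[OF H'(2) E'(3) h])
      show "bilin K H H E (\<lambda>h\<^sub>1 h\<^sub>2. q ((i (?app h\<^sub>1 a) \<otimes>\<^bsub>E\<^esub> \<phi> h\<^sub>2) \<otimes>\<^bsub>E\<^esub> i b))"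
        by (rule acs a ib | assumption)+
      fix g k assume g: "g \<in> carrier H" and k: "k \<in> carrier H"
      have ca: "?app g a \<in> carrier A" and cb: "?app k b \<in> carrier A" by (rule acs g k a b)+
      have m: "\<phi> k \<otimes>\<^bsub>E\<^esub> i b \<in> carrier E" by (rule ms k b)+
      have "(i (?app g a) \<otimes>\<^bsub>E\<^esub> \<phi> k) \<otimes>\<^bsub>E\<^esub> i b = i (?app g a) \<otimes>\<^bsub>E\<^esub> (\<phi> k \<otimes>\<^bsub>E\<^esub> i b)"
        by (simp add: E.m_assoc maps_closed ca k ib)
      then show "q ((i (?app g a) \<otimes>\<^bsub>E\<^esub> \<phi> k) \<otimes>\<^bsub>E\<^esub> i b) = i (?app g a \<otimes>\<^bsub>A\<^esub> ?app k b)"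
        by (simp add: q_i_mult[OF ca m] i_mult[OF ca cb] i_act[OF k b])
    qed
    also have "\<dots> = i (sweedler K H A (\<lambda>h\<^sub>1 h\<^sub>2. ?app h\<^sub>1 a \<otimes>\<^bsub>A\<^esub> ?app h\<^sub>2 b) h)"
      by (rule sweedler_lin[OF H'(2) A'(3) E'(3) i0 _ h, symmetric]) (rule acs a b | assumption)+
    finally show "i (?app h (a \<otimes>\<^bsub>A\<^esub> b)) = \<dots>" .
    show "?app h (a \<otimes>\<^bsub>A\<^esub> b) \<in> carrier A" by (rule acs a b h)+
    show "sweedler K H A (\<lambda>h\<^sub>1 h\<^sub>2. ?app h\<^sub>1 a \<otimes>\<^bsub>A\<^esub> ?app h\<^sub>2 b) h \<in> carrier A"
      by (rule acs a b h | assumption)+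
  qed
  show ?thesis unfolding weak_action_def Let_def using act_lin one_A one_H mult by blast
qed

section \<open>The isomorphism with the crossed product\<close>

abbreviation T :: "('k, ('a \<times> 'h \<Rightarrow> 'k) set) module" where
  "T \<equiv> tensor_space K A H"

abbreviation TT :: "('k, (('a \<times> 'h \<Rightarrow> 'k) set \<times> ('a \<times> 'h \<Rightarrow> 'k) set \<Rightarrow> 'k) set) module" where
  "TT \<equiv> tensor_space K T T"

abbreviation P :: "('k, ('a \<times> 'h \<Rightarrow> 'k) set) bialg" where
  "P \<equiv> crossed_product K A H act cocycle"

text \<open>
The following map and \<open>\<theta> x = j(x\<^sub>1) # \<pi>(x\<^sub>2)\<close> are mutually inverse: one direction is lemma
\<open>recompose\<close>, the other the fact that \<open>q\<close> replaces \<open>\<phi>(h)\<close> by \<open>\<epsilon>(h)\<close> in \<open>i(a) \<phi>(h)\<close>.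
\<close>

definition \<psi> :: "('a \<times> 'h \<Rightarrow> 'k) set \<Rightarrow> 'e" where
  "\<psi> = tensor_lift K E (\<lambda>a h. i a \<otimes>\<^bsub>E\<^esub> \<phi> h)"

definition \<theta> :: "'e \<Rightarrow> ('a \<times> 'h \<Rightarrow> 'k) set" where
  "\<theta> = coact T (\<lambda>u h. pure_tensor K A H (j u) h)"

lemma \<psi>_bilin: "bilin K A H E (\<lambda>a h. i a \<otimes>\<^bsub>E\<^esub> \<phi> h)"
  by (rule ms | assumption)+

lemma \<psi>_lin: "\<psi> \<in> lin_maps K T E"
  unfolding \<psi>_def by (rule tensor_lift_lin[OF A'(3) H'(3) E'(3) \<psi>_bilin])

lemma \<psi>_pure: "\<lbrakk>a \<in> carrier A; h \<in> carrier H\<rbrakk> \<Longrightarrow> \<psi> (pure_tensor K A H a h) = i a \<otimes>\<^bsub>E\<^esub> \<phi> h"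
  unfolding \<psi>_def by (rule tensor_lift_pure[OF A'(3) H'(3) E'(3) \<psi>_bilin])

lemma \<theta>_bilin: "bilin K E H T (\<lambda>u h. pure_tensor K A H (j u) h)"
  by (rule js | assumption)+

lemma \<theta>_lin: "\<theta> \<in> lin_maps K E T"
  unfolding \<theta>_def by (rule coact_comp[OF spaces(4) \<theta>_bilin lin_id])

lemmas ts = acs \<psi>_lin \<theta>_lin lin_comp[OF \<psi>_lin] lin_closed[OF \<psi>_lin] lin_comp[OF \<theta>_lin] lin_closed[OF \<theta>_lin]

lemma \<psi>_\<theta>:
  assumes x: "x \<in> carrier E" shows "\<psi> (\<theta> x) = x"
proof -
  have "\<psi> (\<theta> x) = coact E (\<lambda>u h. \<psi> (pure_tensor K A H (j u) h)) x"
    unfolding \<theta>_def by (rule coact_lin[OF spaces(4) E'(3) \<psi>_lin \<theta>_bilin x])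
  also have "\<dots> = coact E (\<lambda>u h. q u \<otimes>\<^bsub>E\<^esub> \<phi> h) x"
    by (rule coact_cong[OF E'(3) x]) ((rule ts | assumption)+, simp add: \<psi>_pure j_closed i_j)
  also have "\<dots> = x" by (rule recompose[OF x])
  finally show ?thesis .
qed

lemma \<theta>_i_\<phi>:
  assumes a: "a \<in> carrier A" and h: "h \<in> carrier H"
  shows "\<theta> (i a \<otimes>\<^bsub>E\<^esub> \<phi> h) = pure_tensor K A H a h"
proof -
  have "\<theta> (i a \<otimes>\<^bsub>E\<^esub> \<phi> h) = sweedler K H T (\<lambda>h\<^sub>1 h\<^sub>2. pure_tensor K A H (j (i a \<otimes>\<^bsub>E\<^esub> \<phi> h\<^sub>1)) h\<^sub>2) h"
    unfolding \<theta>_def by (rule coact_i_\<phi>[OF spaces(4) \<theta>_bilin a h])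
  also have "\<dots> = sweedler K H T (\<lambda>h\<^sub>1 h\<^sub>2. \<epsilon>\<^bsub>H\<^esub> h\<^sub>1 \<odot>\<^bsub>T\<^esub> pure_tensor K A H a h\<^sub>2) h"
  proof (rule sweedler_cong[OF H'(2) spaces(4) h])
    show "bilin K H H T (\<lambda>h\<^sub>1 h\<^sub>2. pure_tensor K A H (j (i a \<otimes>\<^bsub>E\<^esub> \<phi> h\<^sub>1)) h\<^sub>2)"
      by (rule js a | assumption)+
    fix g k assume g: "g \<in> carrier H" and k: "k \<in> carrier H"
    show "pure_tensor K A H (j (i a \<otimes>\<^bsub>E\<^esub> \<phi> g)) k = \<epsilon>\<^bsub>H\<^esub> g \<odot>\<^bsub>T\<^esub> pure_tensor K A H a k"
      using lin_smult[OF bilinD(2)[OF pure_tensor_bilin[OF A'(3) H'(3)] k] counit_closed[OF H'(2) g] a]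
      by (simp add: j_i_\<phi> a g)
  qed
  also have "\<dots> = pure_tensor K A H a h"
    by (rule sweedler_counit_left[OF H'(2) spaces(4) _ h]) (rule ms a)+
  finally show ?thesis .
qed

lemma \<theta>_\<psi>:
  assumes x: "x \<in> carrier T" shows "\<theta> (\<psi> x) = x"
  by (rule tensor_lin_eqI[OF A'(3) H'(3) spaces(4) lin_comp[OF \<theta>_lin \<psi>_lin] lin_id _ x])
    (simp add: \<psi>_pure \<theta>_i_\<phi>)

definition crossed_mult :: "'a \<Rightarrow> 'h \<Rightarrow> 'a \<Rightarrow> 'h \<Rightarrow> ('a \<times> 'h \<Rightarrow> 'k) set" where
  "crossed_mult a h c g = sweedler3 K H T (\<lambda>h\<^sub>1 h\<^sub>2 h\<^sub>3. sweedler K H T (\<lambda>g\<^sub>1 g\<^sub>2.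
     pure_tensor K A H
       (a \<otimes>\<^bsub>A\<^esub> act (pure_tensor K H A h\<^sub>1 c) \<otimes>\<^bsub>A\<^esub> cocycle (pure_tensor K H H h\<^sub>2 g\<^sub>1))
       (h\<^sub>3 \<otimes>\<^bsub>H\<^esub> g\<^sub>2)) g) h"

lemma mult_P: "x \<otimes>\<^bsub>P\<^esub> y = tensor_lift K T (\<lambda>a h. tensor_lift K T (\<lambda>c g. crossed_mult a h c g) y) x"
  by (simp add: crossed_product_def Let_def crossed_mult_def)

lemma crossed_mult_lin:
  "\<lbrakk>h \<in> carrier H; c \<in> carrier A; g \<in> carrier H\<rbrakk> \<Longrightarrow> (\<lambda>a. crossed_mult a h c g) \<in> lin_maps K A T"
  "\<lbrakk>a \<in> carrier A; c \<in> carrier A; g \<in> carrier H\<rbrakk> \<Longrightarrow> (\<lambda>h. crossed_mult a h c g) \<in> lin_maps K H T"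
  "\<lbrakk>a \<in> carrier A; h \<in> carrier H; g \<in> carrier H\<rbrakk> \<Longrightarrow> (\<lambda>c. crossed_mult a h c g) \<in> lin_maps K A T"
  "\<lbrakk>a \<in> carrier A; h \<in> carrier H; c \<in> carrier A\<rbrakk> \<Longrightarrow> (\<lambda>g. crossed_mult a h c g) \<in> lin_maps K H T"
  unfolding crossed_mult_def sweedler3_def by (rule ts | assumption)+

text \<open>
Both commutation rules, read from right to left:
\<open>i(a) i(h\<^sub>1 \<triangleright> c) i(f(h\<^sub>2, g\<^sub>1)) \<phi>(h\<^sub>3 g\<^sub>2) = i(a) i(h\<^sub>1 \<triangleright> c) \<phi>(h\<^sub>2) \<phi>(g) = i(a) \<phi>(h) i(c) \<phi>(g)\<close>.
The second and third Sweedler factors of \<open>h\<close> arise as the factors of one element \<open>y\<close>, and the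
first step takes place with \<open>y\<close> fixed.
\<close>

lemma \<psi>_crossed_mult:
  assumes a: "a \<in> carrier A" and h: "h \<in> carrier H" and c: "c \<in> carrier A" and g: "g \<in> carrier H"
  shows "\<psi> (crossed_mult a h c g) = (i a \<otimes>\<^bsub>E\<^esub> \<phi> h) \<otimes>\<^bsub>E\<^esub> (i c \<otimes>\<^bsub>E\<^esub> \<phi> g)"
proof -
  let ?app = "\<lambda>h a. act (pure_tensor K H A h a)" and ?f = "\<lambda>g h. cocycle (pure_tensor K H H g h)"
  have cl: "i a \<in> carrier E" "i c \<in> carrier E" "\<phi> h \<in> carrier E" "\<phi> g \<in> carrier E"
    by (rule maps_closed a c h g)+
  let ?u = "\<lambda>h\<^sub>1. i a \<otimes>\<^bsub>E\<^esub> i (?app h\<^sub>1 c)"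
  have u: "?u k \<in> carrier E" if "k \<in> carrier H" for k by (rule acs a c that)+
  let ?m = "\<lambda>h\<^sub>1 h\<^sub>2 h\<^sub>3 g\<^sub>1 g\<^sub>2. pure_tensor K A H (a \<otimes>\<^bsub>A\<^esub> ?app h\<^sub>1 c \<otimes>\<^bsub>A\<^esub> ?f h\<^sub>2 g\<^sub>1) (h\<^sub>3 \<otimes>\<^bsub>H\<^esub> g\<^sub>2)"
  have inner: "\<psi> (sweedler K H T (\<lambda>h\<^sub>2 h\<^sub>3. sweedler K H T (?m h\<^sub>1 h\<^sub>2 h\<^sub>3) g) y) = ?u h\<^sub>1 \<otimes>\<^bsub>E\<^esub> (\<phi> y \<otimes>\<^bsub>E\<^esub> \<phi> g)"
    if h1: "h\<^sub>1 \<in> carrier H" and y: "y \<in> carrier H" for h\<^sub>1 y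
  proof -
    have m: "\<psi> (?m h\<^sub>1 h\<^sub>2 h\<^sub>3 g\<^sub>1 g\<^sub>2) = ?u h\<^sub>1 \<otimes>\<^bsub>E\<^esub> (i (?f h\<^sub>2 g\<^sub>1) \<otimes>\<^bsub>E\<^esub> \<phi> (h\<^sub>3 \<otimes>\<^bsub>H\<^esub> g\<^sub>2))"
      if "h\<^sub>2 \<in> carrier H" "h\<^sub>3 \<in> carrier H" "g\<^sub>1 \<in> carrier H" "g\<^sub>2 \<in> carrier H" for h\<^sub>2 h\<^sub>3 g\<^sub>1 g\<^sub>2
    proof -
      have c1: "?app h\<^sub>1 c \<in> carrier A" and c2: "?f h\<^sub>2 g\<^sub>1 \<in> carrier A" and c3: "h\<^sub>3 \<otimes>\<^bsub>H\<^esub> g\<^sub>2 \<in> carrier H"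
        by (rule acs h1 c that)+
      show ?thesis by (simp add: \<psi>_pure a c1 c2 c3 i_mult E.m_assoc maps_closed del: H.m_closed)
    qed
    have "\<psi> (sweedler K H T (\<lambda>h\<^sub>2 h\<^sub>3. sweedler K H T (?m h\<^sub>1 h\<^sub>2 h\<^sub>3) g) y) =
      sweedler K H E (\<lambda>h\<^sub>2 h\<^sub>3. \<psi> (sweedler K H T (?m h\<^sub>1 h\<^sub>2 h\<^sub>3) g)) y"
      by (rule sweedler_lin[OF H'(2) spaces(4) E'(3) \<psi>_lin _ y]) (rule ts a c g h1 | assumption)+
    also have "\<dots> = sweedler K H E (\<lambda>h\<^sub>2 h\<^sub>3. ?u h\<^sub>1 \<otimes>\<^bsub>E\<^esub>
      sweedler K H E (\<lambda>g\<^sub>1 g\<^sub>2. i (?f h\<^sub>2 g\<^sub>1) \<otimes>\<^bsub>E\<^esub> \<phi> (h\<^sub>3 \<otimes>\<^bsub>H\<^esub> g\<^sub>2)) g) y"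
    proof (rule sweedler_cong[OF H'(2) E'(3) y])
      show "bilin K H H E (\<lambda>h\<^sub>2 h\<^sub>3. \<psi> (sweedler K H T (?m h\<^sub>1 h\<^sub>2 h\<^sub>3) g))"
        by (rule ts a c g h1 | assumption)+
      fix h\<^sub>2 h\<^sub>3 assume h23: "h\<^sub>2 \<in> carrier H" "h\<^sub>3 \<in> carrier H"
      have "\<psi> (sweedler K H T (?m h\<^sub>1 h\<^sub>2 h\<^sub>3) g) = sweedler K H E (\<lambda>g\<^sub>1 g\<^sub>2. \<psi> (?m h\<^sub>1 h\<^sub>2 h\<^sub>3 g\<^sub>1 g\<^sub>2)) g"
        by (rule sweedler_lin[OF H'(2) spaces(4) E'(3) \<psi>_lin _ g]) (rule ts a c h1 h23 | assumption)+
      also have "\<dots> = sweedler K H E (\<lambda>g\<^sub>1 g\<^sub>2. ?u h\<^sub>1 \<otimes>\<^bsub>E\<^esub> (i (?f h\<^sub>2 g\<^sub>1) \<otimes>\<^bsub>E\<^esub> \<phi> (h\<^sub>3 \<otimes>\<^bsub>H\<^esub> g\<^sub>2))) g"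
        by (rule sweedler_cong[OF H'(2) E'(3) g]) ((rule ts a c h1 h23 | assumption)+, rule m[OF h23])
      also have "\<dots> = ?u h\<^sub>1 \<otimes>\<^bsub>E\<^esub> sweedler K H E (\<lambda>g\<^sub>1 g\<^sub>2. i (?f h\<^sub>2 g\<^sub>1) \<otimes>\<^bsub>E\<^esub> \<phi> (h\<^sub>3 \<otimes>\<^bsub>H\<^esub> g\<^sub>2)) g"
        by (rule sweedler_lin[OF H'(2) E'(3) E'(3) _ _ g, symmetric]) (rule ts u[OF h1] h23 | assumption)+
      finally show "\<psi> (sweedler K H T (?m h\<^sub>1 h\<^sub>2 h\<^sub>3) g) = \<dots>" .
    qed
    also have "\<dots> = ?u h\<^sub>1 \<otimes>\<^bsub>E\<^esub> sweedler K H E (\<lambda>h\<^sub>2 h\<^sub>3.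
      sweedler K H E (\<lambda>g\<^sub>1 g\<^sub>2. i (?f h\<^sub>2 g\<^sub>1) \<otimes>\<^bsub>E\<^esub> \<phi> (h\<^sub>3 \<otimes>\<^bsub>H\<^esub> g\<^sub>2)) g) y"
      by (rule sweedler_lin[OF H'(2) E'(3) E'(3) _ _ y, symmetric]) (rule ts u[OF h1] g | assumption)+
    finally show ?thesis by (simp add: \<phi>_\<phi>_mult[OF y g])
  qed
  have "\<psi> (crossed_mult a h c g) = sweedler K H E (\<lambda>h\<^sub>1 y.
    \<psi> (sweedler K H T (\<lambda>h\<^sub>2 h\<^sub>3. sweedler K H T (?m h\<^sub>1 h\<^sub>2 h\<^sub>3) g) y)) h"
    unfolding crossed_mult_def sweedler3_def
    by (rule sweedler_lin[OF H'(2) spaces(4) E'(3) \<psi>_lin _ h]) (rule ts a c g | assumption)+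
  also have "\<dots> = sweedler K H E (\<lambda>h\<^sub>1 y. i a \<otimes>\<^bsub>E\<^esub> ((i (?app h\<^sub>1 c) \<otimes>\<^bsub>E\<^esub> \<phi> y) \<otimes>\<^bsub>E\<^esub> \<phi> g)) h"
  proof (rule sweedler_cong[OF H'(2) E'(3) h])
    show "bilin K H H E (\<lambda>h\<^sub>1 y. \<psi> (sweedler K H T (\<lambda>h\<^sub>2 h\<^sub>3. sweedler K H T (?m h\<^sub>1 h\<^sub>2 h\<^sub>3) g) y))"
      by (rule ts a c g | assumption)+
    fix h\<^sub>1 y assume hy: "h\<^sub>1 \<in> carrier H" "y \<in> carrier H"
    have c1: "i (?app h\<^sub>1 c) \<in> carrier E" by (rule acs hy c)+
    show "\<psi> (sweedler K H T (\<lambda>h\<^sub>2 h\<^sub>3. sweedler K H T (?m h\<^sub>1 h\<^sub>2 h\<^sub>3) g) y) =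
      i a \<otimes>\<^bsub>E\<^esub> ((i (?app h\<^sub>1 c) \<otimes>\<^bsub>E\<^esub> \<phi> y) \<otimes>\<^bsub>E\<^esub> \<phi> g)"
      unfolding inner[OF hy] using c1 by (simp add: E.m_assoc cl maps_closed hy)
  qed
  also have "\<dots> = i a \<otimes>\<^bsub>E\<^esub> (sweedler K H E (\<lambda>h\<^sub>1 y. i (?app h\<^sub>1 c) \<otimes>\<^bsub>E\<^esub> \<phi> y) h \<otimes>\<^bsub>E\<^esub> \<phi> g)"
    by (rule sweedler_lin[OF H'(2) E'(3) E'(3) _ _ h, symmetric]) (rule acs cl c | assumption)+
  also have "\<dots> = (i a \<otimes>\<^bsub>E\<^esub> \<phi> h) \<otimes>\<^bsub>E\<^esub> (i c \<otimes>\<^bsub>E\<^esub> \<phi> g)"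
    unfolding \<phi>_i_commute[OF h c, symmetric] by (simp add: E.m_assoc cl)
  finally show ?thesis .
qed

lemma crossed_lift_bilin:
  assumes y: "y \<in> carrier T"
  shows "bilin K A H T (\<lambda>a h. tensor_lift K T (\<lambda>c g. crossed_mult a h c g) y)"
proof (rule bilinI)
  fix a assume a: "a \<in> carrier A"
  show "(\<lambda>h. tensor_lift K T (\<lambda>c g. crossed_mult a h c g) y) \<in> lin_maps K H T"
    by (rule lift_param_lin[OF H'(3) A'(3) H'(3) spaces(4) _ y], rule trilinI)
      (rule crossed_mult_lin a | assumption)+
next
  fix h assume h: "h \<in> carrier H"
  show "(\<lambda>a. tensor_lift K T (\<lambda>c g. crossed_mult a h c g) y) \<in> lin_maps K A T"
    by (rule lift_param_lin[OF A'(3) A'(3) H'(3) spaces(4) _ y], rule trilinI)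
      (rule crossed_mult_lin h | assumption)+
qed

lemma mult_P_closed: "\<lbrakk>x \<in> carrier T; y \<in> carrier T\<rbrakk> \<Longrightarrow> x \<otimes>\<^bsub>P\<^esub> y \<in> carrier T"
  unfolding mult_P
  by (rule lin_closed[OF tensor_lift_lin[OF A'(3) H'(3) spaces(4) crossed_lift_bilin]])

lemma \<psi>_mult:
  assumes x: "x \<in> carrier T" and y: "y \<in> carrier T"
  shows "\<psi> (x \<otimes>\<^bsub>P\<^esub> y) = \<psi> x \<otimes>\<^bsub>E\<^esub> \<psi> y"
proof -
  have \<psi>y: "\<psi> y \<in> carrier E" by (rule lin_closed[OF \<psi>_lin y])
  have in_y: "\<psi> (tensor_lift K T (\<lambda>c g. crossed_mult a h c g) y) = (i a \<otimes>\<^bsub>E\<^esub> \<phi> h) \<otimes>\<^bsub>E\<^esub> \<psi> y"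
    if ah: "a \<in> carrier A" "h \<in> carrier H" for a h
  proof -
    have b: "bilin K A H T (\<lambda>c g. crossed_mult a h c g)"
      by (rule bilinI) (rule crossed_mult_lin ah | assumption)+
    show ?thesis
      by (rule tensor_lin_eqI[OF A'(3) H'(3) E'(3)
            lin_comp[OF \<psi>_lin tensor_lift_lin[OF A'(3) H'(3) spaces(4) b]] _ _ y])
        ((rule ts ah)+, simp add: tensor_lift_pure[OF A'(3) H'(3) spaces(4) b] \<psi>_crossed_mult ah \<psi>_pure)
  qed
  note b = crossed_lift_bilin[OF y]
  show ?thesis unfolding mult_P
    by (rule tensor_lin_eqI[OF A'(3) H'(3) E'(3)
          lin_comp[OF \<psi>_lin tensor_lift_lin[OF A'(3) H'(3) spaces(4) b]] _ _ x])
      ((rule ts \<psi>y)+, simp add: tensor_lift_pure[OF A'(3) H'(3) spaces(4) b] in_y \<psi>_pure)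
qed

text \<open>
The formula says that \<open>\<theta>\<close> is comultiplicative. On a pure tensor it holds because \<open>i\<close> and \<open>\<phi>\<close> are
coalgebra maps and \<open>\<Delta>\<close> is multiplicative:
\<open>\<Delta>(i(a) \<phi>(h)) = i(a\<^sub>1) \<phi>(h\<^sub>1) \<otimes> i(a\<^sub>2) \<phi>(h\<^sub>2)\<close>.
\<close>

lemma comult_P:
  assumes x: "x \<in> carrier T"
  shows "\<Delta>\<^bsub>P\<^esub> x = sweedler K E TT (\<lambda>x\<^sub>1 x\<^sub>2. pure_tensor K T T (\<theta> x\<^sub>1) (\<theta> x\<^sub>2)) (\<psi> x)"
proof -
  let ?c = "\<lambda>a\<^sub>1 a\<^sub>2 h\<^sub>1 h\<^sub>2. pure_tensor K T T (pure_tensor K A H a\<^sub>1 h\<^sub>1) (pure_tensor K A H a\<^sub>2 h\<^sub>2)"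
  let ?b = "\<lambda>a h. sweedler K A TT (\<lambda>a\<^sub>1 a\<^sub>2. sweedler K H TT (?c a\<^sub>1 a\<^sub>2) h) a"
  let ?d = "\<lambda>x\<^sub>1 x\<^sub>2. pure_tensor K T T (\<theta> x\<^sub>1) (\<theta> x\<^sub>2)"
  have TT: "k_space K TT" by (rule spaces)
  have b: "bilin K A H TT ?b" by (rule ts | assumption)+
  have d: "bilin K E E TT ?d" by (rule ts | assumption)+
  have "\<Delta>\<^bsub>P\<^esub> x = tensor_lift K TT ?b x" by (simp add: Let_def)
  also have "\<dots> = sweedler K E TT ?d (\<psi> x)"
  proof (rule tensor_lin_eqI[OF A'(3) H'(3) TT tensor_lift_lin[OF A'(3) H'(3) TT b] _ _ x])
    show "(\<lambda>x. sweedler K E TT ?d (\<psi> x)) \<in> lin_maps K T TT" by (rule ts | assumption)+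
    fix a h assume a: "a \<in> carrier A" and h: "h \<in> carrier H"
    have ia: "i a \<in> carrier E" and \<phi>h: "\<phi> h \<in> carrier E" by (rule maps_closed a h)+
    have "sweedler K E TT ?d (\<psi> (pure_tensor K A H a h)) =
      sweedler K E TT (\<lambda>x\<^sub>1 x\<^sub>2. sweedler K E TT (\<lambda>y\<^sub>1 y\<^sub>2. ?d (x\<^sub>1 \<otimes>\<^bsub>E\<^esub> y\<^sub>1) (x\<^sub>2 \<otimes>\<^bsub>E\<^esub> y\<^sub>2)) (\<phi> h)) (i a)"
      unfolding \<psi>_pure[OF a h] by (rule sweedler_mult[OF bialg(3) TT d ia \<phi>h])
    also have "\<dots> = sweedler K A TT (\<lambda>a\<^sub>1 a\<^sub>2.
      sweedler K E TT (\<lambda>y\<^sub>1 y\<^sub>2. ?d (i a\<^sub>1 \<otimes>\<^bsub>E\<^esub> y\<^sub>1) (i a\<^sub>2 \<otimes>\<^bsub>E\<^esub> y\<^sub>2)) (\<phi> h)) a"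
      by (rule sweedler_coalgebra_map[OF A'(2) E'(2) TT hopf_mapsD(2)[OF i] _ a]) (rule ts h | assumption)+
    also have "\<dots> = ?b a h"
    proof (rule sweedler_cong[OF A'(2) TT a])
      show "bilin K A A TT (\<lambda>a\<^sub>1 a\<^sub>2.
        sweedler K E TT (\<lambda>y\<^sub>1 y\<^sub>2. ?d (i a\<^sub>1 \<otimes>\<^bsub>E\<^esub> y\<^sub>1) (i a\<^sub>2 \<otimes>\<^bsub>E\<^esub> y\<^sub>2)) (\<phi> h))"
        by (rule ts h | assumption)+
      fix a\<^sub>1 a\<^sub>2 assume a12: "a\<^sub>1 \<in> carrier A" "a\<^sub>2 \<in> carrier A"
      have "sweedler K E TT (\<lambda>y\<^sub>1 y\<^sub>2. ?d (i a\<^sub>1 \<otimes>\<^bsub>E\<^esub> y\<^sub>1) (i a\<^sub>2 \<otimes>\<^bsub>E\<^esub> y\<^sub>2)) (\<phi> h) =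
        sweedler K H TT (\<lambda>h\<^sub>1 h\<^sub>2. ?d (i a\<^sub>1 \<otimes>\<^bsub>E\<^esub> \<phi> h\<^sub>1) (i a\<^sub>2 \<otimes>\<^bsub>E\<^esub> \<phi> h\<^sub>2)) h"
        by (rule sweedler_coalgebra_map[OF H'(2) E'(2) TT \<phi> _ h]) (rule ts a12 | assumption)+
      also have "\<dots> = sweedler K H TT (?c a\<^sub>1 a\<^sub>2) h"
        by (rule sweedler_cong[OF H'(2) TT h]) ((rule ts a12 | assumption)+, simp add: \<theta>_i_\<phi> a12)
      finally show "sweedler K E TT (\<lambda>y\<^sub>1 y\<^sub>2. ?d (i a\<^sub>1 \<otimes>\<^bsub>E\<^esub> y\<^sub>1) (i a\<^sub>2 \<otimes>\<^bsub>E\<^esub> y\<^sub>2)) (\<phi> h) = \<dots>" .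
    qed
    finally show "tensor_lift K TT ?b (pure_tensor K A H a h) = sweedler K E TT ?d (\<psi> (pure_tensor K A H a h))"
      by (simp add: tensor_lift_pure[OF A'(3) H'(3) TT b a h])
  qed
  finally show ?thesis .
qed

lemma counit_P:
  assumes x: "x \<in> carrier T" shows "\<epsilon>\<^bsub>P\<^esub> x = \<epsilon>\<^bsub>E\<^esub> (\<psi> x)"
proof -
  let ?b = "\<lambda>a h. \<epsilon>\<^bsub>A\<^esub> a \<otimes>\<^bsub>K\<^esub> \<epsilon>\<^bsub>H\<^esub> h"
  note sc = scalars_k_space[OF field_K]
  have "bilin K A H (scalars K) (\<lambda>a h. \<epsilon>\<^bsub>A\<^esub> a \<odot>\<^bsub>scalars K\<^esub> \<epsilon>\<^bsub>H\<^esub> h)"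
    by (rule bilin_rule; rule smult_left smult_right)
      (rule ms lin_closed[OF counit_lin[OF H'(2)]] | assumption)+
  then have b: "bilin K A H (scalars K) ?b" by (simp add: scalars_def)
  show ?thesis unfolding crossed_product_simps tensor_coalgebra_simps
  proof (rule tensor_lin_eqI[OF A'(3) H'(3) sc tensor_lift_lin[OF A'(3) H'(3) sc b] _ _ x])
    show "(\<lambda>x. \<epsilon>\<^bsub>E\<^esub> (\<psi> x)) \<in> lin_maps K T (scalars K)" by (rule ts | assumption)+
    fix a h assume a: "a \<in> carrier A" and h: "h \<in> carrier H"
    have ia: "i a \<in> carrier E" and \<phi>h: "\<phi> h \<in> carrier E" by (rule maps_closed a h)+
    show "tensor_lift K (scalars K) ?b (pure_tensor K A H a h) = \<epsilon>\<^bsub>E\<^esub> (\<psi> (pure_tensor K A H a h))"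
      by (simp add: tensor_lift_pure[OF A'(3) H'(3) sc b a h] \<psi>_pure[OF a h]
          counit_ring_hom(1)[OF bialg(3) ia \<phi>h] coalgebra_mapsD(3)[OF \<phi> h]
          coalgebra_mapsD(3)[OF hopf_mapsD(2)[OF i] a])
  qed
qed

text \<open>
Apply \<open>\<epsilon> \<otimes> id\<close> to \<open>\<rho>(i a) = i a \<otimes> 1\<close>.
\<close>

lemma \<pi>_i:
  assumes a: "a \<in> carrier A" shows "\<pi> (i a) = \<epsilon>\<^bsub>A\<^esub> a \<odot>\<^bsub>H\<^esub> \<one>\<^bsub>H\<^esub>"
proof -
  have ia: "i a \<in> carrier E" by (rule maps_closed a)+
  have "\<pi> (i a) = coact H (\<lambda>u h. \<epsilon>\<^bsub>E\<^esub> u \<odot>\<^bsub>H\<^esub> h) (i a)"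
    unfolding coact_def by (rule sweedler_counit_left[OF E'(2) H'(3) \<pi>0 ia, symmetric])
  also have "\<dots> = \<epsilon>\<^bsub>E\<^esub> (i a) \<odot>\<^bsub>H\<^esub> \<one>\<^bsub>H\<^esub>"
    by (rule coact_i[OF H'(3) _ a]) (rule ms | assumption)+
  finally show ?thesis by (simp add: coalgebra_mapsD(3)[OF hopf_mapsD(2)[OF i] a])
qed

lemma crossed_proj_\<psi>:
  assumes x: "x \<in> carrier T" shows "crossed_proj K A H x = \<pi> (\<psi> x)"
proof -
  let ?b = "\<lambda>a h. \<epsilon>\<^bsub>A\<^esub> a \<odot>\<^bsub>H\<^esub> h"
  have b: "bilin K A H H ?b" by (rule ms | assumption)+
  show ?thesis unfolding crossed_proj_def
    by (rule tensor_lin_eqI[OF A'(3) H'(3) H'(3) tensor_lift_lin[OF A'(3) H'(3) H'(3) b] _ _ x])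
      ((rule ts | assumption)+, simp add: tensor_lift_pure[OF A'(3) H'(3) H'(3) b] \<psi>_pure \<pi>_mult
        maps_closed \<pi>_i \<pi>\<phi> k_algebraD(3)[OF H'(1)] counit_closed[OF A'(2)])
qed

lemma lin_maps_P:
  "lin_maps K V P = lin_maps K V T" "lin_maps K P V = lin_maps K T V"
  unfolding lin_maps_def by simp_all

lemma tensor_P: "tensor_space K P P = TT" "pure_tensor K P P = pure_tensor K T T"
  by (rule tensor_ops_cong; simp)+

lemma transport_P: "transport K E P \<theta> \<psi>"
proof
  show "hopf_algebra K E" by (rule hopf_E)
  show "k_space K P" by (rule k_space_ops_cong[OF spaces(4)]) simp_all
  show "\<theta> \<in> lin_maps K E P" "\<psi> \<in> lin_maps K P E" unfolding lin_maps_P by (rule \<theta>_lin \<psi>_lin)+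
  show "\<one>\<^bsub>P\<^esub> = \<theta> \<one>\<^bsub>E\<^esub>"
    using \<theta>_i_\<phi>[OF A.one_closed H.one_closed] by (simp add: i_one \<phi>_one)
next
  fix x assume x: "x \<in> carrier E"
  then have \<theta>x: "\<theta> x \<in> carrier T" by (rule lin_closed[OF \<theta>_lin])
  show "\<psi> (\<theta> x) = x" by (rule \<psi>_\<theta>[OF x])
  show "\<Delta>\<^bsub>P\<^esub> (\<theta> x) = sweedler K E (tensor_space K P P) (\<lambda>x\<^sub>1 x\<^sub>2. pure_tensor K P P (\<theta> x\<^sub>1) (\<theta> x\<^sub>2)) x"
    unfolding tensor_P comult_P[OF \<theta>x] \<psi>_\<theta>[OF x] ..
  show "\<epsilon>\<^bsub>P\<^esub> (\<theta> x) = \<epsilon>\<^bsub>E\<^esub> x" unfolding counit_P[OF \<theta>x] \<psi>_\<theta>[OF x] ..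
  fix x' assume x': "x' \<in> carrier E"
  then have \<theta>x': "\<theta> x' \<in> carrier T" by (rule lin_closed[OF \<theta>_lin])
  show "\<theta> x \<otimes>\<^bsub>P\<^esub> \<theta> x' = \<theta> (x \<otimes>\<^bsub>E\<^esub> x')"
    using \<theta>_\<psi>[OF mult_P_closed[OF \<theta>x \<theta>x']] by (simp add: \<psi>_mult[OF \<theta>x \<theta>x'] \<psi>_\<theta> x x')
next
  fix y assume "y \<in> carrier P"
  then show "\<theta> (\<psi> y) = y" by (simp add: \<theta>_\<psi>)
qed

end

theorem proposition1p3:
  fixes K :: "'k ring"
    and A :: "('k, 'a) bialg" and H :: "('k, 'h) bialg" and E :: "('k, 'e) bialg"
    and i :: "'a \<Rightarrow> 'e" and \<pi> :: "'e \<Rightarrow> 'h"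
  assumes "field K"
    and "hopf_algebra K A" and "hopf_algebra K H"
    and "coalgebra_split_extension K A H E i \<pi>"
  shows "\<exists>act f. crossed_system K A H act f \<and>
           equivalent_extensions K A H E i \<pi>
             (crossed_product K A H act f) (crossed_incl K A H) (crossed_proj K A H)"
proof -
  note ext = assms(4)
  obtain \<phi>\<^sub>0 where E: "hopf_algebra K E" and i: "i \<in> hopf_maps K A E" "inj_on i (carrier A)"
    and \<pi>: "\<pi> \<in> hopf_maps K E H"
    and \<phi>0: "\<phi>\<^sub>0 \<in> coalgebra_maps K H E" "\<And>h. h \<in> carrier H \<Longrightarrow> \<pi> (\<phi>\<^sub>0 h) = h"
    and co: "i ` carrier A = coinvariants K E H \<pi>"
    using ext unfolding coalgebra_split_extension_def by auto
  have H: "bialgebra K H" using assms(3) unfolding hopf_algebra_def by simp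
  obtain \<phi> where \<phi>: "\<phi> \<in> coalgebra_maps K H E" "\<And>h. h \<in> carrier H \<Longrightarrow> \<pi> (\<phi> h) = h" "\<phi> \<one>\<^bsub>H\<^esub> = \<one>\<^bsub>E\<^esub>"
    using unital_section[OF E H \<pi> \<phi>0] by blast
  obtain S where S: "antipode K E S" using E unfolding hopf_algebra_def by auto
  interpret X: split_extension K A H E i \<pi> \<phi> S
    by unfold_locales (use assms(2,3) E i \<pi> \<phi> co S in auto)
  interpret P: transport K E X.P X.\<theta> X.\<psi> by (rule X.transport_P)
  have "crossed_system K A H X.act X.cocycle"
    unfolding crossed_system_def using X.weak_action_act X.cocycle_lin P.hopf_B by simp
  moreover have "equivalent_extensions K A H E i \<pi> X.P (crossed_incl K A H) (crossed_proj K A H)"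
  proof (rule P.equivalent_extension[OF assms(2,3) ext])
    fix a assume a: "a \<in> carrier A"
    show "crossed_incl K A H a = X.\<theta> (i a)"
      using X.\<theta>_i_\<phi>[OF a X.H.one_closed] a by (simp add: crossed_incl_def X.\<phi>_one X.maps_closed)
  next
    fix x assume "x \<in> carrier X.P"
    then show "crossed_proj K A H x = \<pi> (X.\<psi> x)" by (simp add: X.crossed_proj_\<psi>)
  qed
  ultimately show ?thesis by blast
qed

end
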